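(* Let $(N,B,L)$ be a Hadamard triple in $\mathbb{R}$ with $0\in B\cap L$, and let $(\mu_{N,B},\Lambda)$ be the canonical spectral pair generated by $(N,B,L)$. (i) If $\#B < N^{0.677}$, then there are infinitely many prime spectral eigenvalues of $(\mu_{N,B},\Lambda)$. Furthermore, $$\liminf_{x\to+\infty}\frac{\#\{p\le x:\ p \text{ is a prime and a spectral eigenvalue of } (\mu_{N,B},\Lambda)\}}{\pi(x)}>0.$$ (ii) If $\#B<N^{1/2}$, then almost all primes are spectral eigenvalues of $(\mu_{N,B},\Lambda)$ in the sense that $$\lim_{x\to+\infty}\frac{\#\{p\le x:\ p \text{ is a prime and a spectral eigenvalue of } (\mu_{N,B},\Lambda)\}}{\pi(x)}=1.$$
   Context: $\#A$ denotes the cardinality of a set $A$, and $\pi(x)$ is the number of primes not exceeding $x$. Spectral pairs: for a Borel probability measure $\mu$ on $\mathbb{R}$ and a countable set $\Lambda\subset\mathbb{R}$, $(\mu,\Lambda)$ is a spectral pair (and $\Lambda$ is a spectrum of $\mu$) if $\{e_\lambda(x)=e^{2\pi \mathrm{i}\lambda x}:\lambda\in\Lambda\}$ is an orthonormal basis of $L^2(\mu)$. A real number $t$ is a spectral eigenvalue of the spectral pair $(\mu,\Lambda)$ if $(\mu,t\Lambda)$ is also a spectral pair. Hadamard triple: let $N\ge 2$ be an integer and $B,L\subset\mathbb{Z}$ finite sets with $\#B=\#L\ge 2$. $(N,B,L)$ is a Hadamard triple in $\mathbb{R}$ if the matrix $\left(\frac{1}{\sqrt{\#B}}e^{2\pi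 \mathrm{i} b\ell/N}\right)_{b\in B,\ell\in L}$ is unitary. Self-similar measure: $\mu_{N,B}$ is the unique Borel probability measure $\mu$ on $\mathbb{R}$ satisfying $\mu=\frac{1}{\#B}\sum_{b\in B}\mu\circ\tau_b^{-1}$, where $\tau_b(x)=(x+b)/N$. Canonical spectral pair: let $(N,B,L)$ be a Hadamard triple with $0\in B\cap L$. Let $m_B(x)=\frac{1}{\#B}\sum_{b\in B}e^{2\pi \mathrm{i}bx}$ and $\tau_\ell(x)=(x+\ell)/N$ for $\ell\in L$. A finite set $C=\{x_1,\dots,x_k\}\subset\mathbb{R}$ is a cycle if there are $\ell_1,\dots,\ell_k\in L$ with $\tau_{\ell_j}(x_j)=x_{j+1}$ for $1\le j\le k-1$ and $\tau_{\ell_k}(x_k)=x_1$; it is an $m_B$-cycle if in addition $|m_B(x_j)|=1$ for all $1\le j\le k$. Let $\Lambda$ be the smallest set that contains $-C$ for all $m_B$-cycles $C$ and satisfies $N\Lambda+L\subset\Lambda$. It is known (Dutkay–Jorgensen) that $\Lambda$ is a spectrum of $\mu_{N,B}$; the pair $(\mu_{N,B},\Lambda)$ is called the canonical spectral pair generated by $(N,B,L)$. *)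

theory Defs
  imports "HOL-Probability.Probability" "HOL-Computational_Algebra.Primes"
begin

definition exponential :: "real \<Rightarrow> real \<Rightarrow> complex" where
  "exponential lam x = cis (2 * pi * lam * x)"

definition square_integrable :: "'a measure \<Rightarrow> ('a \<Rightarrow> complex) \<Rightarrow> bool" where
  "square_integrable M f \<longleftrightarrow>
     f \<in> borel_measurable M \<and> integrable M (\<lambda>x. (norm (f x))\<^sup>2)"

text \<open>
  Elements of \<open>L\<^sup>2(M)\<close> are represented by square-integrable functions, and the Hilbert space
  notions are spelled out for representatives.  An orthonormal basis is an orthonormal family
  whose finite linear combinations are dense in \<open>L\<^sup>2(M)\<close>.
\<close>

definition orthonormal_basis_L2 :: "'a measure \<Rightarrow> ('i \<Rightarrow> 'a \<Rightarrow> complex) \<Rightarrow> 'i set \<Rightarrow> bool" where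
  "orthonormal_basis_L2 M e I \<longleftrightarrow>
     (\<forall>i\<in>I. square_integrable M (e i)) \<and>
     (\<forall>i\<in>I. \<forall>j\<in>I. (LINT x|M. e i x * cnj (e j x)) = (if i = j then 1 else 0)) \<and>
     (\<forall>f. square_integrable M f \<longrightarrow>
        (\<forall>\<epsilon>>0. \<exists>F c. finite F \<and> F \<subseteq> I \<and>
           (LINT x|M. (norm (f x - (\<Sum>i\<in>F. c i * e i x)))\<^sup>2) < \<epsilon>))"

definition spectral_pair :: "real measure \<Rightarrow> real set \<Rightarrow> bool" where
  "spectral_pair \<mu> \<Lambda> \<longleftrightarrow>
     prob_space \<mu> \<and> sets \<mu> = sets borel \<and> countable \<Lambda> \<and>
     orthonormal_basis_L2 \<mu> exponential \<Lambda>"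

definition spectral_eigenvalue :: "real measure \<Rightarrow> real set \<Rightarrow> real \<Rightarrow> bool" where
  "spectral_eigenvalue \<mu> \<Lambda> t \<longleftrightarrow>
     spectral_pair \<mu> \<Lambda> \<and> spectral_pair \<mu> ((\<lambda>x. t * x) ` \<Lambda>)"

text \<open>Unitarity of a matrix whose rows and columns are indexed by finite sets.\<close>

definition unitary_on :: "'i set \<Rightarrow> 'j set \<Rightarrow> ('i \<Rightarrow> 'j \<Rightarrow> complex) \<Rightarrow> bool" where
  "unitary_on I J H \<longleftrightarrow>
     (\<forall>i\<in>I. \<forall>i'\<in>I. (\<Sum>j\<in>J. H i j * cnj (H i' j)) = (if i = i' then 1 else 0)) \<and>
     (\<forall>j\<in>J. \<forall>j'\<in>J. (\<Sum>i\<in>I. cnj (H i j) * H i j') = (if j = j' then 1 else 0))"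

definition hadamard_triple :: "int \<Rightarrow> int set \<Rightarrow> int set \<Rightarrow> bool" where
  "hadamard_triple N B L \<longleftrightarrow>
     N \<ge> 2 \<and> finite B \<and> finite L \<and> card B = card L \<and> card B \<ge> 2 \<and>
     unitary_on B L
       (\<lambda>b l. of_real (1 / sqrt (real (card B))) *
              cis (2 * pi * real_of_int b * real_of_int l / real_of_int N))"

definition contraction :: "int \<Rightarrow> int \<Rightarrow> real \<Rightarrow> real" where
  "contraction N d x = (x + real_of_int d) / real_of_int N"

definition is_self_similar_measure :: "int \<Rightarrow> int set \<Rightarrow> real measure \<Rightarrow> bool" where
  "is_self_similar_measure N B \<mu> \<longleftrightarrow>
     prob_space \<mu> \<and> sets \<mu> = sets borel \<and>
     (\<forall>A\<in>sets borel.
        measure \<mu> A = 1 / real (card B) * (\<Sum>b\<in>B. measure \<mu> (contraction N b -` A)))"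

text \<open>
  By Hutchinson's theorem there is exactly one such measure when \<open>N \<ge> 2\<close> and \<open>B\<close> is finite
  and nonempty.
\<close>

definition self_similar_measure :: "int \<Rightarrow> int set \<Rightarrow> real measure" where
  "self_similar_measure N B = (THE \<mu>. is_self_similar_measure N B \<mu>)"

definition mask :: "int set \<Rightarrow> real \<Rightarrow> complex" where
  "mask B x = 1 / of_nat (card B) * (\<Sum>b\<in>B. cis (2 * pi * real_of_int b * x))"

definition is_cycle :: "int \<Rightarrow> int set \<Rightarrow> real set \<Rightarrow> bool" where
  "is_cycle N L C \<longleftrightarrow>
     (\<exists>k\<ge>1. \<exists>(x :: nat \<Rightarrow> real) (l :: nat \<Rightarrow> int).
        C = x ` {1..k} \<and> l ` {1..k} \<subseteq> L \<and>
        (\<forall>j\<in>{1..<k}. contraction N (l j) (x j) = x (j + 1)) \<and>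
        contraction N (l k) (x k) = x 1)"

definition is_mask_cycle :: "int \<Rightarrow> int set \<Rightarrow> int set \<Rightarrow> real set \<Rightarrow> bool" where
  "is_mask_cycle N B L C \<longleftrightarrow> is_cycle N L C \<and> (\<forall>x\<in>C. norm (mask B x) = 1)"

inductive_set canonical_spectrum :: "int \<Rightarrow> int set \<Rightarrow> int set \<Rightarrow> real set"
  for N :: int and B L :: "int set" where
  cycle: "is_mask_cycle N B L C \<Longrightarrow> x \<in> C \<Longrightarrow> - x \<in> canonical_spectrum N B L"
| step: "y \<in> canonical_spectrum N B L \<Longrightarrow> l \<in> L \<Longrightarrow>
    real_of_int N * y + real_of_int l \<in> canonical_spectrum N B L"

definition prime_eigenvalues :: "int \<Rightarrow> int set \<Rightarrow> int set \<Rightarrow> nat set" where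
  "prime_eigenvalues N B L =
     {p. prime p \<and>
         spectral_eigenvalue (self_similar_measure N B) (canonical_spectrum N B L) (real p)}"

definition count_upto :: "nat set \<Rightarrow> real \<Rightarrow> nat" where
  "count_upto P x = card {p \<in> P. real p \<le> x}"

definition prime_counting :: "real \<Rightarrow> nat" where
  "prime_counting x = card {p :: nat. prime p \<and> real p \<le> x}"

end

(*
  Spectrality of the canonical pair: the function Q(xi) = sum over Lambda of |mu^(xi + lambda)|^2 is
  bounded by 1 and satisfies Q(xi) = sum over l in L of |m_B((xi+l)/N)|^2 Q((xi+l)/N).  Its
  minimizers on an interval form a closed set that is invariant under the branches with nonzero
  weight; an infinite one contains a point whose iterated contractions stay in it and tend to 0,
  and a finite one contains an m_B-cycle.  As Q = 1 at 0 and at cycle points, Q = 1 identically.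

  Primes: for large p the triple (N, B, pL) is again Hadamard, so p is an eigenvalue unless p L has
  an m_B-cycle that is not p times an m_B-cycle of L.  Such a cycle yields at least ord_p(N) points
  of the attractor of L of the form a/(b p) with p not dividing a, for one of the finitely many
  nonzero b in B.  For different primes p <= x these fractions are separated by a multiple of
  x^(-2), so there are at most O(x^(2 alpha)) of them, where (#B) = N^alpha.  Only O(y^2) primes
  have ord_p(N) <= y; with y = x^0.4 all but O(x^0.8 + x^(2 alpha - 0.4)) primes up to x are
  eigenvalues.  This is o(x / log x) as soon as alpha <= 0.677, so that the density is 1 in both
  parts, without any result on large prime factors of p - 1.
*)
theory Submission
  imports Defs "HOL-Number_Theory.Number_Theory" "HOL-Real_Asymp.Real_Asymp"
begin

section \<open>The self-similar measure and its Fourier transform\<close>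

text \<open>A prime p is an eigenvalue as soon as p \<Lambda> is itself a canonical spectrum, namely
  that of (N, B, pL); completeness is therefore proved for every Hadamard triple with 0 in B and L
  and used for both L and pL. Scaling by p turns mask cycles into mask cycles. Scaling back by 1/p
  preserves cycles but may turn an integer b x into a fraction, and this is the only obstruction.
  Going backwards in a cycle replaces y by N y - l, so the integer p b y is multiplied by N modulo p
  at each step: hence the multiplicative order. The attractor is covered by (#L)^m intervals of
  length about N^(-m), and N^m of size x^2 gives the bound for separated points. Primes of order at
  most y divide the product of the numbers N^n - 1 with n <= y, whose logarithm is O(y^2). For y =
  x^s the errors are x^(2 s) and x^(2 alpha - s); both save a power of x when 2 alpha - 1 < s < 1/2,
  and s = 0.4 exceeds 2 alpha - 1 = 0.354 for alpha = 0.677. Against a power saving, a Chebyshev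
  lower bound of order x / log x for the number of primes is enough.\<close>

definition fourier :: "real measure \<Rightarrow> real \<Rightarrow> complex" where
  "fourier M \<xi> = (LINT x|M. exponential \<xi> x)"

lemma exponential_conv_iexp: "exponential \<xi> x = iexp ((2 * pi * \<xi>) * x)"
  by (simp add: exponential_def cis_conv_exp)

lemma fourier_conv_char: "fourier M \<xi> = char M (2 * pi * \<xi>)"
  by (simp add: fourier_def char_def exponential_conv_iexp)

lemma exponential_add: "exponential (\<xi> + \<eta>) x = exponential \<xi> x * exponential \<eta> x"
  by (simp add: exponential_def cis_mult algebra_simps)

lemma exponential_minus: "exponential (- \<xi>) x = cnj (exponential \<xi> x)"
  by (simp add: exponential_def cis_cnj)

lemma exponential_mult_cnj: "exponential \<xi> x * cnj (exponential \<eta> x) = exponential (\<xi> - \<eta>) x"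
  using exponential_add[of \<xi> "- \<eta>" x] by (simp add: exponential_minus)

lemma norm_exponential [simp]: "norm (exponential \<xi> x) = 1"
  by (simp add: exponential_def)

lemma continuous_on_exponential [continuous_intros]: "continuous_on A (exponential \<xi>)"
  unfolding exponential_def by (intro continuous_intros)

lemma borel_measurable_exponential [measurable]: "exponential \<xi> \<in> borel_measurable borel"
  by (intro borel_measurable_continuous_onI continuous_intros)

lemma measurable_contraction [measurable]: "contraction N b \<in> borel_measurable borel"
  unfolding contraction_def by simp

lemma norm_mask_le: "norm (mask B x) \<le> 1"
proof -
  have "norm (\<Sum>b\<in>B. cis (2 * pi * real_of_int b * x)) \<le> (\<Sum>b\<in>B. 1)"
    by (rule sum_norm_le) simp
  then show ?thesis
    by (cases "card B = 0") (simp_all add: mask_def norm_mult norm_divide field_simps)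
qed

lemma isCont_fourier:
  assumes "prob_space \<mu>" "sets \<mu> = sets borel"
  shows "isCont (fourier \<mu>) \<xi>"
proof -
  interpret real_distribution \<mu>
    using assms by (simp add: real_distribution_def real_distribution_axioms_def)
  have "isCont (\<lambda>\<xi>. char \<mu> (2 * pi * \<xi>)) \<xi>"
    by (rule isCont_o2[OF _ isCont_char]) (intro continuous_intros)
  then show ?thesis by (simp add: fourier_conv_char[abs_def])
qed

lemma fourier_0: "prob_space \<mu> \<Longrightarrow> fourier \<mu> 0 = 1"
  by (simp add: fourier_def exponential_def prob_space.prob_space)

section \<open>Random digit expansions, the functional equation and uniqueness\<close>

context
  fixes N :: int and B :: "int set"
  assumes N2: "N \<ge> 2" and finB: "finite B" and neB: "B \<noteq> {}"
begin

abbreviation (input) digit_pmf :: "int pmf" where "digit_pmf \<equiv> pmf_of_set B"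

lemma measurable_case_contraction:
  assumes "sets \<mu> = sets borel"
  shows "(\<lambda>(b, x). contraction N b x) \<in> measurable (measure_pmf digit_pmf \<Otimes>\<^sub>M \<mu>) borel"
proof -
  have "(\<lambda>(b, x). contraction N b x) \<in>
      measurable (count_space UNIV \<Otimes>\<^sub>M (borel :: real measure)) borel"
    by (rule measurable_pair_measure_countable1) auto
  then show ?thesis
    using assms by (simp cong: measurable_cong_sets sets_pair_measure_cong)
qed

lemma measure_distr_contraction:
  assumes "prob_space \<mu>" and sets: "sets \<mu> = sets borel" and A: "A \<in> sets borel"
  shows "measure (distr (measure_pmf digit_pmf \<Otimes>\<^sub>M \<mu>) borel (\<lambda>(b, x). contraction N b x)) A =
    1 / real (card B) * (\<Sum>b\<in>B. measure \<mu> (contraction N b -` A))"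
proof -
  interpret prob_space \<mu> by fact
  note m = measurable_case_contraction[OF sets]
  have "emeasure (distr (measure_pmf digit_pmf \<Otimes>\<^sub>M \<mu>) borel (\<lambda>(b, x). contraction N b x)) A =
    emeasure (measure_pmf digit_pmf \<Otimes>\<^sub>M \<mu>)
      ((\<lambda>(b, x). contraction N b x) -` A \<inter> space (measure_pmf digit_pmf \<Otimes>\<^sub>M \<mu>))"
    using m A by (rule emeasure_distr)
  also have "\<dots> = (\<integral>\<^sup>+ b. emeasure \<mu> (contraction N b -` A) \<partial>measure_pmf digit_pmf)"
    using sets_eq_imp_space_eq[OF sets] measurable_sets[OF m A]
    by (subst emeasure_pair_measure_alt)
       (auto intro!: nn_integral_cong arg_cong[where f = "emeasure \<mu>"] simp: space_pair_measure)
  also have "\<dots> = (\<Sum>b\<in>B. emeasure \<mu> (contraction N b -` A)) / card B"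
    using finB neB by (subst nn_integral_pmf_of_set) auto
  also have "\<dots> = ennreal (1 / real (card B) * (\<Sum>b\<in>B. measure \<mu> (contraction N b -` A)))"
    using finB neB by (simp add: emeasure_eq_measure divide_ennreal ennreal_of_nat_eq_real_of_nat
        sum_nonneg card_gt_0_iff)
  finally show ?thesis
    by (simp add: measure_def sum_nonneg)
qed

text \<open>Stationarity in terms of a random variable: x has the same law as (x + b) / N with b an
  independent uniform digit. In this form integrals can be computed by change of variables and
  Fubini.\<close>

lemma is_self_similar_measure_iff_distr:
  "is_self_similar_measure N B \<mu> \<longleftrightarrow> prob_space \<mu> \<and> sets \<mu> = sets borel \<and>
     distr (measure_pmf digit_pmf \<Otimes>\<^sub>M \<mu>) borel (\<lambda>(b, x). contraction N b x) = \<mu>"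
  (is "_ \<longleftrightarrow> _ \<and> _ \<and> ?D = _")
proof (cases "prob_space \<mu> \<and> sets \<mu> = sets borel")
  case True
  then interpret prob_space \<mu> by simp
  interpret P: pair_prob_space "measure_pmf digit_pmf" \<mu> ..
  have sets: "sets \<mu> = sets borel" using True by simp
  interpret D: prob_space ?D
    by (rule P.prob_space_distr[OF measurable_case_contraction[OF sets]])
  have "?D = \<mu> \<longleftrightarrow> (\<forall>A\<in>sets borel. measure \<mu> A = measure ?D A)"
    using sets by (auto intro!: measure_eqI simp: emeasure_eq_measure D.emeasure_eq_measure)
  then show ?thesis
    using True by (simp add: is_self_similar_measure_def measure_distr_contraction)
qed (auto simp: is_self_similar_measure_def)

text \<open>The coding map of the iterated function system of the maps
  \<open>contraction N b\<close>. The series may diverge for streams with digits outside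
  \<open>B\<close>; these form a null set by \<open>AE_streams\<close>.\<close>

definition expansion :: "int stream \<Rightarrow> real" where
  "expansion \<omega> = (\<Sum>n. real_of_int (\<omega> !! n) / real_of_int N ^ Suc n)"

text \<open>Bounds the support of the measure: replacing N by 2 in the series leaves the weights 1 /
  2^(n+1), whose total is 1.\<close>

definition digit_bound :: real where
  "digit_bound = real_of_int (Max (abs ` B))"

lemma digit_bound: "b \<in> B \<Longrightarrow> \<bar>real_of_int b\<bar> \<le> digit_bound"
  unfolding digit_bound_def using finB by (metis Max_ge finite_imageI image_eqI of_int_abs of_int_le_iff)

lemma digit_bound_nonneg: "digit_bound \<ge> 0"
  using digit_bound neB by fastforce

lemma expansion_term_bound:
  assumes "\<omega> \<in> streams B"
  shows "norm (real_of_int (\<omega> !! n) / real_of_int N ^ Suc n) \<le> digit_bound * (1/2) ^ Suc n"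
proof -
  have "norm (real_of_int (\<omega> !! n) / real_of_int N ^ Suc n) =
      \<bar>real_of_int (\<omega> !! n)\<bar> / real_of_int N ^ Suc n"
    using N2 by (simp add: abs_mult)
  also have "\<dots> \<le> digit_bound / 2 ^ Suc n"
    using N2 assms
    by (intro frac_le power_mono digit_bound digit_bound_nonneg) (auto simp: streams_iff_snth)
  finally show ?thesis by (simp add: power_one_over field_simps)
qed

lemma sums_bound: "(\<lambda>n. digit_bound * (1/2) ^ Suc n) sums digit_bound"
  using sums_mult[OF power_half_series, of digit_bound] by simp

lemma summable_expansion:
  "\<omega> \<in> streams B \<Longrightarrow> summable (\<lambda>n. real_of_int (\<omega> !! n) / real_of_int N ^ Suc n)"
  by (rule summable_comparison_test'[OF sums_summable[OF sums_bound]]) (rule expansion_term_bound)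

lemma abs_expansion_le:
  assumes "\<omega> \<in> streams B"
  shows "\<bar>expansion \<omega>\<bar> \<le> digit_bound"
proof -
  have "norm (expansion \<omega>) \<le> (\<Sum>n. digit_bound * (1/2) ^ Suc n)"
    unfolding expansion_def using sums_summable[OF sums_bound] expansion_term_bound[OF assms]
    by (rule norm_suminf_le[rotated])
  then show ?thesis using sums_unique[OF sums_bound] by simp
qed

lemma expansion_Stream:
  assumes "b \<in> B" "\<omega> \<in> streams B"
  shows "expansion (b ## \<omega>) = contraction N b (expansion \<omega>)"
proof -
  have b\<omega>: "b ## \<omega> \<in> streams B" using assms by auto
  have "expansion (b ## \<omega>) = (\<Sum>n. real_of_int (\<omega> !! n) / real_of_int N ^ Suc (Suc n)) + b / N"
    unfolding expansion_def using suminf_split_head[OF summable_expansion[OF b\<omega>]] by simp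
  also have "(\<Sum>n. real_of_int (\<omega> !! n) / real_of_int N ^ Suc (Suc n)) =
      (\<Sum>n. (real_of_int (\<omega> !! n) / real_of_int N ^ Suc n) / N)"
    by (simp add: divide_divide_eq_left mult.assoc mult.commute)
  also have "\<dots> = expansion \<omega> / N"
    unfolding expansion_def using summable_expansion[OF assms(2)] by (rule suminf_divide)
  finally show ?thesis by (simp add: contraction_def add_divide_distrib)
qed

lemma measurable_expansion: "expansion \<in> borel_measurable (stream_space (measure_pmf digit_pmf))"
proof -
  have "(\<lambda>\<omega>. real_of_int (\<omega> !! n)) \<in> borel_measurable (stream_space (measure_pmf digit_pmf))" for n
    by (rule measurable_compose[OF measurable_snth]) simp
  then show ?thesis unfolding expansion_def by simp
qed

lemma AE_streams: "AE \<omega> in stream_space (measure_pmf digit_pmf). \<omega> \<in> streams B"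
proof -
  have "AE \<omega> in stream_space (measure_pmf digit_pmf). stream_all (\<lambda>b. b \<in> B) \<omega>"
    using finB neB
    by (subst prob_space.AE_stream_all[OF prob_space_measure_pmf]) (auto simp: AE_measure_pmf_iff)
  then show ?thesis by (simp add: streams_iff_snth stream.pred_set sset_range ball_UNIV flip: Ball_def)
qed

text \<open>The law of \<open>expansion\<close> under independent uniform digits; splitting off the
  first digit turns \<open>expansion_Stream\<close> into self-similarity. The bound on the support
  is kept because the Stone-Weierstrass argument needs a compact interval.\<close>

lemma self_similar_measure_exists:
  obtains \<mu> where "is_self_similar_measure N B \<mu>" "AE x in \<mu>. \<bar>x\<bar> \<le> digit_bound"
proof
  let ?D = "measure_pmf digit_pmf" and ?S = "stream_space (measure_pmf digit_pmf)"
  let ?\<mu> = "distr ?S borel expansion"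
  note [measurable] = measurable_expansion
  interpret S: prob_space ?S by (rule prob_space.prob_space_stream_space[OF prob_space_measure_pmf])
  interpret M: prob_space ?\<mu> by (rule S.prob_space_distr[OF measurable_expansion])
  have [simp]: "space ?S = UNIV" by (simp add: space_stream_space)
  have "measure ?\<mu> A = 1 / real (card B) * (\<Sum>b\<in>B. measure ?\<mu> (contraction N b -` A))"
    if A [measurable]: "A \<in> sets borel" for A
  proof -
    have meas: "expansion -` A \<in> sets ?S"
      using measurable_sets[OF measurable_expansion A] by simp
    have cA [measurable]: "contraction N b -` A \<in> sets borel" for b
      using measurable_sets[OF measurable_contraction[of N b] A] by simp
    have "emeasure ?S {\<omega>. b ## \<omega> \<in> expansion -` A} = emeasure ?\<mu> (contraction N b -` A)"
      if "b \<in> B" for b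
    proof -
      have "emeasure ?S {\<omega>. b ## \<omega> \<in> expansion -` A} = emeasure ?S (expansion -` contraction N b -` A)"
      proof (rule emeasure_eq_AE)
        show "AE \<omega> in ?S. \<omega> \<in> {\<omega>. b ## \<omega> \<in> expansion -` A} \<longleftrightarrow>
            \<omega> \<in> expansion -` contraction N b -` A"
          using AE_streams by eventually_elim (simp add: expansion_Stream[OF that])
        have "(\<lambda>\<omega>. b ## \<omega>) \<in> measurable ?S ?S" by simp
        from measurable_sets[OF this meas] show "{\<omega>. b ## \<omega> \<in> expansion -` A} \<in> sets ?S"
          by (simp add: vimage_def)
        show "expansion -` contraction N b -` A \<in> sets ?S"
          using measurable_sets[OF measurable_expansion cA] by simp
      qed
      then show ?thesis using cA by (simp add: emeasure_distr)
    qed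
    then have "emeasure ?\<mu> A = (\<Sum>b\<in>B. emeasure ?\<mu> (contraction N b -` A)) / card B"
      using finB neB
      by (simp add: emeasure_distr prob_space.emeasure_stream_space[OF prob_space_measure_pmf meas] nn_integral_pmf_of_set)
    also have "\<dots> = ennreal (1 / real (card B) * (\<Sum>b\<in>B. measure ?\<mu> (contraction N b -` A)))"
      using finB neB by (simp add: M.emeasure_eq_measure divide_ennreal ennreal_of_nat_eq_real_of_nat
          sum_nonneg card_gt_0_iff)
    finally show ?thesis by (simp add: measure_def sum_nonneg)
  qed
  then show "is_self_similar_measure N B ?\<mu>"
    by (simp add: is_self_similar_measure_def M.prob_space_axioms)
  show "AE x in ?\<mu>. \<bar>x\<bar> \<le> digit_bound"
    using AE_streams by (subst AE_distr_iff) (auto dest!: abs_expansion_le elim: eventually_mono)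
qed

text \<open>Conditioning on the first digit b: the exponential at (x + b) / N is a phase depending
  on b times the exponential of frequency \<xi> / N, and averaging the phases gives the
  mask.\<close>

lemma fourier_self_similar:
  assumes "is_self_similar_measure N B \<mu>"
  shows "fourier \<mu> \<xi> = mask B (\<xi> / N) * fourier \<mu> (\<xi> / N)"
proof -
  let ?D = "measure_pmf digit_pmf"
  have prob: "prob_space \<mu>" and sets: "sets \<mu> = sets borel" and
    eq: "distr (?D \<Otimes>\<^sub>M \<mu>) borel (\<lambda>(b, x). contraction N b x) = \<mu>"
    using assms is_self_similar_measure_iff_distr by auto
  interpret prob_space \<mu> by fact
  interpret P: pair_prob_space ?D \<mu> ..
  note m = measurable_case_contraction[OF sets]
  have m': "(\<lambda>p. exponential \<xi> (case p of (b, x) \<Rightarrow> contraction N b x)) \<in> borel_measurable (?D \<Otimes>\<^sub>M \<mu>)"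
    by (rule measurable_compose[OF m]) simp
  have "fourier \<mu> \<xi> = (LINT p|(?D \<Otimes>\<^sub>M \<mu>). exponential \<xi> (case p of (b, x) \<Rightarrow> contraction N b x))"
    unfolding fourier_def by (subst eq[symmetric], subst integral_distr[OF m]) simp_all
  also have "\<dots> = (LINT b|?D. LINT x|\<mu>. exponential \<xi> (contraction N b x))"
    using m' by (subst P.integral_fst'[symmetric]) (auto intro!: P.integrable_const_bound[of _ 1])
  also have "\<dots> = (LINT b|?D. cis (2 * pi * real_of_int b * (\<xi> / N)) * fourier \<mu> (\<xi> / N))"
  proof (rule Bochner_Integration.integral_cong)
    fix b
    have "exponential \<xi> (contraction N b x) =
        cis (2 * pi * real_of_int b * (\<xi> / N)) * exponential (\<xi> / N) x" for x
      using N2 by (simp add: exponential_def contraction_def cis_mult field_simps)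
    then show "(LINT x|\<mu>. exponential \<xi> (contraction N b x)) =
        cis (2 * pi * real_of_int b * (\<xi> / N)) * fourier \<mu> (\<xi> / N)"
      by (simp add: fourier_def)
  qed simp
  also have "\<dots> = mask B (\<xi> / N) * fourier \<mu> (\<xi> / N)"
    using finB neB
    by (subst integral_measure_pmf[of B])
       (auto simp: mask_def scaleR_conv_of_real sum_distrib_left sum_distrib_right algebra_simps)
  finally show ?thesis .
qed

text \<open>The mask has modulus at most 1, so the distance \<open>d\<close> of the two transforms
  satisfies \<open>d x\<close> \<le> \<open>d (x / N)\<close>; continuity at 0, where both
  transforms equal 1, forces \<open>d\<close> to vanish. Levy's uniqueness theorem
  concludes.\<close>

lemma self_similar_measure_unique:
  assumes "is_self_similar_measure N B \<mu>" "is_self_similar_measure N B \<nu>"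
  shows "\<mu> = \<nu>"
proof -
  have real_dist: "real_distribution \<mu>" "real_distribution \<nu>"
    using assms by (auto simp: is_self_similar_measure_def real_distribution_def real_distribution_axioms_def)
  have prob: "prob_space \<mu>" "prob_space \<nu>" "sets \<mu> = sets borel" "sets \<nu> = sets borel"
    using assms by (auto simp: is_self_similar_measure_def)
  have "fourier \<mu> \<xi> = fourier \<nu> \<xi>" for \<xi>
  proof -
    define d where "d x = norm (fourier \<mu> x - fourier \<nu> x)" for x
    have step: "d x \<le> d (x / N)" for x
    proof -
      have "fourier \<mu> x - fourier \<nu> x = mask B (x / N) * (fourier \<mu> (x / N) - fourier \<nu> (x / N))"
        by (simp add: fourier_self_similar[OF assms(1), of x] fourier_self_similar[OF assms(2), of x]
            algebra_simps)
      then show ?thesis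
        using norm_mask_le by (simp add: d_def norm_mult mult_left_le_one_le)
    qed
    have le: "d \<xi> \<le> d (\<xi> / real_of_int N ^ n)" for n
    proof (induction n)
      case (Suc n)
      then show ?case using step[of "\<xi> / real_of_int N ^ n"] by (simp add: mult.commute)
    qed simp
    have "isCont d 0"
      unfolding d_def using prob by (intro continuous_intros isCont_fourier)
    moreover have "(\<lambda>n. \<xi> / real_of_int N ^ n) \<longlonglongrightarrow> 0"
      using N2 LIMSEQ_divide_realpow_zero by simp
    ultimately have "(\<lambda>n. d (\<xi> / real_of_int N ^ n)) \<longlonglongrightarrow> d 0"
      by (rule isCont_tendsto_compose)
    moreover have "d 0 = 0" using prob by (simp add: d_def fourier_0)
    ultimately have "d \<xi> \<le> 0"
      using le by (intro LIMSEQ_le_const) auto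
    then show ?thesis by (simp add: d_def)
  qed
  then have "char \<mu> t = char \<nu> t" for t
    using fourier_conv_char[of \<mu> "t / (2 * pi)"] fourier_conv_char[of \<nu> "t / (2 * pi)"] by simp
  then show ?thesis by (intro Levy_uniqueness real_dist ext)
qed

lemma
  shows is_self_similar_self_similar_measure: "is_self_similar_measure N B (self_similar_measure N B)"
    and AE_self_similar_measure_bounded: "AE x in self_similar_measure N B. \<bar>x\<bar> \<le> digit_bound"
proof -
  obtain \<mu> where \<mu>: "is_self_similar_measure N B \<mu>" "AE x in \<mu>. \<bar>x\<bar> \<le> digit_bound"
    by (rule self_similar_measure_exists)
  have "self_similar_measure N B = \<mu>"
    unfolding self_similar_measure_def
    using \<mu>(1) self_similar_measure_unique by (intro the_equality) auto
  then show "is_self_similar_measure N B (self_similar_measure N B)"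
    "AE x in self_similar_measure N B. \<bar>x\<bar> \<le> digit_bound"
    using \<mu> by (simp_all only:)
qed

end

section \<open>Density of trigonometric polynomials\<close>

lemma square_integrable_measurable: "square_integrable M f \<Longrightarrow> f \<in> borel_measurable M"
  by (simp add: square_integrable_def)

lemma square_integrable_bound:
  assumes "f \<in> borel_measurable M" "integrable M g" "AE x in M. (norm (f x))\<^sup>2 \<le> g x"
  shows "square_integrable M f"
  unfolding square_integrable_def
  using assms by (auto intro!: Bochner_Integration.integrable_bound[OF assms(2)] elim!: eventually_mono)

lemma norm_add_square_le:
  fixes a b :: "'a :: real_normed_vector"
  shows "(norm (a + b))\<^sup>2 \<le> 2 * (norm a)\<^sup>2 + 2 * (norm b)\<^sup>2"
proof -
  have "(norm (a + b))\<^sup>2 \<le> (norm a + norm b)\<^sup>2"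
    by (intro power_mono norm_triangle_ineq) auto
  also have "\<dots> \<le> 2 * (norm a)\<^sup>2 + 2 * (norm b)\<^sup>2"
    using sum_squares_bound[of "norm a" "norm b"] by (simp add: power2_sum)
  finally show ?thesis .
qed

lemma square_integrable_add:
  assumes "square_integrable M f" "square_integrable M g"
  shows "square_integrable M (\<lambda>x. f x + g x)"
  using assms
  by (intro square_integrable_bound[where g = "\<lambda>x. 2 * (norm (f x))\<^sup>2 + 2 * (norm (g x))\<^sup>2"])
     (auto simp: square_integrable_def norm_add_square_le)

lemma square_integrable_cmult:
  assumes "square_integrable M f" shows "square_integrable M (\<lambda>x. c * f x)"
  using assms by (auto simp: square_integrable_def norm_mult power_mult_distrib)

lemma square_integrable_diff:
  assumes "square_integrable M f" "square_integrable M g"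
  shows "square_integrable M (\<lambda>x. f x - g x)"
  using square_integrable_add[OF assms(1) square_integrable_cmult[OF assms(2), of "-1"]] by simp

lemma square_integrable_0: "square_integrable M (\<lambda>x. 0)"
  by (simp add: square_integrable_def)

lemma square_integrable_sum:
  "(\<And>i. i \<in> F \<Longrightarrow> square_integrable M (f i)) \<Longrightarrow> square_integrable M (\<lambda>x. \<Sum>i\<in>F. f i x)"
  by (induction F rule: infinite_finite_induct) (auto simp: square_integrable_0 square_integrable_add)

text \<open>The density clause of \<open>orthonormal_basis_L2\<close> for a single f, isolated so
  that the class of approximable functions can be enlarged step by step.\<close>

definition L2_approximable :: "'a measure \<Rightarrow> ('i \<Rightarrow> 'a \<Rightarrow> complex) \<Rightarrow> 'i set \<Rightarrow> ('a \<Rightarrow> complex) \<Rightarrow> bool" where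
  "L2_approximable M e I f \<longleftrightarrow>
     (\<forall>\<epsilon>>0. \<exists>F c. finite F \<and> F \<subseteq> I \<and> (LINT x|M. (norm (f x - (\<Sum>i\<in>F. c i * e i x)))\<^sup>2) < \<epsilon>)"

lemma integral_norm_add_square_le:
  fixes f g :: "'a \<Rightarrow> complex"
  assumes "square_integrable M f" "square_integrable M g"
  shows "(LINT x|M. (norm (f x + g x))\<^sup>2) \<le> 2 * (LINT x|M. (norm (f x))\<^sup>2) + 2 * (LINT x|M. (norm (g x))\<^sup>2)"
proof -
  have "(LINT x|M. (norm (f x + g x))\<^sup>2) \<le> (LINT x|M. 2 * (norm (f x))\<^sup>2 + 2 * (norm (g x))\<^sup>2)"
    using assms square_integrable_add[OF assms]
    by (intro integral_mono norm_add_square_le) (auto simp: square_integrable_def)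
  then show ?thesis using assms by (simp add: square_integrable_def)
qed

lemma L2_approximable_combination:
  assumes "finite F" "F \<subseteq> I"
  shows "L2_approximable M e I (\<lambda>x. \<Sum>i\<in>F. c i * e i x)"
  unfolding L2_approximable_def
proof safe
  fix \<epsilon> :: real assume "\<epsilon> > 0"
  with assms show "\<exists>F' c'. finite F' \<and> F' \<subseteq> I \<and>
      (LINT x|M. (norm ((\<Sum>i\<in>F. c i * e i x) - (\<Sum>i\<in>F'. c' i * e i x)))\<^sup>2) < \<epsilon>"
    by (intro exI[of _ F] exI[of _ c]) simp
qed

lemma L2_approximable_cmult:
  assumes "L2_approximable M e I f"
  shows "L2_approximable M e I (\<lambda>x. a * f x)"
proof (cases "a = 0")
  case True
  then show ?thesis using L2_approximable_combination[of "{}"] by simp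
next
  case False
  show ?thesis
    unfolding L2_approximable_def
  proof safe
    fix \<epsilon> :: real assume "\<epsilon> > 0"
    then have "\<epsilon> / (norm a)\<^sup>2 > 0" using False by simp
    then obtain F c where F: "finite F" "F \<subseteq> I"
      "(LINT x|M. (norm (f x - (\<Sum>i\<in>F. c i * e i x)))\<^sup>2) < \<epsilon> / (norm a)\<^sup>2"
      using assms unfolding L2_approximable_def by blast
    have "a * f x - (\<Sum>i\<in>F. (a * c i) * e i x) = a * (f x - (\<Sum>i\<in>F. c i * e i x))" for x
      by (simp add: right_diff_distrib sum_distrib_left mult.assoc)
    then have "(LINT x|M. (norm (a * f x - (\<Sum>i\<in>F. (a * c i) * e i x)))\<^sup>2) =
        (LINT x|M. (norm a)\<^sup>2 * (norm (f x - (\<Sum>i\<in>F. c i * e i x)))\<^sup>2)"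
      by (simp add: norm_mult power_mult_distrib)
    also have "\<dots> < \<epsilon>" using F(3) False by (simp add: field_simps)
    finally show "\<exists>F c. finite F \<and> F \<subseteq> I \<and> (LINT x|M. (norm (a * f x - (\<Sum>i\<in>F. c i * e i x)))\<^sup>2) < \<epsilon>"
      using F by (intro exI[of _ F] exI[of _ "\<lambda>i. a * c i"] conjI)
  qed
qed

context
  fixes M :: "'a measure" and e :: "'i \<Rightarrow> 'a \<Rightarrow> complex" and I :: "'i set"
  assumes e: "\<And>i. i \<in> I \<Longrightarrow> square_integrable M (e i)"
begin

lemma square_integrable_combination:
  "F \<subseteq> I \<Longrightarrow> square_integrable M (\<lambda>x. \<Sum>i\<in>F. c i * e i x)"
  by (intro square_integrable_sum square_integrable_cmult e) auto

lemma L2_approximable_limit: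
  assumes f: "square_integrable M f"
    and lim: "\<And>\<epsilon>. \<epsilon> > 0 \<Longrightarrow> \<exists>h. square_integrable M h \<and> L2_approximable M e I h \<and>
      (LINT x|M. (norm (f x - h x))\<^sup>2) < \<epsilon>"
  shows "L2_approximable M e I f"
  unfolding L2_approximable_def
proof safe
  fix \<epsilon> :: real assume "\<epsilon> > 0"
  \<comment> \<open>The inequality |a + b|^2 \<le> 2 |a|^2 + 2 |b|^2 costs a factor 2 on each of the
    two errors, hence the quarter.\<close>
  then have "\<epsilon> / 4 > 0" by simp
  from lim[OF this] obtain h where h: "square_integrable M h" "L2_approximable M e I h"
    "(LINT x|M. (norm (f x - h x))\<^sup>2) < \<epsilon> / 4" by blast
  then obtain F c where F: "finite F" "F \<subseteq> I"
    "(LINT x|M. (norm (h x - (\<Sum>i\<in>F. c i * e i x)))\<^sup>2) < \<epsilon> / 4"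
    using \<open>\<epsilon> / 4 > 0\<close> unfolding L2_approximable_def by blast
  have "(LINT x|M. (norm (f x - (\<Sum>i\<in>F. c i * e i x)))\<^sup>2) < \<epsilon>"
    using integral_norm_add_square_le[of M "\<lambda>x. f x - h x" "\<lambda>x. h x - (\<Sum>i\<in>F. c i * e i x)"]
      f h F square_integrable_diff[OF f h(1)]
      square_integrable_diff[OF h(1) square_integrable_combination[OF F(2)], of c]
    by simp
  then show "\<exists>F c. finite F \<and> F \<subseteq> I \<and> (LINT x|M. (norm (f x - (\<Sum>i\<in>F. c i * e i x)))\<^sup>2) < \<epsilon>"
    using F by blast
qed

lemma L2_approximable_add:
  assumes f: "square_integrable M f" "L2_approximable M e I f"
    and g: "square_integrable M g" "L2_approximable M e I g"
  shows "L2_approximable M e I (\<lambda>x. f x + g x)"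
proof (rule L2_approximable_limit)
  fix \<epsilon> :: real assume "\<epsilon> > 0"
  then have \<epsilon>: "\<epsilon> / 4 > 0" by simp
  from f \<epsilon> obtain F c where F: "finite F" "F \<subseteq> I"
    "(LINT x|M. (norm (f x - (\<Sum>i\<in>F. c i * e i x)))\<^sup>2) < \<epsilon> / 4"
    unfolding L2_approximable_def by blast
  from g \<epsilon> obtain G d where G: "finite G" "G \<subseteq> I"
    "(LINT x|M. (norm (g x - (\<Sum>i\<in>G. d i * e i x)))\<^sup>2) < \<epsilon> / 4"
    unfolding L2_approximable_def by blast
  \<comment> \<open>F and G may overlap, so both coefficient families are extended by 0 to the union
    and added there.\<close>
  let ?c = "\<lambda>i. (if i \<in> F then c i else 0) + (if i \<in> G then d i else 0)"
  have "(\<Sum>i\<in>F \<union> G. ?c i * e i x) = (\<Sum>i\<in>F. c i * e i x) + (\<Sum>i\<in>G. d i * e i x)" for x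
  proof -
    have "(\<Sum>i\<in>F \<union> G. (if i \<in> F then c i * e i x else 0)) = (\<Sum>i\<in>F. c i * e i x)"
      using F G by (intro sum.mono_neutral_cong_right) auto
    moreover have "(\<Sum>i\<in>F \<union> G. (if i \<in> G then d i * e i x else 0)) = (\<Sum>i\<in>G. d i * e i x)"
      using F G by (intro sum.mono_neutral_cong_right) auto
    moreover have "(\<Sum>i\<in>F \<union> G. ?c i * e i x) = (\<Sum>i\<in>F \<union> G. (if i \<in> F then c i * e i x else 0) +
        (if i \<in> G then d i * e i x else 0))"
      by (intro sum.cong) (auto simp: algebra_simps)
    ultimately show ?thesis by (simp add: sum.distrib)
  qed
  then have eq: "f x + g x - (\<Sum>i\<in>F \<union> G. ?c i * e i x) =
      (f x - (\<Sum>i\<in>F. c i * e i x)) + (g x - (\<Sum>i\<in>G. d i * e i x))" for x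
    by simp
  show "\<exists>h. square_integrable M h \<and> L2_approximable M e I h \<and>
      (LINT x|M. (norm (f x + g x - h x))\<^sup>2) < \<epsilon>"
  proof (intro exI conjI)
    show "L2_approximable M e I (\<lambda>x. \<Sum>i\<in>F \<union> G. ?c i * e i x)"
      using F G by (intro L2_approximable_combination) auto
    show "square_integrable M (\<lambda>x. \<Sum>i\<in>F \<union> G. ?c i * e i x)"
      using F G by (intro square_integrable_combination) auto
    show "(LINT x|M. (norm (f x + g x - (\<Sum>i\<in>F \<union> G. ?c i * e i x)))\<^sup>2) < \<epsilon>"
    proof -
      have "(LINT x|M. (norm ((f x - (\<Sum>i\<in>F. c i * e i x)) + (g x - (\<Sum>i\<in>G. d i * e i x))))\<^sup>2) < \<epsilon>"
        using F(3) G(3)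
          integral_norm_add_square_le[OF square_integrable_diff[OF f(1) square_integrable_combination[OF F(2), of c]]
          square_integrable_diff[OF g(1) square_integrable_combination[OF G(2), of d]]]
        by linarith
      then show ?thesis by (subst eq)
    qed
  qed
qed (rule square_integrable_add[OF f(1) g(1)])

lemma L2_approximable_sum:
  assumes "\<And>i. i \<in> A \<Longrightarrow> square_integrable M (g i)" "\<And>i. i \<in> A \<Longrightarrow> L2_approximable M e I (g i)"
  shows "L2_approximable M e I (\<lambda>x. \<Sum>i\<in>A. g i x)"
  using assms
proof (induction A rule: infinite_finite_induct)
  case (insert i A)
  then show ?case by (auto intro!: L2_approximable_add square_integrable_sum)
qed (use L2_approximable_combination[of "{}"] in auto)

text \<open>Dominated convergence with majorant 4 w^2 for |f - s n|^2. It carries approximability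
  through the pi-lambda and simple function arguments.\<close>

lemma L2_approximable_dominated:
  assumes s: "\<And>n. s n \<in> borel_measurable M" "\<And>n. L2_approximable M e I (s n)"
    and lim: "\<And>x. x \<in> space M \<Longrightarrow> (\<lambda>n. s n x) \<longlonglongrightarrow> f x"
    and bound: "\<And>n x. x \<in> space M \<Longrightarrow> norm (s n x) \<le> w x" and w: "integrable M (\<lambda>x. (w x)\<^sup>2)"
  shows "L2_approximable M e I f"
proof (rule L2_approximable_limit)
  have f_le: "norm (f x) \<le> w x" if "x \<in> space M" for x
    using lim[OF that] bound[OF that] by (intro Lim_norm_ubound[of sequentially]) auto
  have [measurable]: "f \<in> borel_measurable M"
    using s(1) lim by (rule borel_measurable_LIMSEQ_metric)
  note [measurable] = s(1)
  have sq: "square_integrable M g" if "g \<in> borel_measurable M" "\<And>x. x \<in> space M \<Longrightarrow> norm (g x) \<le> w x" for g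
    using that w by (intro square_integrable_bound[OF _ w]) (auto intro!: AE_I2 power_mono)
  show "square_integrable M f" by (rule sq) (use f_le in auto)
  have "(\<lambda>n. LINT x|M. (norm (f x - s n x))\<^sup>2) \<longlonglongrightarrow> (LINT x|M. 0)"
  proof (rule integral_dominated_convergence)
    show "integrable M (\<lambda>x. 4 * (w x)\<^sup>2)" using w by simp
    show "AE x in M. (\<lambda>n. (norm (f x - s n x))\<^sup>2) \<longlonglongrightarrow> 0"
    proof (rule AE_I2)
      fix x assume "x \<in> space M"
      then have "(\<lambda>n. (norm (f x - s n x))\<^sup>2) \<longlonglongrightarrow> (norm (f x - f x))\<^sup>2"
        by (intro tendsto_intros lim)
      then show "(\<lambda>n. (norm (f x - s n x))\<^sup>2) \<longlonglongrightarrow> 0" by simp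
    qed
    show "AE x in M. norm ((norm (f x - s n x))\<^sup>2) \<le> 4 * (w x)\<^sup>2" for n
    proof (rule AE_I2)
      fix x assume x: "x \<in> space M"
      have "(norm (f x - s n x))\<^sup>2 \<le> (w x + w x)\<^sup>2"
        using f_le[OF x] bound[OF x, of n]
        by (intro power_mono order_trans[OF norm_triangle_ineq4] add_mono) auto
      then show "norm ((norm (f x - s n x))\<^sup>2) \<le> 4 * (w x)\<^sup>2"
        by (simp add: power2_eq_square)
    qed
  qed simp_all
  then have tendsto: "(\<lambda>n. LINT x|M. (norm (f x - s n x))\<^sup>2) \<longlonglongrightarrow> 0" by simp
  fix \<epsilon> :: real assume "\<epsilon> > 0"
  then obtain n where "(LINT x|M. (norm (f x - s n x))\<^sup>2) < \<epsilon>"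
    using order_tendstoD(2)[OF tendsto] by (auto simp: eventually_sequentially)
  then show "\<exists>h. square_integrable M h \<and> L2_approximable M e I h \<and> (LINT x|M. (norm (f x - h x))\<^sup>2) < \<epsilon>"
    using s bound by (intro exI[of _ "s n"] conjI sq) auto
qed

end

section \<open>Trigonometric polynomials and Stone-Weierstrass\<close>

inductive_set trig :: "(real \<Rightarrow> complex) set" where
  exponential: "exponential \<xi> \<in> trig"
| cmult: "f \<in> trig \<Longrightarrow> (\<lambda>x. c * f x) \<in> trig"
| add: "f \<in> trig \<Longrightarrow> g \<in> trig \<Longrightarrow> (\<lambda>x. f x + g x) \<in> trig"

lemma trig_mult:
  assumes "f \<in> trig" "g \<in> trig" shows "(\<lambda>x. f x * g x) \<in> trig"
  using assms(1)
proof induction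
  case (exponential \<xi>)
  from assms(2) show ?case
  proof induction
    case (exponential \<eta>)
    show ?case using trig.exponential[of "\<xi> + \<eta>"] by (simp add: exponential_add[abs_def])
  next
    case (cmult f c)
    show ?case using trig.cmult[OF cmult.IH, of c] by (simp add: mult.left_commute)
  next
    case (add f g)
    show ?case using trig.add[OF add.IH] by (simp add: distrib_left)
  qed
next
  case (cmult f c)
  show ?case using trig.cmult[OF cmult.IH, of c] by (simp add: mult.assoc)
next
  case (add f g)
  show ?case using trig.add[OF add.IH] by (simp add: distrib_right)
qed

lemma continuous_on_trig: "f \<in> trig \<Longrightarrow> continuous_on A f"
  by (induction rule: trig.induct) (intro continuous_intros; assumption)+

lemma trig_const: "(\<lambda>x. c) \<in> trig"
  using trig.cmult[OF trig.exponential[of 0], of c] by (simp add: exponential_def)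

lemma trig_sin: "(\<lambda>x. of_real (sin (2 * pi * \<xi> * x))) \<in> trig"
proof -
  have "(\<lambda>x. 1 / (2 * \<i>) * exponential \<xi> x + - 1 / (2 * \<i>) * exponential (- \<xi>) x) \<in> trig"
    by (intro trig.intros)
  also have "(\<lambda>x. 1 / (2 * \<i>) * exponential \<xi> x + - 1 / (2 * \<i>) * exponential (- \<xi>) x) =
      (\<lambda>x. of_real (sin (2 * pi * \<xi> * x)))"
    by (simp add: fun_eq_iff exponential_def complex_eq_iff)
  finally show ?thesis .
qed

lemma trig_dense:
  fixes g :: "real \<Rightarrow> real"
  assumes "continuous_on {-K..K} g" "\<epsilon> > 0"
  obtains h where "h \<in> trig" "\<And>x. x \<in> {-K..K} \<Longrightarrow> norm (of_real (g x) - h x) < \<epsilon>"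
proof -
  interpret function_ring_on "{f. (\<lambda>x. complex_of_real (f x)) \<in> trig}" "{-K..K}"
  proof
    fix f assume "f \<in> {f. (\<lambda>x. complex_of_real (f x)) \<in> trig}"
    then have "continuous_on {-K..K} (\<lambda>x. Re (complex_of_real (f x)))"
      by (intro continuous_intros continuous_on_trig) auto
    then show "continuous_on {-K..K} f" by simp
  next
    fix x y assume xy: "x \<in> {-K..K}" "y \<in> {-K..K}" "x \<noteq> y"
    then have K: "K > 0" by auto
    \<comment> \<open>Period 4 K: on the interval the argument runs through [-pi/2, pi/2], where the
      sine is injective.\<close>
    let ?f = "\<lambda>x. sin (2 * pi * (1 / (4 * K)) * x)"
    have "?f x \<noteq> ?f y"
    proof
      assume eq: "?f x = ?f y"
      have range: "-(pi/2) \<le> 2 * pi * (1 / (4 * K)) * z \<and> 2 * pi * (1 / (4 * K)) * z \<le> pi/2"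
        if "z \<in> {-K..K}" for z
      proof -
        have "2 * pi * (1 / (4 * K)) * z = pi / 2 * (z / K)" using K by (simp add: field_simps)
        moreover have "-1 \<le> z / K" "z / K \<le> 1" using that K by (simp_all add: field_simps)
        then have "pi / 2 * (-1) \<le> pi / 2 * (z / K)" "pi / 2 * (z / K) \<le> pi / 2 * 1"
          by (intro mult_left_mono; simp)+
        ultimately show ?thesis by simp
      qed
      have "2 * pi * (1 / (4 * K)) * x = 2 * pi * (1 / (4 * K)) * y"
        using range[OF xy(1), THEN conjunct1] range[OF xy(1), THEN conjunct2]
          range[OF xy(2), THEN conjunct1] range[OF xy(2), THEN conjunct2] eq
        by (rule sin_inj_pi)
      then show False using xy K by simp
    qed
    then show "\<exists>f\<in>{f. (\<lambda>x. complex_of_real (f x)) \<in> trig}. f x \<noteq> f y"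
      using trig_sin[of "1 / (4 * K)"] by (intro bexI[of _ ?f]) auto
  qed (auto intro: trig.add trig_mult trig_const)
  from Stone_Weierstrass_basic[OF assms] obtain f where
    "(\<lambda>x. complex_of_real (f x)) \<in> trig" "\<forall>x\<in>{-K..K}. \<bar>g x - f x\<bar> < \<epsilon>" by blast
  then show ?thesis
    by (intro that[of "\<lambda>x. complex_of_real (f x)"]) (auto simp flip: of_real_diff simp: norm_of_real)
qed

text \<open>Approximability passes from exponentials to trigonometric polynomials, to bounded
  continuous functions by uniform approximation on the interval carrying M, to indicators of Borel
  sets by the pi-lambda theorem for half-lines, and to f by simple functions.\<close>

theorem L2_approximable_if_exponentials:
  fixes M :: "real measure"
  assumes "prob_space M" and sets: "sets M = sets borel" and bounded: "AE x in M. \<bar>x\<bar> \<le> K"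
    and e: "\<And>i. i \<in> I \<Longrightarrow> square_integrable M (e i)"
    and exps: "\<And>\<xi>. L2_approximable M e I (exponential \<xi>)"
    and f: "square_integrable M f"
  shows "L2_approximable M e I f"
proof -
  interpret prob_space M by fact
  have space: "space M = UNIV" using sets_eq_imp_space_eq[OF sets] by simp
  note meas = measurable_cong_sets[OF sets refl]
  have sq: "square_integrable M g" if "g \<in> borel_measurable borel" "\<And>x. norm (g x) \<le> 1" for g
    using that by (intro square_integrable_bound[where g = "\<lambda>_. 1"])
      (auto simp: meas power_le_one)
  have trig: "square_integrable M g \<and> L2_approximable M e I g" if "g \<in> trig" for g
    using that
    by induction
      (auto intro!: exps sq square_integrable_add square_integrable_cmult
         L2_approximable_add L2_approximable_cmult e)
  have cont: "L2_approximable M e I (\<lambda>x. of_real (g x))"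
    if g: "continuous_on UNIV g" "\<And>x. \<bar>g x\<bar> \<le> 1" for g
  proof (rule L2_approximable_limit[OF e])
    show "square_integrable M (\<lambda>x. complex_of_real (g x))"
      using g by (intro sq borel_measurable_continuous_onI continuous_intros) auto
    fix \<epsilon> :: real assume "\<epsilon> > 0"
    then have "sqrt (\<epsilon> / 2) > 0" by simp
    with g obtain h where h: "h \<in> trig" "\<And>x. x \<in> {-K..K} \<Longrightarrow> norm (of_real (g x) - h x) < sqrt (\<epsilon> / 2)"
      using trig_dense[of K g "sqrt (\<epsilon> / 2)"] continuous_on_subset by blast
    have "(LINT x|M. (norm (of_real (g x) - h x))\<^sup>2) \<le> (LINT x|M. \<epsilon> / 2)"
    proof (rule integral_mono_AE)
      show "integrable M (\<lambda>x. (norm (complex_of_real (g x) - h x))\<^sup>2)"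
        using square_integrable_diff[OF \<open>square_integrable M (\<lambda>x. complex_of_real (g x))\<close>, of h] trig[OF h(1)]
        by (simp add: square_integrable_def)
      show "AE x in M. (norm (complex_of_real (g x) - h x))\<^sup>2 \<le> \<epsilon> / 2"
        using bounded
      proof eventually_elim
        case (elim x)
        then have "norm (of_real (g x) - h x) < sqrt (\<epsilon> / 2)" by (intro h) auto
        then have "(norm (of_real (g x) - h x))\<^sup>2 \<le> (sqrt (\<epsilon> / 2))\<^sup>2" by (intro power_mono) auto
        then show ?case using \<open>\<epsilon> > 0\<close> by simp
      qed
    qed simp
    also have "\<dots> < \<epsilon>" using \<open>\<epsilon> > 0\<close> by (simp add: prob_space)
    finally show "\<exists>h. square_integrable M h \<and> L2_approximable M e I h \<and>
        (LINT x|M. (norm (complex_of_real (g x) - h x))\<^sup>2) < \<epsilon>"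
      using trig[OF h(1)] by blast
  qed
  have indicator: "L2_approximable M e I (indicator A)" if "A \<in> sets borel" for A
  proof -
    have "Int_stable (range (\<lambda>a::real. {..a}))"
      by (auto simp: Int_stable_def)
    moreover have "range (\<lambda>a::real. {..a}) \<subseteq> Pow UNIV" by simp
    moreover have "A \<in> sigma_sets UNIV (range (\<lambda>a::real. {..a}))"
      using that by (simp add: borel_eq_atMost)
    ultimately show ?thesis
    proof (induction rule: sigma_sets_induct_disjoint)
      case (basic A)
      then obtain a where A: "A = {..a}" by auto
      \<comment> \<open>For n > 0 this is 1 up to a, 0 from a + 1/n on and linear in between: a
        continuous approximation to the half-line.\<close>
      let ?g = "\<lambda>n x. max 0 (min 1 (1 - real n * (x - a)))"
      show ?case
      proof (rule L2_approximable_dominated[OF e])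
        show "L2_approximable M e I (\<lambda>x. of_real (?g n x))" for n
          by (rule cont) (auto intro!: continuous_intros)
        show "(\<lambda>x. complex_of_real (?g n x)) \<in> borel_measurable M" for n
          unfolding meas by measurable
        fix x
        show "(\<lambda>n. complex_of_real (?g n x)) \<longlonglongrightarrow> indicator A x"
        proof (cases "x \<le> a")
          case True
          then have "?g n x = 1" for n
            using mult_nonneg_nonpos[of "real n" "x - a"] by (auto simp: min_def max_def)
          then show ?thesis using True by (simp add: A)
        next
          case False
          have "eventually (\<lambda>n. real n > 1 / (x - a)) sequentially"
            by (metis eventually_sequentiallyI filterlim_at_top_dense filterlim_real_sequentially)
          then have "eventually (\<lambda>n. ?g n x = 0) sequentially"
            by eventually_elim (use False in \<open>auto simp: field_simps max_def min_def\<close>)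
          then have "(\<lambda>n. complex_of_real (?g n x)) \<longlonglongrightarrow> 0"
            by (intro tendsto_eventually) (auto elim!: eventually_mono)
          then show ?thesis using False by (simp add: A)
        qed
      next
        show "norm (complex_of_real (?g n x)) \<le> 1" for n x by (auto simp: norm_of_real)
      qed auto
    next
      case empty
      have "L2_approximable M e I (\<lambda>x. \<Sum>i\<in>{}. 0 * e i x)"
        by (rule L2_approximable_combination) simp_all
      then show ?case by (simp add: indicator_def[abs_def])
    next
      case (compl A)
      then have A: "A \<in> sets borel" by (simp add: borel_eq_atMost)
      have eq: "indicator (UNIV - A) = (\<lambda>x. exponential 0 x + (-1) * (indicator A x :: complex))"
        by (auto simp: fun_eq_iff exponential_def indicator_def)
      have "square_integrable M (indicator A)"
        using A by (intro sq) (auto simp: indicator_def)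
      then show ?case
        unfolding eq using trig[OF trig.exponential] compl.IH
        by (intro L2_approximable_add L2_approximable_cmult square_integrable_cmult e) auto
    next
      case (union A)
      then have A: "A i \<in> sets borel" for i by (auto simp: borel_eq_atMost)
      show ?case
      proof (rule L2_approximable_dominated[OF e])
        have "square_integrable M (indicator (A i))" for i
          using A by (intro sq) (auto simp: indicator_def)
        then show "L2_approximable M e I (\<lambda>x. \<Sum>i<n. indicator (A i) x)" for n
          using union by (intro L2_approximable_sum e) auto
        show "(\<lambda>x. \<Sum>i<n. indicator (A i) x :: complex) \<in> borel_measurable M" for n
          unfolding meas using A by measurable
        have eq: "(\<Sum>i<n. indicator (A i) x) = (indicator (\<Union>i<n. A i) x :: complex)" for n x
          using union by (intro indicator_UN_disjoint[symmetric])
            (auto simp: disjoint_family_on_def)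
        show "(\<lambda>n. \<Sum>i<n. indicator (A i) x :: complex) \<longlonglongrightarrow> indicator (\<Union>i. A i) x" for x
          unfolding eq by (rule LIMSEQ_indicator_UN)
        show "norm (\<Sum>i<n. indicator (A i) x :: complex) \<le> 1" for n x
          unfolding eq by (simp add: indicator_def)
      qed auto
    qed
  qed
  have fm: "f \<in> borel_measurable M" using f by (rule square_integrable_measurable)
  from borel_measurable_implies_sequence_metric[OF fm, of 0] obtain s where
    s: "\<And>i. simple_function M (s i)" "\<And>x. x \<in> space M \<Longrightarrow> (\<lambda>i. s i x) \<longlonglongrightarrow> f x"
    "\<And>i x. x \<in> space M \<Longrightarrow> norm (s i x) \<le> 2 * norm (f x)"
    by (simp add: dist_norm) metis
  show ?thesis
  proof (rule L2_approximable_dominated[OF e])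
    show "s i \<in> borel_measurable M" for i using s(1) by (rule borel_measurable_simple_function)
    show "integrable M (\<lambda>x. (2 * norm (f x))\<^sup>2)"
      using f by (simp add: square_integrable_def power_mult_distrib)
    show "L2_approximable M e I (s i)" for i
    proof -
      have fin: "finite (range (s i))" using s(1)[of i] by (simp add: simple_function_def space)
      have A: "s i -` {y} \<in> sets borel" for y
        using simple_functionD(2)[OF s(1)[of i], of "{y}"] by (simp add: sets space)
      have eq: "s i = (\<lambda>x. \<Sum>y\<in>range (s i). y * indicator (s i -` {y}) x)"
      proof
        fix x
        have "(\<Sum>y\<in>range (s i). y * indicator (s i -` {y}) x) = (\<Sum>y\<in>range (s i). if s i x = y then y else 0)"
          by (intro sum.cong) (auto simp: indicator_def)
        then show "s i x = (\<Sum>y\<in>range (s i). y * indicator (s i -` {y}) x)"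
          using fin by simp
      qed
      have sq_ind: "square_integrable M (indicator (s i -` {y}))" for y
        using A by (intro sq) (auto simp: indicator_def)
      have "L2_approximable M e I (\<lambda>x. \<Sum>y\<in>range (s i). y * indicator (s i -` {y}) x)"
        by (rule L2_approximable_sum[OF e])
           (auto intro!: L2_approximable_cmult square_integrable_cmult sq_ind indicator A e)
      then show ?thesis by (subst eq)
    qed
  qed (use s in auto)
qed

section \<open>The canonical spectrum\<close>

text \<open>Equality case of the triangle inequality: all products of one term with the conjugate of
  another have real part at most 1 and must reach it; pairing with the digit 0 leaves cos (2 pi b x)
  = 1. Being a mask cycle thereby becomes an integrality condition.\<close>

lemma norm_mask_eq_1_iff:
  assumes "finite B" "0 \<in> B"
  shows "norm (mask B x) = 1 \<longleftrightarrow> (\<forall>b\<in>B. real_of_int b * x \<in> \<int>)"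
proof
  let ?z = "\<lambda>b. cis (2 * pi * real_of_int b * x)"
  assume "norm (mask B x) = 1"
  then have norm: "norm (\<Sum>b\<in>B. ?z b) = card B"
    using assms by (auto simp: mask_def norm_mult norm_divide field_simps)
  have "complex_of_real ((norm (\<Sum>b\<in>B. ?z b))\<^sup>2) = (\<Sum>b\<in>B. \<Sum>b'\<in>B. ?z b * cnj (?z b'))"
    by (simp only: complex_norm_square cnj_sum sum_product)
  from arg_cong[OF this, of Re]
  have "(\<Sum>b\<in>B. \<Sum>b'\<in>B. Re (?z b * cnj (?z b'))) = (real (card B))\<^sup>2"
    unfolding norm Re_sum Re_complex_of_real by (rule sym)
  moreover have "(\<Sum>b\<in>B. \<Sum>b'\<in>B. 1) = (real (card B))\<^sup>2"
    by (simp add: power2_eq_square)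
  ultimately have "(\<Sum>b\<in>B. \<Sum>b'\<in>B. 1 - Re (?z b * cnj (?z b'))) = 0"
    by (simp only: sum_subtractf)
  moreover have nonneg: "1 - Re (?z b * cnj (?z b')) \<ge> 0" for b b'
    using complex_Re_le_cmod[of "?z b * cnj (?z b')"] by (simp add: norm_mult)
  ultimately have "\<forall>b\<in>B. (\<Sum>b'\<in>B. 1 - Re (?z b * cnj (?z b'))) = 0"
    using assms by (subst (asm) sum_nonneg_eq_0_iff) (auto intro!: sum_nonneg)
  then have "\<forall>b\<in>B. \<forall>b'\<in>B. 1 - Re (?z b * cnj (?z b')) = 0"
    using assms nonneg by (subst (asm) sum_nonneg_eq_0_iff) auto
  then have "\<forall>b\<in>B. cos (2 * pi * real_of_int b * x) = 1"
    using assms(2) by fastforce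
  show "\<forall>b\<in>B. real_of_int b * x \<in> \<int>"
  proof
    fix b assume "b \<in> B"
    then have "cos (2 * pi * real_of_int b * x) = 1"
      using \<open>\<forall>b\<in>B. cos (2 * pi * real_of_int b * x) = 1\<close> by blast
    then obtain k :: int where "2 * pi * real_of_int b * x = k * 2 * pi"
      by (auto simp: cos_one_2pi_int)
    then have "real_of_int b * x = k" by (simp add: field_simps)
    then show "real_of_int b * x \<in> \<int>" by simp
  qed
next
  assume int: "\<forall>b\<in>B. real_of_int b * x \<in> \<int>"
  have "cis (2 * pi * real_of_int b * x) = 1" if "b \<in> B" for b
  proof -
    from int that have "real_of_int b * x \<in> \<int>" by blast
    then obtain k :: int where "real_of_int b * x = k" by (rule Ints_cases)
    then have "2 * pi * real_of_int b * x = 2 * pi * k" by (simp add: mult.assoc)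
    then show ?thesis by (simp only: cis_multiple_2pi[OF Ints_of_int])
  qed
  then show "norm (mask B x) = 1"
    using assms by (auto simp: mask_def norm_mult norm_divide)
qed

lemma mask_add_dual:
  assumes "\<forall>b\<in>B. real_of_int b * y \<in> \<int>"
  shows "mask B (x + y) = mask B x"
proof -
  have "cis (2 * pi * real_of_int b * (x + y)) = cis (2 * pi * real_of_int b * x)" if "b \<in> B" for b
  proof -
    from assms that have "real_of_int b * y \<in> \<int>" by blast
    then obtain k :: int where "real_of_int b * y = k" by (rule Ints_cases)
    then have "2 * pi * real_of_int b * (x + y) = 2 * pi * real_of_int b * x + 2 * pi * k"
      by (simp add: algebra_simps)
    then show ?thesis by (simp add: cis_multiple_2pi flip: cis_mult)
  qed
  then show ?thesis by (simp add: mask_def cong: sum.cong)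
qed

lemma continuous_mask: "isCont (mask B) x"
proof -
  have "continuous_on UNIV (mask B)"
    unfolding mask_def[abs_def] by (intro continuous_intros)
  then show ?thesis by (simp add: continuous_on_eq_continuous_at)
qed

lemma finite_cis_fibre: "finite {z::real. \<bar>z\<bar> \<le> R \<and> cis (2 * pi * z) = w}"
proof (cases "{z::real. \<bar>z\<bar> \<le> R \<and> cis (2 * pi * z) = w} = {}")
  case True
  then show ?thesis by (simp only: finite.emptyI)
next
  case False
  then obtain z0 where z0: "\<bar>z0\<bar> \<le> R" "cis (2 * pi * z0) = w" by auto
  let ?K = "\<lceil>2 * R\<rceil>"
  have "{z::real. \<bar>z\<bar> \<le> R \<and> cis (2 * pi * z) = w} \<subseteq> (\<lambda>k. z0 + real_of_int k) ` {- ?K..?K}"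
  proof
    fix z assume z: "z \<in> {z::real. \<bar>z\<bar> \<le> R \<and> cis (2 * pi * z) = w}"
    then have "sin (2 * pi * z) = sin (2 * pi * z0) \<and> cos (2 * pi * z) = cos (2 * pi * z0)"
      using z0 by (auto simp: complex_eq_iff)
    then obtain n :: int where "2 * pi * z = 2 * pi * z0 + 2 * pi * n"
      unfolding sin_cos_eq_iff by blast
    then have "2 * pi * z = 2 * pi * (z0 + n)" by (simp add: algebra_simps)
    then have n: "z = z0 + n" by simp
    with z z0 have "\<bar>real_of_int n\<bar> \<le> 2 * R" by auto
    then have "n \<in> {- ?K..?K}" by (auto simp: abs_le_iff) linarith+
    then show "z \<in> (\<lambda>k. z0 + real_of_int k) ` {- ?K..?K}" using n by blast
  qed
  then show ?thesis by (rule finite_subset) simp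
qed

text \<open>A factor of modulus 1 shifts the exponents by Min B and makes them nonnegative; the mask
  then turns into a polynomial in exp(2 pi i z), nonzero because its value at 1 is #B.\<close>

lemma finite_mask_zeros:
  assumes "finite B" "B \<noteq> {}"
  shows "finite {z. \<bar>z\<bar> \<le> R \<and> mask B z = 0}"
proof -
  let ?e = "\<lambda>b. nat (b - Min B)"
  define P :: "complex poly" where "P = (\<Sum>b\<in>B. Polynomial.monom 1 (?e b))"
  have "poly P 1 = of_nat (card B)" by (simp add: P_def poly_sum poly_monom)
  then have "P \<noteq> 0" using assms by auto
  then have fin: "finite {w. poly P w = 0}" by (rule poly_roots_finite)
  have "poly P (cis (2 * pi * z)) = 0" if "mask B z = 0" for z
  proof -
    have "poly P (cis (2 * pi * z)) = (\<Sum>b\<in>B. cis (2 * pi * real_of_int b * z) * cis (- (2 * pi * real_of_int (Min B) * z)))"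
      unfolding P_def poly_sum poly_monom
    proof (intro sum.cong refl)
      fix b assume "b \<in> B"
      then have "b - Min B \<ge> 0" using assms by simp
      then have e: "real (?e b) = real_of_int b - real_of_int (Min B)" by simp
      have "cis (2 * pi * z) ^ ?e b = cis (real (?e b) * (2 * pi * z))" by (rule Complex.DeMoivre)
      also have "real (?e b) * (2 * pi * z) =
          2 * pi * real_of_int b * z + - (2 * pi * real_of_int (Min B) * z)"
        unfolding e by (simp add: algebra_simps)
      finally show "1 * cis (2 * pi * z) ^ ?e b =
          cis (2 * pi * real_of_int b * z) * cis (- (2 * pi * real_of_int (Min B) * z))"
        by (simp only: cis_mult mult_1)
    qed
    also have "\<dots> = (\<Sum>b\<in>B. cis (2 * pi * real_of_int b * z)) * cis (- (2 * pi * real_of_int (Min B) * z))"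
      by (simp add: sum_distrib_right)
    also have "\<dots> = 0" using that assms by (simp add: mask_def)
    finally show ?thesis .
  qed
  then have "{z. \<bar>z\<bar> \<le> R \<and> mask B z = 0} \<subseteq>
      (\<Union>w\<in>{w. poly P w = 0}. {z. \<bar>z\<bar> \<le> R \<and> cis (2 * pi * z) = w})" by auto
  then show ?thesis using fin finite_cis_fibre by (auto intro: finite_subset)
qed

lemma eventually_less_power:
  assumes "N \<ge> (2::int)" shows "\<exists>J. \<forall>j\<ge>J. (x::real) < real_of_int N ^ j"
proof -
  obtain J where J: "x < real_of_int N ^ J"
    using real_arch_pow[of "real_of_int N" x] assms by auto
  have "real_of_int N ^ J \<le> real_of_int N ^ j" if "j \<ge> J" for j
    using that assms by (intro power_increasing) auto
  with J show ?thesis by (meson less_le_trans)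
qed

text \<open>As the mask is nonzero near 0, only finitely many powers N^j can bring a point of the
  interval onto a zero. Off this exceptional set the digit 0 has positive weight along the whole
  orbit y / N^j.\<close>

lemma finite_scaled_mask_zeros:
  assumes "finite B" "0 \<in> B" "N \<ge> 2"
  shows "finite {y. \<bar>y\<bar> \<le> R \<and> (\<exists>j. mask B (y / real_of_int N ^ j) = 0)}"
proof -
  let ?Z = "{z. \<bar>z\<bar> \<le> R \<and> mask B z = 0}"
  have fin: "finite ?Z" using assms by (intro finite_mask_zeros) auto
  have mask0: "mask B 0 \<noteq> 0" using assms by (auto simp: mask_def)
  have "eventually (\<lambda>z. mask B z \<noteq> 0) (nhds 0)"
    using continuous_mask[where B = B and x = 0] mask0
    unfolding isCont_def tendsto_at_iff_tendsto_nhds by (rule tendsto_imp_eventually_ne)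
  then obtain \<delta> where \<delta>: "\<delta> > 0" "\<And>z. \<bar>z\<bar> < \<delta> \<Longrightarrow> mask B z \<noteq> 0"
    by (auto simp: eventually_nhds_metric dist_real_def)
  obtain J where J: "\<And>j. j \<ge> J \<Longrightarrow> R / \<delta> < real_of_int N ^ j"
    using eventually_less_power[OF assms(3)] by blast
  have "{y. \<bar>y\<bar> \<le> R \<and> (\<exists>j. mask B (y / real_of_int N ^ j) = 0)} \<subseteq>
      (\<Union>j<J. (\<lambda>z. z * real_of_int N ^ j) ` ?Z)"
  proof
    fix y assume "y \<in> {y. \<bar>y\<bar> \<le> R \<and> (\<exists>j. mask B (y / real_of_int N ^ j) = 0)}"
    then obtain j where y: "\<bar>y\<bar> \<le> R" "mask B (y / real_of_int N ^ j) = 0" by blast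
    let ?z = "y / real_of_int N ^ j"
    have N1: "real_of_int N ^ j \<ge> 1" using assms(3) by (intro one_le_power) simp
    have abs: "\<bar>?z\<bar> = \<bar>y\<bar> / real_of_int N ^ j" using N1 by (simp add: abs_divide)
    have "\<bar>?z\<bar> \<ge> \<delta>" using y(2) \<delta>(2)[of ?z] by linarith
    then have "\<delta> * real_of_int N ^ j \<le> R" using y(1) N1 abs by (simp add: field_simps)
    then have "\<not> J \<le> j" using J[of j] \<delta>(1) by (auto simp: field_simps)
    then have "j < J" by simp
    moreover have "\<bar>?z\<bar> \<le> R"
      using y(1) divide_left_mono[OF N1, of "\<bar>y\<bar>"] N1 unfolding abs by simp
    moreover have "y = ?z * real_of_int N ^ j" using assms(3) by simp
    ultimately show "y \<in> (\<Union>j<J. (\<lambda>z. z * real_of_int N ^ j) ` ?Z)"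
      using y by (intro UN_I[of j] image_eqI[of _ _ ?z]) auto
  qed
  then show ?thesis by (rule finite_subset) (intro finite_UN_I finite_imageI fin finite_lessThan)
qed

lemma bounded_nat_seq_not_increasing:
  fixes f :: "nat \<Rightarrow> nat"
  assumes "\<And>n. f n \<le> C" obtains n where "f (Suc n) \<le> f n"
proof -
  have "\<exists>n. f (Suc n) \<le> f n"
  proof (rule ccontr)
    assume "\<not> ?thesis"
    then have "n \<le> f n" for n
      by (induction n) (auto simp: not_le intro: Suc_leI le_less_trans)
    then show False using assms[of "Suc C"] by (meson Suc_n_not_le_n order_trans)
  qed
  then show ?thesis using that by blast
qed

lemma finite_self_map_cycle:
  assumes "finite M" "x \<in> M" "\<And>y. y \<in> M \<Longrightarrow> g y \<in> M"
  obtains y and k :: nat where "y \<in> M" "k \<ge> 1" "(g ^^ k) y = y"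
proof -
  have in_M: "(g ^^ n) x \<in> M" for n
    by (induction n) (auto intro: assms)
  have "\<not> inj (\<lambda>n. (g ^^ n) x)"
  proof
    assume "inj (\<lambda>n. (g ^^ n) x)"
    then have "infinite (range (\<lambda>n. (g ^^ n) x))" by (rule range_inj_infinite)
    moreover have "range (\<lambda>n. (g ^^ n) x) \<subseteq> M" using in_M by blast
    ultimately show False using assms(1) finite_subset by blast
  qed
  then obtain i j where ij: "i \<noteq> j" "(g ^^ i) x = (g ^^ j) x" unfolding inj_def by blast
  define m where "m = min i j"
  define k where "k = max i j - m"
  have "(g ^^ (k + m)) x = (g ^^ m) x"
    using ij by (auto simp: k_def m_def max_def min_def)
  then have "(g ^^ k) ((g ^^ m) x) = (g ^^ m) x" by (simp add: funpow_add)
  moreover have "k \<ge> 1" using ij by (auto simp: k_def m_def)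
  ultimately show ?thesis using that in_M by blast
qed

text \<open>A locale, so that everything up to the spectral pair can be interpreted again for the
  scaled digit set pL.\<close>

locale based_hadamard_triple =
  fixes N :: int and B L :: "int set"
  assumes hadamard: "hadamard_triple N B L" and zero_mem: "0 \<in> B" "0 \<in> L"
begin

lemma N2: "N \<ge> 2" and finB: "finite B" and finL: "finite L" and cardB: "card B \<ge> 2"
  and cardL: "card L = card B"
  using hadamard by (auto simp: hadamard_triple_def)

lemma neB: "B \<noteq> {}" using zero_mem by auto

abbreviation "\<mu> \<equiv> self_similar_measure N B"
abbreviation "\<Lambda> \<equiv> canonical_spectrum N B L"
abbreviation "branch l x \<equiv> (x + real_of_int l) / real_of_int N"

section \<open>Unitarity of the Hadamard matrix and orthogonality of the exponentials\<close>

abbreviation hmat :: "int \<Rightarrow> int \<Rightarrow> complex" where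
  "hmat b l \<equiv> of_real (1 / sqrt (real (card B))) *
     cis (2 * pi * real_of_int b * real_of_int l / real_of_int N)"

lemma inverse_sqrt_card:
  "complex_of_real (1 / sqrt (real (card B))) * complex_of_real (1 / sqrt (real (card B))) =
    of_real (1 / real (card B))"
  by (simp flip: of_real_mult)

lemma mask_digit_diff_eq_0:
  assumes "l \<in> L" "l' \<in> L" "l \<noteq> l'"
  shows "mask B ((real_of_int l' - real_of_int l) / real_of_int N) = 0"
proof -
  have "cnj (hmat b l) * hmat b l' = of_real (1 / real (card B)) *
      cis (2 * pi * real_of_int b * ((real_of_int l' - real_of_int l) / real_of_int N))" for b
  proof -
    have "cnj (hmat b l) * hmat b l' =
      (of_real (1 / sqrt (real (card B))) * of_real (1 / sqrt (real (card B)))) *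
      (cis (- (2 * pi * real_of_int b * real_of_int l / real_of_int N)) *
       cis (2 * pi * real_of_int b * real_of_int l' / real_of_int N))"
      by (simp only: complex_cnj_mult complex_cnj_complex_of_real cis_cnj mult_ac)
    also have "\<dots> = of_real (1 / real (card B)) *
      cis (2 * pi * real_of_int b * ((real_of_int l' - real_of_int l) / real_of_int N))"
      unfolding inverse_sqrt_card cis_mult by (simp add: algebra_simps diff_divide_distrib)
    finally show ?thesis .
  qed
  moreover have "(\<Sum>b\<in>B. cnj (hmat b l) * hmat b l') = 0"
    using hadamard assms unfolding hadamard_triple_def unitary_on_def by auto
  ultimately show ?thesis by (simp add: mask_def sum_distrib_left)
qed

text \<open>The vector of these mask values is the transposed Hadamard matrix applied to the unit
  vector of phases \<open>c b\<close> divided by sqrt (#B), so unitarity gives it norm 1.\<close>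

lemma sum_norm_mask_branch: "(\<Sum>l\<in>L. (norm (mask B (branch l \<xi>)))\<^sup>2) = 1"
proof -
  have rows: "(\<Sum>l\<in>L. hmat b l * cnj (hmat b' l)) = (if b = b' then 1 else 0)"
    if "b \<in> B" "b' \<in> B" for b b'
    using hadamard that unfolding hadamard_triple_def unitary_on_def by blast
  define c where "c b = cis (2 * pi * real_of_int b * \<xi> / real_of_int N)" for b
  have mask: "mask B (branch l \<xi>) = of_real (1 / sqrt (real (card B))) * (\<Sum>b\<in>B. hmat b l * c b)" for l
  proof -
    have "of_real (1 / sqrt (real (card B))) * (\<Sum>b\<in>B. hmat b l * c b) =
      (of_real (1 / sqrt (real (card B))) * of_real (1 / sqrt (real (card B)))) *
        (\<Sum>b\<in>B. cis (2 * pi * real_of_int b * real_of_int l / real_of_int N) * c b)"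
      by (simp only: sum_distrib_left mult.assoc)
    also have "\<dots> = mask B (branch l \<xi>)"
      unfolding inverse_sqrt_card
      by (simp add: mask_def c_def cis_mult algebra_simps add_divide_distrib)
    finally show ?thesis by simp
  qed
  have "complex_of_real (\<Sum>l\<in>L. (norm (mask B (branch l \<xi>)))\<^sup>2) =
      of_real (1 / real (card B)) *
        (\<Sum>l\<in>L. \<Sum>b\<in>B. \<Sum>b'\<in>B. hmat b l * c b * cnj (hmat b' l * c b'))"
  proof -
    have "complex_of_real ((norm (mask B (branch l \<xi>)))\<^sup>2) = of_real (1 / real (card B)) *
        (\<Sum>b\<in>B. \<Sum>b'\<in>B. hmat b l * c b * cnj (hmat b' l * c b'))" for l
    proof -
      have "complex_of_real ((norm (mask B (branch l \<xi>)))\<^sup>2) =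
          (of_real (1 / sqrt (real (card B))) * of_real (1 / sqrt (real (card B)))) *
          ((\<Sum>b\<in>B. hmat b l * c b) * cnj (\<Sum>b\<in>B. hmat b l * c b))"
        unfolding mask
        by (simp only: complex_norm_square complex_cnj_mult complex_cnj_complex_of_real mult_ac)
      then show ?thesis
        unfolding inverse_sqrt_card by (simp only: cnj_sum sum_product)
    qed
    then show ?thesis by (simp only: of_real_sum sum_distrib_left)
  qed
  also have "(\<Sum>l\<in>L. \<Sum>b\<in>B. \<Sum>b'\<in>B. hmat b l * c b * cnj (hmat b' l * c b')) =
      (\<Sum>b\<in>B. \<Sum>b'\<in>B. c b * cnj (c b') * (\<Sum>l\<in>L. hmat b l * cnj (hmat b' l)))"
    by (subst sum.swap, rule sum.cong[OF refl], subst sum.swap) (simp add: sum_distrib_left mult_ac)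
  also have "\<dots> = (\<Sum>b\<in>B. \<Sum>b'\<in>B. c b * cnj (c b') * (if b = b' then 1 else 0))"
    by (intro sum.cong refl arg_cong[where f = "\<lambda>z. c _ * cnj (c _) * z"] rows)
  also have "\<dots> = (\<Sum>b\<in>B. 1)"
  proof (rule sum.cong[OF refl])
    fix b assume "b \<in> B"
    have "(\<Sum>b'\<in>B. c b * cnj (c b') * (if b = b' then 1 else 0)) = (\<Sum>b'\<in>B. if b = b' then c b * cnj (c b') else 0)"
      by (intro sum.cong) auto
    also have "\<dots> = 1" using finB \<open>b \<in> B\<close> by (simp add: c_def cis_cnj cis_mult)
    finally show "(\<Sum>b'\<in>B. c b * cnj (c b') * (if b = b' then 1 else 0)) = 1" .
  qed
  also have "of_real (1 / real (card B)) * (\<Sum>b\<in>B. 1) = complex_of_real 1" using cardB by simp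
  finally show ?thesis by (simp only: of_real_eq_iff)
qed

text \<open>Mask cycles satisfy this by \<open>norm_mask_eq_1_iff\<close>, and y -> N y + l
  preserves it since B and L are integral. It makes every element of \<Lambda> a period of the
  mask.\<close>

lemma spectrum_dual: "\<kappa> \<in> \<Lambda> \<Longrightarrow> b \<in> B \<Longrightarrow> real_of_int b * \<kappa> \<in> \<int>"
proof (induction rule: canonical_spectrum.induct)
  case (cycle C x)
  then have "real_of_int b * x \<in> \<int>"
    using norm_mask_eq_1_iff[OF finB zero_mem(1)] by (auto simp: is_mask_cycle_def)
  then show ?case by simp
next
  case (step y l)
  have "real_of_int b * (real_of_int N * y + real_of_int l) =
      real_of_int N * (real_of_int b * y) + real_of_int (b * l)"
    by (simp add: algebra_simps)
  also have "\<dots> \<in> \<int>" using step.IH[OF step.prems] by (intro Ints_add Ints_of_int Ints_mult[of "real_of_int N"])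
  finally show ?case .
qed

text \<open>The rule \<open>step\<close> can also be reversed on cycles: if x' = (x + l) / N follows
  x in a cycle, then -x = N (-x') + l.\<close>

lemma spectrum_decompose:
  assumes "\<kappa> \<in> \<Lambda>"
  obtains y l where "y \<in> \<Lambda>" "l \<in> L" "\<kappa> = real_of_int N * y + real_of_int l"
  using assms
proof cases
  case (cycle C x)
  then obtain k :: nat and X l where k: "k \<ge> 1" "C = X ` {1..k}" "l ` {1..k} \<subseteq> L"
    "\<forall>j\<in>{1..<k}. contraction N (l j) (X j) = X (j + 1)" "contraction N (l k) (X k) = X 1"
    unfolding is_mask_cycle_def is_cycle_def by auto
  from cycle k obtain j where j: "j \<in> {1..k}" "x = X j" by auto
  have "\<exists>x'\<in>C. contraction N (l j) x = x'"
    using j k by (cases "j = k") auto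
  then obtain x' where x': "x' \<in> C" "contraction N (l j) x = x'" by blast
  then have "\<kappa> = real_of_int N * (- x') + real_of_int (l j)"
    using N2 cycle by (auto simp: contraction_def field_simps)
  moreover have "- x' \<in> \<Lambda>" using cycle x' by (auto intro: canonical_spectrum.cycle)
  moreover have "l j \<in> L" using j k by auto
  ultimately show ?thesis using that by blast
qed (use that in blast)

lemma is_self_similar: "is_self_similar_measure N B \<mu>"
  by (rule is_self_similar_self_similar_measure[OF N2 finB neB])

lemma prob: "prob_space \<mu>" and sets: "sets \<mu> = sets borel"
  using is_self_similar by (auto simp: is_self_similar_measure_def)

lemma fourier_scaling: "fourier \<mu> \<xi> = mask B (\<xi> / N) * fourier \<mu> (\<xi> / N)"
  by (rule fourier_self_similar[OF N2 finB neB is_self_similar])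

lemma fourier_spectrum_step:
  assumes "y \<in> \<Lambda>" "l \<in> L"
  shows "fourier \<mu> (\<xi> + (real_of_int N * y + real_of_int l)) =
    mask B (branch l \<xi>) * fourier \<mu> (branch l \<xi> + y)"
proof -
  have "(\<xi> + (real_of_int N * y + real_of_int l)) / N = branch l \<xi> + y"
    using N2 by (simp add: field_simps)
  then show ?thesis
    using fourier_scaling[of "\<xi> + (real_of_int N * y + real_of_int l)"]
      mask_add_dual[of B y "branch l \<xi>"] spectrum_dual[OF assms(1)] by simp
qed

lemma minus_dual:
  assumes "y \<in> \<Lambda>" "y' \<in> \<Lambda>"
  shows "\<forall>b\<in>B. real_of_int b * (y - y') \<in> \<int>"
  using spectrum_dual[OF assms(1)] spectrum_dual[OF assms(2)] by (simp add: right_diff_distrib)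

lemma mask_dual: "\<forall>b\<in>B. real_of_int b * y \<in> \<int> \<Longrightarrow> mask B y = 1"
  using mask_add_dual[of B y 0] cardB by (auto simp: mask_def)

lemma spectrum_diff_step:
  assumes "y \<in> \<Lambda>" "y' \<in> \<Lambda>" "l \<in> L" "l' \<in> L" "l \<noteq> l'"
  shows "mask B (((real_of_int N * y + real_of_int l) - (real_of_int N * y' + real_of_int l')) / N) = 0"
proof -
  have "((real_of_int N * y + real_of_int l) - (real_of_int N * y' + real_of_int l')) / N =
      (real_of_int l - real_of_int l') / N + (y - y')"
    using N2 by (simp add: field_simps)
  then show ?thesis
    using mask_add_dual[OF minus_dual[OF assms(1,2)]] mask_digit_diff_eq_0[of l' l] assms by simp
qed

text \<open>\<Lambda> is the disjoint union of the sets N \<Lambda> + l: two representations of one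
  number with different digits would have difference 0, where the mask is 1, while
  \<open>spectrum_diff_step\<close> makes it 0 there.\<close>

lemma spectrum_bij:
  "bij_betw (\<lambda>(l, y). real_of_int N * y + real_of_int l) (L \<times> \<Lambda>) \<Lambda>"
  unfolding bij_betw_def
proof
  show "inj_on (\<lambda>(l, y). real_of_int N * y + real_of_int l) (L \<times> \<Lambda>)"
  proof (rule inj_onI, clarify)
    fix l y l' y' assume *: "l \<in> L" "y \<in> \<Lambda>" "l' \<in> L" "y' \<in> \<Lambda>"
      and eq: "real_of_int N * y + real_of_int l = real_of_int N * y' + real_of_int l'"
    have "l = l'"
    proof (rule ccontr)
      assume "l \<noteq> l'"
      with spectrum_diff_step[of y y' l l'] * eq mask_dual[of 0] show False by simp
    qed
    then show "l = l' \<and> y = y'" using eq N2 by simp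
  qed
  show "(\<lambda>(l, y). real_of_int N * y + real_of_int l) ` (L \<times> \<Lambda>) = \<Lambda>"
  proof safe
    fix \<kappa> assume "\<kappa> \<in> \<Lambda>"
    then obtain y l where "y \<in> \<Lambda>" "l \<in> L" "\<kappa> = real_of_int N * y + real_of_int l"
      by (rule spectrum_decompose)
    then show "\<kappa> \<in> (\<lambda>(l, y). real_of_int N * y + real_of_int l) ` (L \<times> \<Lambda>)" by force
  qed (rule canonical_spectrum.step)
qed

lemma nonzero_digit: obtains b where "b \<in> B" "b \<noteq> 0"
proof -
  have "\<not> B \<subseteq> {0}" using cardB card_mono[of "{0}" B] by auto
  then show ?thesis using that by auto
qed

text \<open>Descent: a nonzero transform forces equal lowest digits, because otherwise the mask
  factor vanishes. Hence for every k the difference is N^k times a difference from \<Lambda>, and a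
  nonzero digit b times it would be a nonzero integer divisible by every power of N.\<close>

lemma fourier_spectrum_orthogonal:
  assumes "\<kappa> \<in> \<Lambda>" "\<kappa>' \<in> \<Lambda>" "\<kappa> \<noteq> \<kappa>'"
  shows "fourier \<mu> (\<kappa> - \<kappa>') = 0"
proof (rule ccontr)
  assume nz: "fourier \<mu> (\<kappa> - \<kappa>') \<noteq> 0"
  have "\<exists>y\<in>\<Lambda>. \<exists>y'\<in>\<Lambda>. \<kappa> - \<kappa>' = real_of_int N ^ k * (y - y') \<and> fourier \<mu> (y - y') \<noteq> 0" for k
  proof (induction k)
    case 0
    show ?case using assms nz by auto
  next
    case (Suc k)
    then obtain y y' where y: "y \<in> \<Lambda>" "y' \<in> \<Lambda>" "\<kappa> - \<kappa>' = real_of_int N ^ k * (y - y')"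
      "fourier \<mu> (y - y') \<noteq> 0" by blast
    obtain z l where z: "z \<in> \<Lambda>" "l \<in> L" "y = real_of_int N * z + real_of_int l"
      using spectrum_decompose[OF y(1)] .
    obtain z' l' where z': "z' \<in> \<Lambda>" "l' \<in> L" "y' = real_of_int N * z' + real_of_int l'"
      using spectrum_decompose[OF y(2)] .
    have fs: "fourier \<mu> (y - y') = mask B ((y - y') / N) * fourier \<mu> ((y - y') / N)"
      by (rule fourier_scaling)
    then have "l = l'" using spectrum_diff_step[OF z(1) z'(1) z(2) z'(2)] y(4) z z' by auto
    then have "(y - y') / N = z - z'" using z z' N2 by (simp add: field_simps)
    moreover from this have "y - y' = N * (z - z')" using N2 by (simp add: field_simps)
    ultimately show ?case using fs y z(1) z'(1) by (intro bexI[of _ z] bexI[of _ z']) auto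
  qed note * = this
  obtain b where b: "b \<in> B" "b \<noteq> 0" by (rule nonzero_digit)
  define d where "d = real_of_int b * (\<kappa> - \<kappa>')"
  have "d \<noteq> 0" using b assms by (simp add: d_def)
  obtain J where J: "\<bar>d\<bar> < real_of_int N ^ J" using eventually_less_power[OF N2] by blast
  obtain y y' where y: "y \<in> \<Lambda>" "y' \<in> \<Lambda>" "\<kappa> - \<kappa>' = real_of_int N ^ J * (y - y')"
    using *[of J] by blast
  then obtain k :: int where k: "real_of_int b * (y - y') = k"
    using minus_dual[OF y(1,2)] b by (auto elim: Ints_cases)
  have d: "d = real_of_int N ^ J * k" unfolding d_def y(3) k[symmetric] by (simp add: mult_ac)
  with \<open>d \<noteq> 0\<close> have "\<bar>real_of_int k\<bar> \<ge> 1" by (cases "k = 0") auto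
  then have "real_of_int N ^ J * 1 \<le> real_of_int N ^ J * \<bar>real_of_int k\<bar>"
    using N2 by (intro mult_left_mono) auto
  also have "\<dots> = \<bar>d\<bar>" using N2 unfolding d by (simp add: abs_mult)
  finally show False using J by simp
qed

lemma countable_spectrum: "countable \<Lambda>"
proof -
  obtain b where b: "b \<in> B" "b \<noteq> 0" by (rule nonzero_digit)
  have "\<Lambda> \<subseteq> range (\<lambda>k::int. real_of_int k / real_of_int b)"
  proof
    fix \<kappa> assume "\<kappa> \<in> \<Lambda>"
    then obtain k :: int where "real_of_int b * \<kappa> = k"
      using spectrum_dual b by (blast elim: Ints_cases)
    then have "\<kappa> = real_of_int k / real_of_int b" using b by (simp add: field_simps)
    then show "\<kappa> \<in> range (\<lambda>k::int. real_of_int k / real_of_int b)" by blast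
  qed
  then show ?thesis by (rule countable_subset) simp
qed

lemma integrable_exponential: "integrable \<mu> (exponential \<xi>)"
proof -
  interpret prob_space \<mu> by (rule prob)
  show ?thesis
  proof (rule integrable_const_bound[where B = 1])
    show "exponential \<xi> \<in> borel_measurable \<mu>"
      unfolding measurable_cong_sets[OF sets refl] by (rule borel_measurable_exponential)
  qed simp
qed

lemma square_integrable_exponential: "square_integrable \<mu> (exponential \<xi>)"
proof -
  interpret prob_space \<mu> by (rule prob)
  show ?thesis
    unfolding square_integrable_def using borel_measurable_integrable[OF integrable_exponential] by simp
qed

section \<open>Bessel's inequality and the Parseval sum\<close>

lemma cnj_fourier: "cnj (fourier \<mu> \<xi>) = fourier \<mu> (- \<xi>)"
  unfolding fourier_def by (simp add: exponential_minus[abs_def])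

text \<open>Orthonormality collapses the double sum. Nonnegativity of the left side is Bessel's
  inequality, and its smallness measures how well the exponential is approximated.\<close>

lemma integral_projection:
  assumes "finite A" "A \<subseteq> \<Lambda>"
  shows "(LINT x|\<mu>. (norm (exponential \<eta> x - (\<Sum>\<kappa>\<in>A. fourier \<mu> (\<eta> - \<kappa>) * exponential \<kappa> x)))\<^sup>2) =
    1 - (\<Sum>\<kappa>\<in>A. (norm (fourier \<mu> (\<eta> - \<kappa>)))\<^sup>2)"
proof -
  interpret prob_space \<mu> by (rule prob)
  let ?F = "fourier \<mu>" and ?c = "\<lambda>\<kappa>. fourier \<mu> (\<eta> - \<kappa>)"
  have expand: "complex_of_real ((norm (exponential \<eta> x - (\<Sum>\<kappa>\<in>A. ?c \<kappa> * exponential \<kappa> x)))\<^sup>2) =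
      exponential 0 x - (\<Sum>\<kappa>\<in>A. cnj (?c \<kappa>) * exponential (\<eta> - \<kappa>) x)
      - (\<Sum>\<kappa>\<in>A. ?c \<kappa> * exponential (\<kappa> - \<eta>) x)
      + (\<Sum>\<kappa>\<in>A. \<Sum>\<kappa>'\<in>A. ?c \<kappa> * cnj (?c \<kappa>') * exponential (\<kappa> - \<kappa>') x)" for x
  proof -
    define S where "S = (\<Sum>\<kappa>\<in>A. ?c \<kappa> * exponential \<kappa> x)"
    have "complex_of_real ((norm (exponential \<eta> x - S))\<^sup>2) =
        exponential \<eta> x * cnj (exponential \<eta> x) - exponential \<eta> x * cnj S
        - S * cnj (exponential \<eta> x) + S * cnj S"
      unfolding complex_norm_square by (simp add: algebra_simps)
    also have "exponential \<eta> x * cnj (exponential \<eta> x) = exponential 0 x"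
      by (simp add: exponential_mult_cnj)
    also have "exponential \<eta> x * cnj S = (\<Sum>\<kappa>\<in>A. cnj (?c \<kappa>) * exponential (\<eta> - \<kappa>) x)"
      unfolding S_def cnj_sum exponential_mult_cnj[symmetric]
      by (simp add: sum_distrib_left mult_ac)
    also have "S * cnj (exponential \<eta> x) = (\<Sum>\<kappa>\<in>A. ?c \<kappa> * exponential (\<kappa> - \<eta>) x)"
      by (simp add: S_def sum_distrib_right mult.assoc exponential_mult_cnj)
    also have "S * cnj S = (\<Sum>\<kappa>\<in>A. \<Sum>\<kappa>'\<in>A. ?c \<kappa> * cnj (?c \<kappa>') * exponential (\<kappa> - \<kappa>') x)"
      unfolding S_def cnj_sum sum_product exponential_mult_cnj[symmetric]
      by (simp add: mult_ac)
    finally show ?thesis by (simp add: S_def)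
  qed
  have "complex_of_real (LINT x|\<mu>. (norm (exponential \<eta> x - (\<Sum>\<kappa>\<in>A. ?c \<kappa> * exponential \<kappa> x)))\<^sup>2) =
      (LINT x|\<mu>. exponential 0 x - (\<Sum>\<kappa>\<in>A. cnj (?c \<kappa>) * exponential (\<eta> - \<kappa>) x)
      - (\<Sum>\<kappa>\<in>A. ?c \<kappa> * exponential (\<kappa> - \<eta>) x)
      + (\<Sum>\<kappa>\<in>A. \<Sum>\<kappa>'\<in>A. ?c \<kappa> * cnj (?c \<kappa>') * exponential (\<kappa> - \<kappa>') x))"
    unfolding integral_complex_of_real[symmetric] expand ..
  also have "\<dots> = ?F 0 - (\<Sum>\<kappa>\<in>A. cnj (?c \<kappa>) * ?F (\<eta> - \<kappa>)) - (\<Sum>\<kappa>\<in>A. ?c \<kappa> * ?F (\<kappa> - \<eta>))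
      + (\<Sum>\<kappa>\<in>A. \<Sum>\<kappa>'\<in>A. ?c \<kappa> * cnj (?c \<kappa>') * ?F (\<kappa> - \<kappa>'))"
    using integrable_exponential by (simp add: fourier_def)
  also have "(\<Sum>\<kappa>\<in>A. \<Sum>\<kappa>'\<in>A. ?c \<kappa> * cnj (?c \<kappa>') * ?F (\<kappa> - \<kappa>')) = (\<Sum>\<kappa>\<in>A. ?c \<kappa> * cnj (?c \<kappa>))"
  proof (rule sum.cong[OF refl])
    fix \<kappa> assume mem: "\<kappa> \<in> A"
    have "(\<Sum>\<kappa>'\<in>A. ?c \<kappa> * cnj (?c \<kappa>') * ?F (\<kappa> - \<kappa>')) = (\<Sum>\<kappa>'\<in>A. if \<kappa> = \<kappa>' then ?c \<kappa> * cnj (?c \<kappa>) else 0)"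
      using assms mem fourier_spectrum_orthogonal fourier_0[OF prob]
      by (intro sum.cong) auto
    then show "(\<Sum>\<kappa>'\<in>A. ?c \<kappa> * cnj (?c \<kappa>') * ?F (\<kappa> - \<kappa>')) = ?c \<kappa> * cnj (?c \<kappa>)"
      using assms mem by simp
  qed
  also have "(\<Sum>\<kappa>\<in>A. ?c \<kappa> * ?F (\<kappa> - \<eta>)) = (\<Sum>\<kappa>\<in>A. ?c \<kappa> * cnj (?c \<kappa>))"
    by (simp add: cnj_fourier)
  also have "?F 0 = 1" by (rule fourier_0[OF prob])
  finally have "complex_of_real (LINT x|\<mu>. (norm (exponential \<eta> x - (\<Sum>\<kappa>\<in>A. ?c \<kappa> * exponential \<kappa> x)))\<^sup>2) =
      complex_of_real (1 - (\<Sum>\<kappa>\<in>A. (norm (?c \<kappa>))\<^sup>2))"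
    by (simp add: complex_norm_square mult.commute del: of_real_power)
  then show ?thesis by (simp only: of_real_eq_iff)
qed

lemma norm_fourier_minus: "norm (fourier \<mu> (- \<xi>)) = norm (fourier \<mu> \<xi>)"
  by (simp flip: cnj_fourier)

lemma bessel:
  assumes "finite A" "A \<subseteq> \<Lambda>"
  shows "(\<Sum>\<kappa>\<in>A. (norm (fourier \<mu> (\<xi> + \<kappa>)))\<^sup>2) \<le> 1"
proof -
  have "norm (fourier \<mu> (- \<xi> - \<kappa>)) = norm (fourier \<mu> (\<xi> + \<kappa>))" for \<kappa>
    using norm_fourier_minus[of "\<xi> + \<kappa>"] by simp
  moreover have "0 \<le> 1 - (\<Sum>\<kappa>\<in>A. (norm (fourier \<mu> (- \<xi> - \<kappa>)))\<^sup>2)"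
    unfolding integral_projection[OF assms, symmetric] by (intro Bochner_Integration.integral_nonneg) auto
  ultimately show ?thesis by simp
qed

text \<open>The squared norm of the projection of the exponential of frequency -\<xi> to the closed
  span of the exponentials from \<Lambda>; the value 1 is Parseval's identity for it.\<close>

definition Q :: "real \<Rightarrow> real" where
  "Q \<xi> = (\<Sum>\<^sub>\<infinity>\<kappa>\<in>\<Lambda>. (norm (fourier \<mu> (\<xi> + \<kappa>)))\<^sup>2)"

lemma Q_summable: "(\<lambda>\<kappa>. (norm (fourier \<mu> (\<xi> + \<kappa>)))\<^sup>2) summable_on \<Lambda>"
  by (rule nonneg_bdd_above_summable_on) (auto intro!: bdd_aboveI[of _ 1] bessel)

lemma sum_le_Q: "finite A \<Longrightarrow> A \<subseteq> \<Lambda> \<Longrightarrow> (\<Sum>\<kappa>\<in>A. (norm (fourier \<mu> (\<xi> + \<kappa>)))\<^sup>2) \<le> Q \<xi>"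
  unfolding Q_def by (rule finite_sum_le_infsum[OF Q_summable]) auto

lemma Q_le_iff: "Q \<xi> \<le> c \<longleftrightarrow> (\<forall>A. finite A \<and> A \<subseteq> \<Lambda> \<longrightarrow> (\<Sum>\<kappa>\<in>A. (norm (fourier \<mu> (\<xi> + \<kappa>)))\<^sup>2) \<le> c)"
proof
  assume "\<forall>A. finite A \<and> A \<subseteq> \<Lambda> \<longrightarrow> (\<Sum>\<kappa>\<in>A. (norm (fourier \<mu> (\<xi> + \<kappa>)))\<^sup>2) \<le> c"
  then show "Q \<xi> \<le> c"
    unfolding Q_def by (intro infsum_le_finite_sums Q_summable) auto
qed (use sum_le_Q order_trans in blast)

lemma Q_le_1: "Q \<xi> \<le> 1"
  unfolding Q_le_iff by (auto intro: bessel)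

lemma Q_nonneg: "Q \<xi> \<ge> 0"
  unfolding Q_def by (rule infsum_nonneg) simp

text \<open>The bijection \<open>spectrum_bij\<close> splits the sum by lowest digit, and the mask
  factor is constant on each piece because \<Lambda> consists of periods of the mask.\<close>

lemma Q_eq_branches: "Q \<xi> = (\<Sum>l\<in>L. (norm (mask B (branch l \<xi>)))\<^sup>2 * Q (branch l \<xi>))"
proof -
  let ?f = "\<lambda>\<kappa>. (norm (fourier \<mu> (\<xi> + \<kappa>)))\<^sup>2" and ?h = "\<lambda>(l, y). real_of_int N * y + real_of_int l"
  have summ: "(\<lambda>p. ?f (?h p)) summable_on (L \<times> \<Lambda>)"
    using Q_summable[of \<xi>] summable_on_reindex_bij_betw[OF spectrum_bij, of ?f] by simp
  have "Q \<xi> = (\<Sum>\<^sub>\<infinity>p\<in>L \<times> \<Lambda>. ?f (?h p))"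
    unfolding Q_def by (rule infsum_reindex_bij_betw[OF spectrum_bij, symmetric])
  also have "\<dots> = (\<Sum>\<^sub>\<infinity>l\<in>L. \<Sum>\<^sub>\<infinity>y\<in>\<Lambda>. ?f (?h (l, y)))"
    by (rule infsum_Sigma_banach[OF summ, symmetric])
  also have "\<dots> = (\<Sum>l\<in>L. \<Sum>\<^sub>\<infinity>y\<in>\<Lambda>. ?f (?h (l, y)))"
    using finL by simp
  also have "\<dots> = (\<Sum>l\<in>L. (norm (mask B (branch l \<xi>)))\<^sup>2 * Q (branch l \<xi>))"
  proof (rule sum.cong[OF refl])
    fix l assume "l \<in> L"
    then have "(\<Sum>\<^sub>\<infinity>y\<in>\<Lambda>. ?f (?h (l, y))) =
        (\<Sum>\<^sub>\<infinity>y\<in>\<Lambda>. (norm (mask B (branch l \<xi>)))\<^sup>2 * (norm (fourier \<mu> (branch l \<xi> + y)))\<^sup>2)"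
      by (intro infsum_cong) (simp add: fourier_spectrum_step norm_mult power_mult_distrib)
    also have "\<dots> = (norm (mask B (branch l \<xi>)))\<^sup>2 * Q (branch l \<xi>)"
      unfolding Q_def by (rule infsum_cmult_right')
    finally show "(\<Sum>\<^sub>\<infinity>y\<in>\<Lambda>. ?f (?h (l, y))) = (norm (mask B (branch l \<xi>)))\<^sup>2 * Q (branch l \<xi>)" .
  qed
  finally show ?thesis .
qed

lemma isCont_fourier_self: "isCont (fourier \<mu>) \<xi>"
  by (rule isCont_fourier[OF prob sets])

text \<open>Q is a supremum of continuous finite sums. Lower semicontinuity is enough to attain a
  minimum on an interval and to make the set of minimizers closed.\<close>

lemma Q_lower_semicontinuous:
  assumes "X \<longlonglongrightarrow> x" "(\<lambda>n. Q (X n)) \<longlonglongrightarrow> q"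
  shows "Q x \<le> q"
  unfolding Q_le_iff
proof safe
  fix A assume A: "finite A" "A \<subseteq> \<Lambda>"
  have "(\<lambda>n. \<Sum>\<kappa>\<in>A. (norm (fourier \<mu> (X n + \<kappa>)))\<^sup>2) \<longlonglongrightarrow> (\<Sum>\<kappa>\<in>A. (norm (fourier \<mu> (x + \<kappa>)))\<^sup>2)"
    by (intro tendsto_intros isCont_tendsto_compose[OF isCont_fourier_self] assms)
  then show "(\<Sum>\<kappa>\<in>A. (norm (fourier \<mu> (x + \<kappa>)))\<^sup>2) \<le> q"
    using assms(2) by (rule LIMSEQ_le) (use sum_le_Q[OF A] in blast)
qed

lemma Q_eq_1: "- x \<in> \<Lambda> \<Longrightarrow> Q x = 1"
  using sum_le_Q[of "{- x}" x] Q_le_1[of x] fourier_0[OF prob] by simp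

lemma zero_in_spectrum: "0 \<in> \<Lambda>"
proof -
  have "is_cycle N L {0}"
    unfolding is_cycle_def using zero_mem(2)
    by (intro exI[of _ 1] exI[of _ "\<lambda>_. 0"] conjI) (auto simp: contraction_def)
  then have "is_mask_cycle N B L {0}"
    using norm_mask_eq_1_iff[OF finB zero_mem(1), of 0] by (simp add: is_mask_cycle_def)
  from canonical_spectrum.cycle[OF this, of 0] show ?thesis by simp
qed

section \<open>Allowed digits and finite invariant sets\<close>

definition allowed :: "real \<Rightarrow> int set" where
  "allowed x = {l \<in> L. mask B (branch l x) \<noteq> 0}"

lemma finite_allowed: "finite (allowed x)"
  using finL by (simp add: allowed_def)

text \<open>The squared moduli of the mask are the transition probabilities of a random walk x ->
  \<open>branch l x\<close>; in particular some digit is always allowed.\<close>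

lemma sum_allowed: "(\<Sum>l\<in>allowed x. (norm (mask B (branch l x)))\<^sup>2) = 1"
proof -
  have "(\<Sum>l\<in>allowed x. (norm (mask B (branch l x)))\<^sup>2) = (\<Sum>l\<in>L. (norm (mask B (branch l x)))\<^sup>2)"
    using finL by (intro sum.mono_neutral_left) (auto simp: allowed_def)
  then show ?thesis by (simp add: sum_norm_mask_branch)
qed

lemma allowed_nonempty: "allowed x \<noteq> {}"
  using sum_allowed[of x] by auto

text \<open>A difference N k would give mask 0 at the integer k, where the mask is 1. That digits of
  L are incongruent modulo N makes the integer coding of digit words unambiguous.\<close>

lemma digits_distinct:
  assumes "l \<in> L" "l' \<in> L" "N dvd l' - l" shows "l = l'"
proof (rule ccontr)
  assume "l \<noteq> l'"
  obtain k where k: "l' - l = N * k" using assms(3) by (auto elim: dvdE)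
  have "real_of_int l' - real_of_int l = real_of_int N * real_of_int k"
    using k by (metis of_int_diff of_int_mult)
  then have "(real_of_int l' - real_of_int l) / real_of_int N = real_of_int k"
    using N2 by simp
  then have "mask B (real_of_int k) = 0"
    using mask_digit_diff_eq_0[OF assms(1,2) \<open>l \<noteq> l'\<close>] by simp
  moreover have "mask B (real_of_int k) = 1"
    by (rule mask_dual) (auto simp flip: of_int_mult)
  ultimately show False by simp
qed

text \<open>A word l_0, ..., l_(n-1) of successively allowed digits is coded by k = l_0 + N l_1 +
  ... + N^(n-1) l_(n-1); the walk then ends at (x + k) / N^n.\<close>

primrec paths :: "nat \<Rightarrow> real \<Rightarrow> int set" where
  "paths 0 x = {0}"
| "paths (Suc n) x = (\<Union>l\<in>allowed x. (\<lambda>k. l + N * k) ` paths n (branch l x))"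

lemma finite_paths: "finite (paths n x)"
  by (induction n arbitrary: x) (auto simp: finite_allowed)

lemma card_paths_Suc: "card (paths (Suc n) x) = (\<Sum>l\<in>allowed x. card (paths n (branch l x)))"
proof -
  have "card (paths (Suc n) x) = (\<Sum>l\<in>allowed x. card ((\<lambda>k. l + N * k) ` paths n (branch l x)))"
    unfolding paths.simps
  proof (rule card_UN_disjoint)
    show "\<forall>l\<in>allowed x. \<forall>l'\<in>allowed x. l \<noteq> l' \<longrightarrow>
        (\<lambda>k. l + N * k) ` paths n (branch l x) \<inter> (\<lambda>k. l' + N * k) ` paths n (branch l' x) = {}"
    proof (intro ballI impI)
      fix l l' assume ll: "l \<in> allowed x" "l' \<in> allowed x" "l \<noteq> l'"
      have "l + N * k \<noteq> l' + N * k'" for k k'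
      proof
        assume "l + N * k = l' + N * k'"
        then have "l' - l = N * (k - k')" by (simp add: algebra_simps)
        then show False using digits_distinct[of l l'] ll by (simp add: allowed_def)
      qed
      then show "(\<lambda>k. l + N * k) ` paths n (branch l x) \<inter> (\<lambda>k. l' + N * k) ` paths n (branch l' x) = {}"
        by auto
    qed
  qed (auto simp: finite_allowed finite_paths)
  also have "\<dots> = (\<Sum>l\<in>allowed x. card (paths n (branch l x)))"
    using N2 by (intro sum.cong refl card_image) (auto simp: inj_on_def)
  finally show ?thesis .
qed

lemma card_paths_pos: "card (paths n x) \<ge> 1"
proof (induction n arbitrary: x)
  case (Suc n)
  obtain l where "l \<in> allowed x" using allowed_nonempty by blast
  then have "card (paths n (branch l x)) \<le> card (paths (Suc n) x)"
    unfolding card_paths_Suc by (intro member_le_sum) (auto simp: finite_allowed)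
  then show ?case using Suc[of "branch l x"] by linarith
qed simp

lemma card_paths_mono: "card (paths n x) \<le> card (paths (Suc n) x)"
proof (induction n arbitrary: x)
  case 0
  show ?case using card_paths_pos[of "Suc 0" x] by simp
next
  case (Suc n)
  then show ?case unfolding card_paths_Suc[of "Suc n"] card_paths_Suc[of n] by (intro sum_mono)
qed

definition invariant :: "real set \<Rightarrow> bool" where
  "invariant M \<longleftrightarrow> (\<forall>x\<in>M. \<forall>l\<in>allowed x. branch l x \<in> M)"

lemma paths_mem_invariant:
  assumes "invariant M" "x \<in> M" "k \<in> paths n x"
  shows "(x + real_of_int k) / real_of_int N ^ n \<in> M"
  using assms(2,3)
proof (induction n arbitrary: x k)
  case (Suc n)
  then obtain l j where lj: "l \<in> allowed x" "j \<in> paths n (branch l x)" "k = l + N * j" by auto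
  have "(branch l x + real_of_int j) / real_of_int N ^ n \<in> M"
    using assms(1) Suc lj by (auto simp: invariant_def)
  moreover have "(branch l x + real_of_int j) / real_of_int N ^ n = (x + real_of_int k) / real_of_int N ^ Suc n"
    using N2 lj by (simp add: field_simps)
  ultimately show ?case by simp
qed simp

lemma card_paths_le:
  assumes "invariant M" "x \<in> M" "finite M"
  shows "card (paths n x) \<le> card M"
proof (rule card_inj_on_le)
  show "inj_on (\<lambda>k. (x + real_of_int k) / real_of_int N ^ n) (paths n x)"
    using N2 by (auto simp: inj_on_def)
  show "(\<lambda>k. (x + real_of_int k) / real_of_int N ^ n) ` paths n x \<subseteq> M"
    using paths_mem_invariant[OF assms(1,2)] by auto
qed fact

text \<open>Each point of a finite invariant set has only boundedly many allowed digit words; where their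
  number is minimal the next digit is forced, and following the forced digits runs into a cycle.\<close>

lemma finite_invariant_meets_spectrum:
  assumes inv: "invariant M" and fin: "finite M" and ne: "M \<noteq> {}"
  obtains x where "x \<in> M" "- x \<in> \<Lambda>"
proof -
  have "(\<Sum>x\<in>M. card (paths n x)) \<le> card M * card M" for n
    using sum_bounded_above[of M "\<lambda>x. card (paths n x)" "card M"] card_paths_le[OF inv _ fin] by simp
  \<comment> \<open>The total number of words over M is bounded by (#M)^2 and nondecreasing in n, so
    it stalls at some n; by \<open>card_paths_mono\<close> it then stalls at each point
    separately.\<close>
  then obtain n where n: "(\<Sum>x\<in>M. card (paths (Suc n) x)) \<le> (\<Sum>x\<in>M. card (paths n x))"
    using bounded_nat_seq_not_increasing[of "\<lambda>n. \<Sum>x\<in>M. card (paths n x)"] by metis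
  define a where "a x = card (paths n x)" for x
  have a_eq: "a x = (\<Sum>l\<in>allowed x. a (branch l x))" if "x \<in> M" for x
  proof -
    have "card (paths (Suc n) x) = card (paths n x)"
    proof (rule ccontr)
      assume "card (paths (Suc n) x) \<noteq> card (paths n x)"
      then have "card (paths n x) < card (paths (Suc n) x)"
        using card_paths_mono[of n x] by linarith
      then have "(\<Sum>x\<in>M. card (paths n x)) < (\<Sum>x\<in>M. card (paths (Suc n) x))"
        using fin that card_paths_mono by (intro sum_strict_mono_ex1) auto
      then show False using n by simp
    qed
    then show ?thesis using card_paths_Suc[of n x] by (simp add: a_def del: paths.simps)
  qed
  \<comment> \<open>At a point where \<open>a\<close> has its minimum a0 \<ge> 1, the sum of
    \<open>a\<close> over the allowed branches is a0 while each summand is at least a0: one digit is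
    allowed, and its branch is a minimum again.\<close>
  define a0 where "a0 = Min (a ` M)"
  define M0 where "M0 = {x \<in> M. a x = a0}"
  have a0_le: "a0 \<le> a x" if "x \<in> M" for x using fin that by (simp add: a0_def)
  have "a0 \<in> a ` M" unfolding a0_def using fin ne by (intro Min_in) auto
  then obtain x0 where x0: "x0 \<in> M0" by (auto simp: M0_def)
  have a0_pos: "a0 \<ge> 1" using x0 card_paths_pos by (auto simp: M0_def a_def)
  define d where "d x = (SOME l. l \<in> allowed x)" for x
  define g where "g x = branch (d x) x" for x
  have forced: "allowed x = {d x} \<and> g x \<in> M0" if x: "x \<in> M0" for x
  proof -
    have xM: "x \<in> M" "a x = a0" using x by (auto simp: M0_def)
    have d: "d x \<in> allowed x" unfolding d_def using allowed_nonempty by (simp add: some_in_eq)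
    have ge: "a (branch l x) \<ge> a0" if "l \<in> allowed x" for l
      using inv xM that a0_le by (auto simp: invariant_def)
    have "card (allowed x) * a0 \<le> (\<Sum>l\<in>allowed x. a (branch l x))"
      using sum_bounded_below[of "allowed x" a0 "\<lambda>l. a (branch l x)"] ge by simp
    then have "card (allowed x) * a0 \<le> a0" using a_eq[OF xM(1)] xM by simp
    then have "card (allowed x) \<le> 1" using a0_pos by (cases "card (allowed x)") auto
    then have single: "allowed x = {d x}"
      using d finite_allowed[of x] card_le_Suc0_iff_eq by fastforce
    then have "a (g x) = a0" using a_eq[OF xM(1)] xM by (simp add: g_def)
    moreover have "g x \<in> M" using inv xM d by (auto simp: invariant_def g_def)
    ultimately show ?thesis using single by (simp add: M0_def)
  qed
  have mask_g: "norm (mask B (g x)) = 1" if "x \<in> M0" for x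
  proof -
    have "(norm (mask B (g x)))\<^sup>2 = 1"
      using sum_allowed[of x] forced[OF that] by (simp add: g_def)
    then have "norm (mask B (g x)) = 1 \<or> norm (mask B (g x)) = - 1"
      by (simp only: power2_eq_1_iff)
    then show ?thesis using norm_ge_zero[of "mask B (g x)"] by linarith
  qed
  have "finite M0" using fin by (simp add: M0_def)
  then obtain y k where y: "y \<in> M0" and k: "k \<ge> 1" "(g ^^ k) y = y"
    using finite_self_map_cycle[of M0 x0 g] x0 forced by blast
  have iter: "(g ^^ j) y \<in> M0" for j by (induction j) (use y forced in auto)
  define X where "X j = (g ^^ (j - 1)) y" for j
  let ?C = "X ` {1..k}"
  have "is_cycle N L ?C"
    unfolding is_cycle_def
  proof (intro exI conjI)
    show "k \<ge> 1" "?C = X ` {1..k}" by (rule k) simp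
    show "(\<lambda>j. d (X j)) ` {1..k} \<subseteq> L"
      using forced iter by (force simp: X_def allowed_def)
    show "\<forall>j\<in>{1..<k}. contraction N (d (X j)) (X j) = X (j + 1)"
    proof
      fix j assume "j \<in> {1..<k}"
      then obtain i where "j = Suc i" by (cases j) auto
      then show "contraction N (d (X j)) (X j) = X (j + 1)"
        by (simp add: X_def contraction_def g_def)
    qed
    obtain i where i: "k = Suc i" using k by (cases k) auto
    show "contraction N (d (X k)) (X k) = X 1"
      using k by (simp add: X_def contraction_def i) (simp add: g_def)
  qed
  moreover have "norm (mask B x) = 1" if x: "x \<in> ?C" for x
  proof -
    from x obtain j where j: "j \<in> {1..k}" "x = X j" by blast
    \<comment> \<open>The fact \<open>mask_g\<close> speaks about images under g only: every cycle
      point is the image of its predecessor, and the first one closes up through the k-th iterate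
      fixing y.\<close>
    have "x \<in> g ` M0"
    proof (cases "j = 1")
      case True
      obtain i where i: "k = Suc i" using k by (cases k) auto
      have "x = g ((g ^^ i) y)" using j True k i by (simp add: X_def)
      then show ?thesis using iter by blast
    next
      case False
      then obtain i where "j = Suc (Suc i)" using j by (cases j; cases "j - 1") auto
      then have "x = g ((g ^^ i) y)" using j by (simp add: X_def)
      then show ?thesis using iter by blast
    qed
    then show ?thesis using mask_g by blast
  qed
  ultimately have mc: "is_mask_cycle N B L ?C" by (simp add: is_mask_cycle_def)
  have "X 1 \<in> ?C" using k by auto
  then have "- X 1 \<in> \<Lambda>" using mc by (rule canonical_spectrum.cycle[rotated])
  moreover have "X 1 \<in> M" using y by (simp add: X_def M0_def)
  ultimately show ?thesis using that by blast
qed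

lemma Q_eq_1_everywhere: "Q \<xi> = 1"
proof -
  \<comment> \<open>Large enough for the interval to contain \<xi>, and at least every |l|, so that
    (R + R) / N \<le> R keeps the interval stable under all branches.\<close>
  define R where "R = max \<bar>\<xi>\<bar> (real_of_int (Max (abs ` L)))"
  have R_digit: "\<bar>real_of_int l\<bar> \<le> R" if "l \<in> L" for l
  proof -
    have "\<bar>l\<bar> \<le> Max (abs ` L)" using that finL by simp
    then have "\<bar>real_of_int l\<bar> \<le> real_of_int (Max (abs ` L))"
      by (simp only: of_int_abs[symmetric] of_int_le_iff)
    then show ?thesis by (simp add: R_def)
  qed
  let ?I = "{- R..R}"
  have R0: "R \<ge> 0" by (simp add: R_def)
  have branch_I: "branch l x \<in> ?I" if "x \<in> ?I" "l \<in> L" for x l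
  proof -
    have "\<bar>x + real_of_int l\<bar> \<le> R + R" using that R_digit[of l] by auto
    also have "\<dots> \<le> N * R" using N2 R0 mult_right_mono[of 2 "real_of_int N" R] by simp
    finally show ?thesis using N2 by (auto simp: abs_le_iff field_simps)
  qed
  define q where "q = Inf (Q ` ?I)"
  have bdd: "bdd_below (Q ` ?I)" using Q_nonneg by (auto intro!: bdd_belowI[of _ 0])
  have q_le: "q \<le> Q x" if "x \<in> ?I" for x
    unfolding q_def using that bdd by (intro cInf_lower) auto
  define M where "M = {x \<in> ?I. Q x = q}"
  have closed_M: "x \<in> M" if "X \<longlonglongrightarrow> x" "(\<lambda>n. Q (X n)) \<longlonglongrightarrow> q" "\<And>n. X n \<in> ?I" for X x
  proof -
    have "x \<in> ?I" using that(1,3) closed_sequentially[of ?I X x] by simp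
    then show ?thesis
      using Q_lower_semicontinuous[OF that(1,2)] q_le[of x] by (simp add: M_def)
  qed
  have ne: "M \<noteq> {}"
  proof -
    have "\<exists>x\<in>?I. Q x < q + 1 / real (Suc n)" for n
    proof -
      have "Inf (Q ` ?I) < q + 1 / real (Suc n)" by (simp add: q_def)
      then show ?thesis using R0 bdd by (subst (asm) cInf_less_iff) auto
    qed
    then obtain X where X: "\<And>n. X n \<in> ?I" "\<And>n. Q (X n) < q + 1 / real (Suc n)" by metis
    have "compact ?I" by simp
    then obtain x r where xr: "x \<in> ?I" "strict_mono (r :: nat \<Rightarrow> nat)" "(X \<circ> r) \<longlonglongrightarrow> x"
      using X(1) unfolding compact_def by metis
    have "(\<lambda>n. Q (X n)) \<longlonglongrightarrow> q"
    proof (rule tendsto_sandwich[where f = "\<lambda>_. q" and h = "\<lambda>n. q + 1 / real (Suc n)"])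
      show "(\<lambda>n. q + 1 / real (Suc n)) \<longlonglongrightarrow> q"
        using tendsto_add[OF tendsto_const[of q] LIMSEQ_inverse_real_of_nat] by (simp add: inverse_eq_divide)
      show "(\<lambda>_. q) \<longlonglongrightarrow> q" by simp
      show "\<forall>\<^sub>F n in sequentially. q \<le> Q (X n)"
        by (rule always_eventually) (use X(1) q_le in blast)
      show "\<forall>\<^sub>F n in sequentially. Q (X n) \<le> q + 1 / real (Suc n)"
        by (rule always_eventually) (use X(2) less_imp_le in blast)
    qed
    then have "(\<lambda>n. Q ((X \<circ> r) n)) \<longlonglongrightarrow> q"
      using LIMSEQ_subseq_LIMSEQ[OF _ xr(2), of "\<lambda>n. Q (X n)"] by (simp add: comp_def)
    then have "x \<in> M" using xr(3) X(1) by (intro closed_M[of "X \<circ> r"]) auto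
    then show ?thesis by blast
  qed
  have inv: "invariant M"
    unfolding invariant_def
  proof (intro ballI)
    fix x l assume x: "x \<in> M" and l: "l \<in> allowed x"
    let ?w = "\<lambda>l. (norm (mask B (branch l x)))\<^sup>2"
    have I: "branch l x \<in> ?I" if "l \<in> L" for l using x that branch_I by (auto simp: M_def)
    \<comment> \<open>The weights sum to 1, so the weighted mean of the nonnegative excesses over
      the minimum q is the excess at x, which is 0.\<close>
    have "(\<Sum>l\<in>L. ?w l * (Q (branch l x) - q)) = Q x - q"
      using Q_eq_branches[of x] sum_norm_mask_branch[of x]
      by (simp add: right_diff_distrib sum_subtractf flip: sum_distrib_right)
    also have "\<dots> = 0" using x by (simp add: M_def)
    finally have "\<forall>l\<in>L. ?w l * (Q (branch l x) - q) = 0"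
      using finL q_le I by (subst (asm) sum_nonneg_eq_0_iff) auto
    then have "Q (branch l x) = q" using l by (auto simp: allowed_def)
    then show "branch l x \<in> M" using I l by (auto simp: M_def allowed_def)
  qed
  have "\<exists>x\<in>M. - x \<in> \<Lambda>"
  proof (cases "finite M")
    case True
    then show ?thesis using finite_invariant_meets_spectrum[OF inv _ ne] by blast
  next
    case False
    \<comment> \<open>An infinite set of minimizers is not contained in the finite exceptional set,
      which yields a point from which the digit 0 is allowed forever.\<close>
    have "\<not> M \<subseteq> {y. \<bar>y\<bar> \<le> R \<and> (\<exists>j. mask B (y / real_of_int N ^ j) = 0)}"
      using False finite_scaled_mask_zeros[OF finB zero_mem(1) N2] finite_subset by blast
    then obtain y where y: "y \<in> M" "\<And>j. mask B (y / real_of_int N ^ j) \<noteq> 0"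
      by (auto simp: M_def)
    have in_M: "y / real_of_int N ^ j \<in> M" for j
    proof (induction j)
      case (Suc j)
      have "0 \<in> allowed (y / real_of_int N ^ j)"
        using zero_mem y(2)[of "Suc j"] by (simp add: allowed_def mult.commute)
      then have "branch 0 (y / real_of_int N ^ j) \<in> M"
        using inv Suc unfolding invariant_def by blast
      then show ?case by (simp add: mult.commute)
    qed (use y in simp)
    have "(\<lambda>j. y / real_of_int N ^ j) \<longlonglongrightarrow> 0"
      using N2 LIMSEQ_divide_realpow_zero by simp
    moreover have "(\<lambda>j. Q (y / real_of_int N ^ j)) \<longlonglongrightarrow> q"
      using in_M by (simp add: M_def)
    \<comment> \<open>The orbit y / N^j stays among the minimizers, and these form a closed set, so
      the limit 0 is a minimizer as well.\<close>
    ultimately have "0 \<in> M" by (rule closed_M) (use in_M in \<open>auto simp: M_def\<close>)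
    then show ?thesis using zero_in_spectrum by (intro bexI[of _ 0]) auto
  qed
  then have "q = 1" using Q_eq_1 by (auto simp: M_def)
  moreover have "\<xi> \<in> ?I" by (auto simp: R_def)
  ultimately show ?thesis using q_le[of \<xi>] Q_le_1[of \<xi>] by simp
qed

text \<open>The error of the orthogonal projection is 1 minus a finite partial sum of Q (-\<eta>) =
  1.\<close>

lemma L2_approximable_exponential: "L2_approximable \<mu> exponential \<Lambda> (exponential \<eta>)"
  unfolding L2_approximable_def
proof safe
  fix \<epsilon> :: real assume "\<epsilon> > 0"
  have "\<not> Q (- \<eta>) \<le> 1 - \<epsilon>" using \<open>\<epsilon> > 0\<close> Q_eq_1_everywhere[of "- \<eta>"] by simp
  then obtain A where A: "finite A" "A \<subseteq> \<Lambda>" "(\<Sum>\<kappa>\<in>A. (norm (fourier \<mu> (- \<eta> + \<kappa>)))\<^sup>2) > 1 - \<epsilon>"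
    unfolding Q_le_iff by (auto simp: not_le)
  have "norm (fourier \<mu> (\<eta> - \<kappa>)) = norm (fourier \<mu> (- \<eta> + \<kappa>))" for \<kappa>
    using norm_fourier_minus[of "\<eta> - \<kappa>"] by simp
  then have "(LINT x|\<mu>. (norm (exponential \<eta> x - (\<Sum>\<kappa>\<in>A. fourier \<mu> (\<eta> - \<kappa>) * exponential \<kappa> x)))\<^sup>2) < \<epsilon>"
    using A(3) unfolding integral_projection[OF A(1,2)] by simp
  then show "\<exists>F c. finite F \<and> F \<subseteq> \<Lambda> \<and>
      (LINT x|\<mu>. (norm (exponential \<eta> x - (\<Sum>\<kappa>\<in>F. c \<kappa> * exponential \<kappa> x)))\<^sup>2) < \<epsilon>"
    by (intro exI[of _ A] exI[of _ "\<lambda>\<kappa>. fourier \<mu> (\<eta> - \<kappa>)"] conjI A(1,2))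
qed

theorem spectral_pair_canonical: "spectral_pair \<mu> \<Lambda>"
  unfolding spectral_pair_def orthonormal_basis_L2_def
proof (intro conjI ballI allI impI)
  show "prob_space \<mu>" "sets \<mu> = sets borel" "countable \<Lambda>"
    by (rule prob sets countable_spectrum)+
  show "square_integrable \<mu> (exponential \<kappa>)" for \<kappa> by (rule square_integrable_exponential)
  show "(LINT x|\<mu>. exponential \<kappa> x * cnj (exponential \<kappa>' x)) = (if \<kappa> = \<kappa>' then 1 else 0)"
    if "\<kappa> \<in> \<Lambda>" "\<kappa>' \<in> \<Lambda>" for \<kappa> \<kappa>'
    using fourier_spectrum_orthogonal[OF that] fourier_0[OF prob]
    by (simp add: exponential_mult_cnj fourier_def)
  fix f and \<epsilon> :: real assume f: "square_integrable \<mu> f" and "\<epsilon> > 0"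
  have "L2_approximable \<mu> exponential \<Lambda> f"
    using prob sets AE_self_similar_measure_bounded[OF N2 finB neB] square_integrable_exponential
      L2_approximable_exponential f
    by (rule L2_approximable_if_exponentials)
  then show "\<exists>F c. finite F \<and> F \<subseteq> \<Lambda> \<and> (LINT x|\<mu>. (norm (f x - (\<Sum>i\<in>F. c i * exponential i x)))\<^sup>2) < \<epsilon>"
    using \<open>\<epsilon> > 0\<close> by (simp add: L2_approximable_def)
qed

end

section \<open>Vanishing sums of roots of unity\<close>

text \<open>Integer combinations of the first n powers of w. If w^n = 1 and n > 0 this is the ring
  generated by w; smaller n serve to find independent powers.\<close>

definition power_span :: "complex \<Rightarrow> nat \<Rightarrow> complex set" where
  "power_span w n = {\<Sum>k<n. of_int (c k) * w ^ k | c. True}"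

lemma power_spanI: "(\<Sum>k<n. of_int (c k) * w ^ k) \<in> power_span w n"
  by (auto simp: power_span_def)

lemma power_spanE:
  assumes "z \<in> power_span w n" obtains c where "z = (\<Sum>k<n. of_int (c k) * w ^ k)"
  using assms by (auto simp: power_span_def)

lemma power_span_add:
  assumes "x \<in> power_span w n" "y \<in> power_span w n" shows "x + y \<in> power_span w n"
proof -
  obtain c d where "x = (\<Sum>k<n. of_int (c k) * w ^ k)" "y = (\<Sum>k<n. of_int (d k) * w ^ k)"
    using assms by (metis power_spanE)
  then have "x + y = (\<Sum>k<n. of_int (c k + d k) * w ^ k)"
    by (simp add: sum.distrib distrib_right)
  then show ?thesis using power_spanI[where c = "\<lambda>k. c k + d k"] by simp
qed

lemma power_span_of_int_mult:
  assumes "x \<in> power_span w n" shows "of_int a * x \<in> power_span w n"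
proof -
  obtain c where "x = (\<Sum>k<n. of_int (c k) * w ^ k)" using assms by (rule power_spanE)
  then have "of_int a * x = (\<Sum>k<n. of_int (a * c k) * w ^ k)"
    by (simp add: sum_distrib_left mult.assoc)
  then show ?thesis using power_spanI[where c = "\<lambda>k. a * c k"] by simp
qed

lemma power_span_0: "0 \<in> power_span w n"
  using power_spanI[of "\<lambda>_. 0"] by simp

lemma power_span_sum: "(\<And>i. i \<in> A \<Longrightarrow> f i \<in> power_span w n) \<Longrightarrow> (\<Sum>i\<in>A. f i) \<in> power_span w n"
  by (induction A rule: infinite_finite_induct) (auto simp: power_span_0 power_span_add)

lemma power_mem_span: "k < n \<Longrightarrow> w ^ k \<in> power_span w n"
proof -
  assume k: "k < n"
  have "(\<Sum>j<n. of_int (if j = k then 1 else 0) * w ^ j) = (\<Sum>j<n. if j = k then w ^ j else 0)"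
    by (intro sum.cong) auto
  also have "\<dots> = w ^ k" using k by simp
  finally show ?thesis using power_spanI[where c = "\<lambda>j. if j = k then 1 else 0" and n = n and w = w] by simp
qed

section \<open>The Frobenius congruence and bounded denominators\<close>

context
  fixes w :: complex and N :: nat
  assumes root: "w ^ N = 1" and N0: "N > 0"
begin

lemma power_mem_full_span: "w ^ k \<in> power_span w N"
proof -
  have "w ^ k = w ^ (N * (k div N) + k mod N)" by simp
  also have "\<dots> = w ^ (k mod N)" unfolding power_add power_mult root by simp
  finally show ?thesis using power_mem_span[of "k mod N" N w] N0 by simp
qed

lemma full_span_mult:
  assumes "x \<in> power_span w N" "y \<in> power_span w N" shows "x * y \<in> power_span w N"
proof -
  obtain c d where "x = (\<Sum>k<N. of_int (c k) * w ^ k)" "y = (\<Sum>k<N. of_int (d k) * w ^ k)"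
    using assms by (metis power_spanE)
  then have "x * y = (\<Sum>k<N. \<Sum>j<N. of_int (c k * d j) * w ^ (k + j))"
    by (simp add: sum_product power_add mult_ac)
  then show ?thesis
    by (auto intro!: power_span_sum power_span_of_int_mult power_mem_full_span simp del: of_int_mult)
qed

lemma full_span_1: "1 \<in> power_span w N"
  using power_mem_full_span[of 0] by simp

lemma full_span_power: "x \<in> power_span w N \<Longrightarrow> x ^ k \<in> power_span w N"
  by (induction k) (auto simp: full_span_1 full_span_mult)

lemma frobenius_add:
  assumes "prime p" "x \<in> power_span w N" "y \<in> power_span w N"
  obtains z where "z \<in> power_span w N" "(x + y) ^ p = x ^ p + y ^ p + of_nat p * z"
proof
  \<comment> \<open>The binomial coefficients strictly between the two ends are divisible by p;
    dividing p out leaves an element of the ring.\<close>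
  let ?z = "\<Sum>k\<in>{0<..<p}. of_int (int ((p choose k) div p)) * (x ^ k * y ^ (p - k))"
  show "?z \<in> power_span w N"
    using assms by (intro power_span_sum power_span_of_int_mult full_span_mult full_span_power)
  have p: "p > 0" using assms(1) prime_gt_0_nat by blast
  have set: "{..p} = insert 0 (insert p {0<..<p})" using p by auto
  have "(x + y) ^ p = (\<Sum>k\<le>p. of_nat (p choose k) * x ^ k * y ^ (p - k))"
    by (rule binomial_ring)
  also have "\<dots> = x ^ p + y ^ p + (\<Sum>k\<in>{0<..<p}. of_nat (p choose k) * x ^ k * y ^ (p - k))"
    unfolding set using p by simp
  also have "(\<Sum>k\<in>{0<..<p}. of_nat (p choose k) * x ^ k * y ^ (p - k)) = of_nat p * ?z"
    unfolding sum_distrib_left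
  proof (rule sum.cong[OF refl])
    fix k assume "k \<in> {0<..<p}"
    then have "p dvd (p choose k)" using assms(1) by (intro dvd_choose_prime) auto
    then have "p choose k = p * ((p choose k) div p)" by simp
    then have "(of_nat (p choose k) :: complex) = of_nat p * of_nat ((p choose k) div p)"
      by (metis of_nat_mult)
    then show "of_nat (p choose k) * x ^ k * y ^ (p - k) =
        of_nat p * (of_int (int ((p choose k) div p)) * (x ^ k * y ^ (p - k)))"
      by (simp add: mult_ac)
  qed
  finally show "(x + y) ^ p = x ^ p + y ^ p + of_nat p * ?z" .
qed

lemma frobenius_sum:
  assumes p: "prime p" and "\<And>i. i \<in> A \<Longrightarrow> f i \<in> power_span w N"
  shows "\<exists>z\<in>power_span w N. (\<Sum>i\<in>A. f i) ^ p = (\<Sum>i\<in>A. f i ^ p) + of_nat p * z"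
proof (use assms(2) in \<open>induction A rule: infinite_finite_induct\<close>)
  case (insert i A)
  then obtain z where z: "z \<in> power_span w N" "(\<Sum>i\<in>A. f i) ^ p = (\<Sum>i\<in>A. f i ^ p) + of_nat p * z"
    by auto
  obtain z' where z': "z' \<in> power_span w N"
    "(f i + (\<Sum>i\<in>A. f i)) ^ p = f i ^ p + (\<Sum>i\<in>A. f i) ^ p + of_nat p * z'"
    using frobenius_add[OF p, of "f i" "\<Sum>i\<in>A. f i"] insert.prems power_span_sum[of A f w N] by auto
  show ?case
    using insert z z' by (intro bexI[of _ "z + z'"]) (auto simp: power_span_add algebra_simps)
qed (use p power_span_0 in \<open>auto intro!: bexI[of _ 0] simp: prime_gt_0_nat\<close>)

definition independent_powers :: "nat \<Rightarrow> bool" where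
  "independent_powers n \<longleftrightarrow>
     (\<forall>c :: nat \<Rightarrow> int. (\<Sum>k<n. of_int (c k) * w ^ k) = 0 \<longrightarrow> (\<forall>k<n. c k = 0))"

text \<open>Here n is the degree of w: the first dependence among the powers has a nonzero leading
  coefficient a. Each multiplication by w can be reduced to lower powers at the cost of one factor
  a, so a^N is a common denominator for all powers below N.\<close>

lemma independent_powers_denominator:
  obtains n and D :: int where "independent_powers n" "D \<noteq> 0"
    "\<forall>z\<in>power_span w N. of_int D * z \<in> power_span w n"
proof -
  have dep: "\<not> independent_powers (Suc N)"
  proof
    assume indep: "independent_powers (Suc N)"
    \<comment> \<open>The coefficients of w^N - 1 = 0, a dependence among the powers up to
      N.\<close>
    let ?c = "\<lambda>k. (if k = N then 1 else 0) - (if k = 0 then 1 else 0) :: int"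
    have "(\<Sum>k<Suc N. of_int (?c k) * w ^ k) =
        (\<Sum>k<Suc N. (if k = N then w ^ k else 0)) - (\<Sum>k<Suc N. (if k = 0 then w ^ k else 0))"
      unfolding sum_subtractf[symmetric] by (intro sum.cong) auto
    also have "\<dots> = 0" using root N0 by simp
    finally have "?c N = 0" 
      using indep[unfolded independent_powers_def, rule_format, of ?c N] by simp
    then show False using N0 by simp
  qed
  define m where "m = (LEAST m. \<not> independent_powers m)"
  have m: "\<not> independent_powers m" unfolding m_def using dep by (rule LeastI)
  have "independent_powers 0" by (simp add: independent_powers_def)
  then obtain n where n: "m = Suc n" using m by (cases m) auto
  have indep: "independent_powers n"
    using not_less_Least[of n "\<lambda>m. \<not> independent_powers m"] n by (auto simp: m_def)
  obtain c where c: "(\<Sum>k<Suc n. of_int (c k) * w ^ k) = 0" "\<exists>k<Suc n. c k \<noteq> (0::int)"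
    using m unfolding n independent_powers_def by blast
  define a where "a = c n"
  have a0: "a \<noteq> 0"
  proof
    assume "a = 0"
    then have "(\<Sum>k<n. of_int (c k) * w ^ k) = 0" using c(1) by (simp add: a_def)
    then have "\<forall>k<n. c k = 0" using indep by (simp add: independent_powers_def)
    then show False using c(2) \<open>a = 0\<close> by (auto simp: a_def less_Suc_eq)
  qed
  have n0: "n > 0"
  proof (rule ccontr)
    assume "\<not> n > 0"
    then show False using c(1) a0 by (simp add: a_def)
  qed
  have an: "of_int a * w ^ n \<in> power_span w n"
  proof -
    have "of_int a * w ^ n = of_int (- 1) * (\<Sum>k<n. of_int (c k) * w ^ k)"
      using c(1) by (simp add: a_def add_eq_0_iff)
    then show ?thesis by (simp only: power_span_of_int_mult[OF power_spanI])
  qed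
  have step: "of_int a * w * z \<in> power_span w n" if z: "z \<in> power_span w n" for z
  proof -
    obtain d where d: "z = (\<Sum>k<n. of_int (d k) * w ^ k)" using z by (rule power_spanE)
    have "of_int a * w * z = (\<Sum>k<n. of_int (d k) * (of_int a * w ^ Suc k))"
      unfolding d by (simp add: sum_distrib_left mult_ac)
    moreover have "of_int a * w ^ Suc k \<in> power_span w n" if "k < n" for k
    proof (cases "Suc k = n")
      case False
      then show ?thesis using that by (intro power_span_of_int_mult power_mem_span) simp
    qed (use an in blast)
    then have "(\<Sum>k<n. of_int (d k) * (of_int a * w ^ Suc k)) \<in> power_span w n"
      by (intro power_span_sum power_span_of_int_mult[where a = "d _"]) simp_all
    ultimately show ?thesis by (simp only:)
  qed
  have powers: "of_int (a ^ j) * w ^ j \<in> power_span w n" for j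
  proof (induction j)
    case 0
    show ?case using power_mem_span[OF n0, of w] by simp
  next
    case (Suc j)
    show ?case using step[OF Suc] by (simp add: mult_ac)
  qed
  have "of_int (a ^ N) * z \<in> power_span w n" if "z \<in> power_span w N" for z
  proof -
    obtain d where d: "z = (\<Sum>k<N. of_int (d k) * w ^ k)" using \<open>z \<in> power_span w N\<close> by (rule power_spanE)
    have "of_int (a ^ N) * z = (\<Sum>k<N. of_int (d k * a ^ (N - k)) * (of_int (a ^ k) * w ^ k))"
      unfolding d sum_distrib_left
    proof (intro sum.cong refl)
      fix k assume "k \<in> {..<N}"
      then have "a ^ N = a ^ (N - k) * a ^ k" by (simp flip: power_add)
      then show "of_int (a ^ N) * (of_int (d k) * w ^ k) =
          of_int (d k * a ^ (N - k)) * (of_int (a ^ k) * w ^ k)"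
        by (simp add: mult_ac)
    qed
    then show ?thesis using powers power_span_of_int_mult by (auto intro!: power_span_sum simp del: of_int_power of_int_mult)
  qed
  then show ?thesis using that[OF indep, of "a ^ N"] a0 by auto
qed

text \<open>After multiplication by D the element v has unique integer coordinates; v = p z makes
  all of them divisible by p, which fails once p exceeds the modulus of a nonzero
  coordinate.\<close>

lemma multiple_in_span_imp_0:
  assumes "v \<in> power_span w N"
  shows "\<exists>K. \<forall>p>K. \<forall>z\<in>power_span w N. v = of_nat p * z \<longrightarrow> v = 0"
proof (cases "v = 0")
  case False
  obtain n and D :: int where nD: "independent_powers n" "D \<noteq> 0"
    "\<forall>z\<in>power_span w N. of_int D * z \<in> power_span w n"
    by (rule independent_powers_denominator)
  obtain c where c: "of_int D * v = (\<Sum>k<n. of_int (c k) * w ^ k)"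
    using nD(3) assms by (blast elim: power_spanE)
  have "\<exists>k<n. c k \<noteq> 0"
  proof (rule ccontr)
    assume "\<not> ?thesis"
    then have "(\<Sum>k<n. of_int (c k) * w ^ k) = 0" by (intro sum.neutral) auto
    then show False using c False nD(2) by simp
  qed
  then obtain k where k: "k < n" "c k \<noteq> 0" by blast
  have "\<not> (v = of_nat p * z)" if p: "p > nat \<bar>c k\<bar>" and z: "z \<in> power_span w N" for p z
  proof
    assume v: "v = of_nat p * z"
    obtain d where d: "of_int D * z = (\<Sum>k<n. of_int (d k) * w ^ k)"
      using nD(3) z by (blast elim: power_spanE)
    have "(\<Sum>k<n. of_int (c k) * w ^ k) = of_nat p * (of_int D * z)"
      using c v by (simp add: mult_ac)
    also have "\<dots> = (\<Sum>k<n. of_int (int p * d k) * w ^ k)"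
      unfolding d by (simp add: sum_distrib_left mult_ac)
    finally have "(\<Sum>k<n. of_int (c k - int p * d k) * w ^ k) = 0"
      by (simp add: left_diff_distrib sum_subtractf)
    then have "c k - int p * d k = 0"
      using nD(1)[unfolded independent_powers_def, rule_format, of "\<lambda>k. c k - int p * d k" k] k(1)
      by blast
    then have "int p dvd c k" by simp
    then have "\<bar>int p\<bar> \<le> \<bar>c k\<bar>" using k(2) by (intro dvd_imp_le_int)
    then show False using p by linarith
  qed
  then show ?thesis by blast
qed auto

end

text \<open>A substitute for the Galois automorphism sending a root of unity to its p-th power, for large
  p: by the Frobenius congruence the image of a vanishing sum is divisible by p in the ring of
  integers, and it takes only finitely many values.\<close>

theorem root_of_unity_sum_prime_power:
  fixes e :: "'i \<Rightarrow> int" and N :: int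
  assumes N: "N > 0" and zero: "(\<Sum>i\<in>A. cis (2 * pi * real_of_int (e i) / real_of_int N)) = 0"
  obtains K where "\<And>p. prime p \<Longrightarrow> p > K \<Longrightarrow>
    (\<Sum>i\<in>A. cis (2 * pi * real_of_int (e i * int p) / real_of_int N)) = 0"
proof -
  define w where "w = cis (2 * pi / real_of_int N)"
  define n where "n = nat N"
  have n: "n > 0" "N = int n" using N by (auto simp: n_def)
  have root: "w ^ n = 1" using n by (simp add: w_def Complex.DeMoivre)
  define f where "f i = nat (e i mod N)" for i
  have cis_eq: "cis (2 * pi * real_of_int (e i * int r) / real_of_int N) = w ^ (f i * r)" for i r
  proof -
    have "e i = N * (e i div N) + int (f i)" using N by (simp add: f_def)
    then have "real_of_int (e i) = real_of_int N * real_of_int (e i div N) + real (f i)"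
      by (metis of_int_add of_int_mult of_int_of_nat_eq)
    then have "2 * pi * real_of_int (e i * int r) / real_of_int N =
        2 * pi * real_of_int (e i div N * int r) + real (f i * r) * (2 * pi / real_of_int N)"
      using N by (simp add: field_simps)
    then have "cis (2 * pi * real_of_int (e i * int r) / real_of_int N) =
        cis (2 * pi * real_of_int (e i div N * int r)) * cis (real (f i * r) * (2 * pi / real_of_int N))"
      by (simp only: cis_mult)
    also have "\<dots> = w ^ (f i * r)"
      unfolding w_def Complex.DeMoivre cis_multiple_2pi[OF Ints_of_int] by simp
    finally show ?thesis .
  qed
  define v where "v r = (\<Sum>i\<in>A. w ^ (f i * r))" for r
  have v_span: "v r \<in> power_span w n" for r
    unfolding v_def using power_mem_full_span[OF root n(1)] by (intro power_span_sum)
  have v1: "v 1 = 0" using zero cis_eq[of _ 1] by (simp add: v_def)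
  \<comment> \<open>Only the residue of r matters: the sums \<open>v r\<close> take at most n
    values, so one threshold for p works for all of them.\<close>
  have v_mod: "v (r mod n) = v r" for r
  proof -
    have "w ^ (f i * r) = w ^ (f i * (r mod n))" for i
    proof -
      have "w ^ r = w ^ (n * (r div n) + r mod n)" by simp
      also have "\<dots> = w ^ (r mod n)" unfolding power_add power_mult root by simp
      finally show ?thesis by (metis mult.commute power_mult)
    qed
    then show ?thesis by (simp add: v_def)
  qed
  obtain K where K: "\<And>r p z. p > K r \<Longrightarrow> z \<in> power_span w n \<Longrightarrow> v r = of_nat p * z \<Longrightarrow> v r = 0"
    using multiple_in_span_imp_0[OF root n(1) v_span] by metis
  show ?thesis
  proof (rule that)
    fix p :: nat assume p: "prime p" "p > Max (K ` {..<n})"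
    have "K (p mod n) \<le> Max (K ` {..<n})" using n by (intro Max_ge) auto
    then have pK: "p > K (p mod n)" using p by simp
    obtain z where z: "z \<in> power_span w n"
      "(\<Sum>i\<in>A. w ^ f i) ^ p = (\<Sum>i\<in>A. (w ^ f i) ^ p) + of_nat p * z"
      using frobenius_sum[OF root n(1) p(1), of A "\<lambda>i. w ^ f i"] power_mem_full_span[OF root n(1)] by blast
    \<comment> \<open>The p-th power of \<open>v 1\<close> = 0 equals \<open>v p\<close> plus a
      multiple of p.\<close>
    have "v p = of_nat p * (of_int (- 1) * z)"
      using z(2) v1 by (simp add: v_def power_mult zero_power prime_gt_0_nat[OF p(1)] eq_neg_iff_add_eq_0)
    then have "v (p mod n) = 0"
      using K[OF pK power_span_of_int_mult[OF z(1)]] v_mod by metis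
    then show "(\<Sum>i\<in>A. cis (2 * pi * real_of_int (e i * int p) / real_of_int N)) = 0"
      unfolding cis_eq using v_mod[of p] by (simp add: v_def)
  qed
qed

section \<open>Primes, multiplicative orders and separated points\<close>

definition prime_pi :: "nat \<Rightarrow> nat" where
  "prime_pi n = card {p. prime p \<and> p \<le> n}"

text \<open>Recurrence of the Leibniz harmonic triangle, whose entries are the reciprocals of (n +
  1) (n choose k).\<close>

lemma leibniz_triangle:
  assumes "k \<le> m"
  shows "1 / (real (Suc (Suc m)) * real (Suc m choose Suc k)) =
    1 / (real (Suc m) * real (m choose k)) - 1 / (real (Suc (Suc m)) * real (Suc m choose k))"
proof -
  define c where "c = real (m choose k)"
  have c: "c > 0" using assms by (simp add: c_def zero_less_binomial)
  have "Suc k * (Suc m choose Suc k) = Suc m * (m choose k)" by (rule Suc_times_binomial)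
  then have 1: "real (Suc k) * real (Suc m choose Suc k) = real (Suc m) * c"
    unfolding c_def by (simp only: flip: of_nat_mult)
  have "(Suc m - k) * (Suc m choose k) = Suc m * (m choose k)"
    using binomial_absorb_comp[of "Suc m" k] by simp
  then have 2: "real (Suc m - k) * real (Suc m choose k) = real (Suc m) * c"
    unfolding c_def by (simp only: flip: of_nat_mult)
  have 1: "real (Suc m choose Suc k) = real (Suc m) * c / real (Suc k)"
    using 1 by (simp add: field_simps)
  have 2: "real (Suc m choose k) = real (Suc m) * c / (real (Suc m) - real k)"
    using 2 assms by (simp add: field_simps of_nat_diff)
  have arith: "1 / ((a + b) * (X / a)) = 1 / X - 1 / ((a + b) * (X / b))"
    if "a > 0" "b > 0" "X > 0" for a b X :: real
  proof -
    have "1 / X = (a + b) / ((a + b) * X)" using that by simp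
    then show ?thesis by (simp add: add_divide_distrib)
  qed
  have sum: "real (Suc (Suc m)) = real (Suc k) + (real (Suc m) - real k)" by simp
  show ?thesis
    unfolding 1 2 c_def[symmetric] sum
    using c assms by (intro arith) auto
qed

text \<open>Induction on k along the Leibniz triangle: the first column has the entries 1 / (n + 1),
  and each further entry is a difference of entries in the same row and the row above, whose
  denominators the same Lcm clears.\<close>

lemma Lcm_div_leibniz_in_Ints:
  "k \<le> n \<Longrightarrow> real (Lcm {1..Suc n}) / (real (Suc n) * real (n choose k)) \<in> \<int>"
proof (induction k arbitrary: n)
  case 0
  have "Suc n dvd Lcm {1..Suc n}" by (intro dvd_Lcm) auto
  then obtain q where "Lcm {1..Suc n} = Suc n * q" by (elim dvdE)
  then have "real (Lcm {1..Suc n}) = real (Suc n) * real q" by (simp only: of_nat_mult)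
  then have "real (Lcm {1..Suc n}) / (real (Suc n) * real (n choose 0)) = real q"
    by (simp only:) simp
  then show ?case by simp
next
  case (Suc k)
  then obtain m where n: "n = Suc m" and km: "k \<le> m" by (cases n) auto
  let ?D = "Lcm {1..Suc (Suc m)}"
  have "Lcm {1..Suc m} dvd ?D" by (intro Lcm_subset) auto
  then obtain q where "?D = Lcm {1..Suc m} * q" by (elim dvdE)
  then have D: "real ?D = real (Lcm {1..Suc m}) * real q" by (simp only: of_nat_mult)
  have "real ?D / (real (Suc (Suc m)) * real (Suc m choose Suc k)) =
      real ?D * (1 / (real (Suc (Suc m)) * real (Suc m choose Suc k)))" by simp
  also have "\<dots> = real ?D / (real (Suc m) * real (m choose k)) -
      real ?D / (real (Suc (Suc m)) * real (Suc m choose k))"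
    unfolding leibniz_triangle[OF km] by (simp add: right_diff_distrib)
  also have "real ?D / (real (Suc m) * real (m choose k)) =
      real q * (real (Lcm {1..Suc m}) / (real (Suc m) * real (m choose k)))"
    unfolding D by simp
  also have "\<dots> - real ?D / (real (Suc (Suc m)) * real (Suc m choose k)) \<in> \<int>"
    using Suc.IH[OF km] Suc.IH[of "Suc m"] km by (intro Ints_diff Ints_mult[OF Ints_of_nat]) auto
  finally show ?case unfolding n .
qed

lemma Lcm_ge_binomial:
  assumes "k \<le> n" shows "Suc n * (n choose k) \<le> Lcm {1..Suc n}"
proof -
  let ?D = "Lcm {1..Suc n}" and ?b = "real (Suc n) * real (n choose k)"
  have b: "?b > 0" using assms by (simp add: zero_less_binomial)
  have "finite {1..Suc n}" by simp
  then have "?D > 0" by (auto intro!: Nat.gr0I simp: Lcm_0_iff_nat)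
  then have "real ?D / ?b > 0" using b by (intro divide_pos_pos) auto
  moreover obtain z :: int where z: "real ?D / ?b = z"
    using Lcm_div_leibniz_in_Ints[OF assms] by (rule Ints_cases)
  ultimately have "z \<ge> 1" by simp
  then have "real ?D / ?b \<ge> 1" using z by simp
  then have "?b \<le> real ?D" using b by (simp add: field_simps)
  then have "real (Suc n * (n choose k)) \<le> real ?D" by (simp only: of_nat_mult)
  then show ?thesis by (simp only: of_nat_le_iff)
qed

text \<open>The central entry k = n of row 2 n: already 2 n times the central binomial coefficient
  is at least 4^n.\<close>

lemma four_power_le_Lcm: "4 ^ n \<le> Lcm {1..Suc (2 * n)}"
proof (cases "n = 0")
  case False
  have "4 ^ n / (2 * real n) \<le> real ((2 * n) choose n)"
    using False central_binomial_lower_bound[of n] by simp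
  then have "4 ^ n \<le> 2 * real n * real ((2 * n) choose n)"
    using False by (simp add: field_simps)
  also have "\<dots> \<le> real (Suc (2 * n)) * real ((2 * n) choose n)"
    by (intro mult_right_mono) auto
  also have "\<dots> = real (Suc (2 * n) * ((2 * n) choose n))" by (simp only: of_nat_mult)
  finally have "real (4 ^ n) \<le> real (Suc (2 * n) * ((2 * n) choose n))" by simp
  then have "4 ^ n \<le> Suc (2 * n) * ((2 * n) choose n)" by (simp only: of_nat_le_iff)
  also have "\<dots> \<le> Lcm {1..Suc (2 * n)}" by (intro Lcm_ge_binomial) auto
  finally show ?thesis .
qed simp

text \<open>Every prime p \<le> m enters the Lcm with a power p^k \<le> m, and there are
  \<open>prime_pi m\<close> such primes.\<close>

lemma Lcm_le_power_prime_pi: "Lcm {1..m} \<le> m ^ prime_pi m"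
proof -
  define P where "P = {p::nat. prime p \<and> p \<le> m}"
  have fin: "finite P" unfolding P_def by (rule finite_subset[of _ "{..m}"]) auto
  define k where "k p = Max {k. p ^ k \<le> m}" for p
  have fk: "finite {k. p ^ k \<le> m}" if "p \<in> P" for p
  proof (rule finite_subset[of _ "{..m}"])
    have "p \<ge> 2" using that prime_ge_2_nat by (auto simp: P_def)
    then have "k < p ^ k" for k using less_exp power_mono[of 2 p k] by (meson less_le_trans zero_le)
    then show "{k. p ^ k \<le> m} \<subseteq> {..m}" by (auto intro: less_imp_le less_le_trans)
  qed simp
  have k_le: "p ^ k p \<le> m" if "p \<in> P" for p
  proof -
    have "p ^ 0 \<le> m" using that prime_gt_0_nat[of p] by (auto simp: P_def)
    then have "k p \<in> {k. p ^ k \<le> m}" unfolding k_def using fk[OF that] by (intro Max_in) blast+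
    then show ?thesis by simp
  qed
  have "Lcm {1..m} dvd (\<Prod>p\<in>P. p ^ k p)"
  proof (rule Lcm_least)
    fix j assume j: "j \<in> {1..m}"
    have "(\<Prod>p\<in>prime_factors j. p ^ multiplicity p j) dvd (\<Prod>p\<in>P. p ^ k p)"
    proof (rule prod_dvd_prod_subset2)
      show "prime_factors j \<subseteq> P"
        using j by (auto simp: P_def prime_factors_dvd dest!: dvd_imp_le)
      fix p assume p: "p \<in> prime_factors j"
      then have pP: "p \<in> P" using \<open>prime_factors j \<subseteq> P\<close> by blast
      have "p ^ multiplicity p j \<le> m"
        using dvd_imp_le[OF multiplicity_dvd[of p j]] j by auto
      then have "multiplicity p j \<le> k p" unfolding k_def using fk[OF pP] by (intro Max_ge) auto
      then show "p ^ multiplicity p j dvd p ^ k p" by (rule le_imp_power_dvd)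
    qed (rule fin)
    then show "j dvd (\<Prod>p\<in>P. p ^ k p)" using j prod_prime_factors[of j] by simp
  qed
  moreover have "(\<Prod>p\<in>P. p ^ k p) > 0" by (auto intro!: prod_pos simp: P_def prime_gt_0_nat)
  ultimately have "Lcm {1..m} \<le> (\<Prod>p\<in>P. p ^ k p)" by (rule dvd_imp_le)
  also have "\<dots> \<le> (\<Prod>p\<in>P. m)" by (intro prod_mono) (use k_le in auto)
  finally show ?thesis by (simp add: P_def prime_pi_def)
qed

lemma prime_counting_eq: "x \<ge> 0 \<Longrightarrow> prime_counting x = prime_pi (nat \<lfloor>x\<rfloor>)"
  unfolding prime_counting_def prime_pi_def by (intro arg_cong[where f = card]) (auto simp: le_nat_iff le_floor_iff)

lemma finite_primes_upto: "finite {p::nat. prime p \<and> real p \<le> x}"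
  by (rule finite_subset[of _ "{..nat \<lfloor>x\<rfloor>}"]) (auto simp: le_nat_floor)

lemma prime_counting_mono: "x \<le> y \<Longrightarrow> prime_counting x \<le> prime_counting y"
  unfolding prime_counting_def
  by (intro card_mono finite_primes_upto) auto

text \<open>Chebyshev's bound: the two estimates of the Lcm of 1, ..., 2 n + 1 give, after taking
  logarithms, n ln 4 \<le> \<open>prime_pi (2 * n + 1)\<close> ln (2 n + 1).\<close>

lemma prime_counting_lower_bound:
  assumes "x \<ge> 3"
  shows "(x - 3) / 2 * ln 4 / ln x \<le> real (prime_counting x)"
proof -
  \<comment> \<open>The largest n with 2 n + 1 \<le> x; rounding costs less than 1, so n exceeds (x
    - 3) / 2.\<close>
  define n where "n = nat \<lfloor>(x - 1) / 2\<rfloor>"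
  have n: "real n \<le> (x - 1) / 2" "real n > (x - 1) / 2 - 1"
  proof -
    have "real n = real_of_int \<lfloor>(x - 1) / 2\<rfloor>" using assms by (simp add: n_def)
    then show "real n \<le> (x - 1) / 2" "real n > (x - 1) / 2 - 1"
      using floor_correct[of "(x - 1) / 2"] by linarith+
  qed
  have n1: "n \<ge> 1" using assms by (simp add: n_def le_nat_floor)
  let ?m = "Suc (2 * n)"
  have "4 ^ n \<le> ?m ^ prime_pi ?m"
    using four_power_le_Lcm[of n] Lcm_le_power_prime_pi[of ?m] by (rule order_trans)
  then have "real (4 ^ n) \<le> real (?m ^ prime_pi ?m)" by (simp only: of_nat_le_iff)
  then have "ln (4 ^ n) \<le> ln (real ?m ^ prime_pi ?m)"
    by (subst ln_le_cancel_iff) (simp_all del: of_nat_Suc)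
  then have "real n * ln 4 \<le> real (prime_pi ?m) * ln (real ?m)"
    by (simp add: ln_realpow del: of_nat_Suc)
  also have "\<dots> \<le> real (prime_counting x) * ln x"
  proof (rule mult_mono)
    have mx: "real ?m \<le> x" using n by simp
    show "ln (real ?m) \<le> ln x" using mx by (subst ln_le_cancel_iff) auto
    have "prime_pi ?m = prime_counting (real ?m)" by (simp add: prime_counting_eq del: of_nat_Suc)
    then show "real (prime_pi ?m) \<le> real (prime_counting x)"
      using prime_counting_mono[OF mx] by simp
  qed auto
  finally have "real n * ln 4 \<le> real (prime_counting x) * ln x" .
  moreover have "(x - 3) / 2 * ln 4 \<le> real n * ln 4"
  proof (rule mult_right_mono)
    show "(x - 3) / 2 \<le> real n" using n(2) by argo
  qed simp
  ultimately have "(x - 3) / 2 * ln 4 \<le> real (prime_counting x) * ln x" by linarith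
  then show ?thesis using assms by (simp add: divide_le_eq)
qed

text \<open>Such primes divide the product of the numbers N^n - 1 for 1 \<le> n \<le> Y. This
  product is at most N^(Y^2), whereas a product of k distinct primes is at least 2^k.\<close>

lemma card_small_order_primes:
  fixes N Y :: nat
  assumes "N \<ge> 2"
  defines "P \<equiv> {p. prime p \<and> coprime p N \<and> ord p N \<le> Y}"
  shows "finite P" and "real (card P) \<le> (real Y)\<^sup>2 * log 2 (real N)"
proof -
  define D where "D = (\<Prod>n\<in>{1..Y}. N ^ n - 1)"
  have D0: "D > 0"
    unfolding D_def
  proof (rule prod_pos)
    fix n assume "n \<in> {1..Y}"
    then have "1 < N ^ n" using assms(1) by (intro one_less_power) auto
    then show "0 < N ^ n - 1" by simp
  qed
  have dvd: "p dvd D" if "p \<in> P" for p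
  proof -
    have p: "prime p" "coprime p N" "ord p N \<le> Y" using that by (auto simp: P_def)
    have "[N ^ ord p N = 1] (mod p)" by (rule ord)
    then have "p dvd N ^ ord p N - 1"
      by (metis cong_to_1_nat)
    moreover have "ord p N \<in> {1..Y}" using p by (simp add: Suc_le_eq)
    then have "N ^ ord p N - 1 dvd D" unfolding D_def by (intro dvd_prodI) auto
    ultimately show ?thesis by (rule dvd_trans)
  qed
  then show fin: "finite P"
    using D0 by (intro finite_subset[of P "{..D}"]) (auto dest!: dvd_imp_le)
  have "\<Prod>F dvd D" if "finite F" "F \<subseteq> P" for F
    using that
  proof (induction F rule: finite_induct)
    case (insert p F)
    have "coprime p (\<Prod>F)"
    proof (rule prod_coprime_right)
      fix q assume "q \<in> F"
      then show "coprime p q" using insert by (intro primes_coprime) (auto simp: P_def)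
    qed
    then have "p * \<Prod>F dvd D" using insert dvd[of p] by (intro divides_mult) auto
    then show ?case using insert by simp
  qed simp
  from this[OF fin] have "\<Prod>P dvd D" by simp
  then have "\<Prod>P \<le> D" using D0 by (rule dvd_imp_le)
  have "2 ^ card P = (\<Prod>p\<in>P. 2)" by simp
  also have "\<dots> \<le> \<Prod>P" by (intro prod_mono) (auto simp: P_def prime_ge_2_nat)
  also have "\<dots> \<le> D" by fact
  also have "D \<le> (\<Prod>n\<in>{1..Y}. N ^ Y)"
    unfolding D_def
  proof (rule prod_mono, safe)
    fix n assume "n \<in> {1..Y}"
    then have "N ^ n \<le> N ^ Y" using assms by (intro power_increasing) auto
    then show "N ^ n - 1 \<le> N ^ Y" by simp
  qed
  also have "\<dots> = N ^ (Y * Y)" by (simp add: power_mult)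
  finally have "real (2 ^ card P) \<le> real (N ^ (Y * Y))" by (simp only: of_nat_le_iff)
  then have "log 2 (2 ^ card P) \<le> log 2 (real N ^ (Y * Y))"
    using assms by (subst log_le_cancel_iff) auto
  then show "real (card P) \<le> (real Y)\<^sup>2 * log 2 (real N)"
    using assms by (simp add: log_nat_power power2_eq_square)
qed

text \<open>Iterating the inclusion of T in the union of its images covers T by at most (#L)^m
  intervals of radius R / N^m, each holding at most one point of S. For the cycle points this is the
  box dimension bound.\<close>

lemma card_separated_le:
  fixes T S :: "real set" and L :: "int set"
  assumes N: "N \<ge> (2::int)" and finL: "finite L"
    and T: "\<And>y. y \<in> T \<Longrightarrow> \<bar>y\<bar> \<le> R \<and> (\<exists>y'\<in>T. \<exists>l\<in>L. y = contraction N l y')"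
    and S: "S \<subseteq> T" and sep: "\<And>y z. y \<in> S \<Longrightarrow> z \<in> S \<Longrightarrow> y \<noteq> z \<Longrightarrow> 2 * R / real_of_int N ^ m < \<bar>y - z\<bar>"
  shows "finite S" "card S \<le> card L ^ m"
proof -
  have N0: "real_of_int N > 0" using N by simp
  have "\<exists>W. finite W \<and> card W \<le> card L ^ m \<and> (\<forall>y\<in>T. \<exists>w\<in>W. \<bar>y - w\<bar> \<le> R / real_of_int N ^ m)"
  proof (induction m)
    case 0
    show ?case using T by (intro exI[of _ "{0}"]) auto
  next
    case (Suc m)
    then obtain W where W: "finite W" "card W \<le> card L ^ m"
      "\<forall>y\<in>T. \<exists>w\<in>W. \<bar>y - w\<bar> \<le> R / real_of_int N ^ m" by blast
    let ?W = "(\<lambda>(l, w). contraction N l w) ` (L \<times> W)"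
    have "card ?W \<le> card (L \<times> W)" using W finL by (intro card_image_le) auto
    also have "\<dots> \<le> card L ^ Suc m" using W by (simp add: card_cartesian_product)
    finally have "card ?W \<le> card L ^ Suc m" .
    moreover have "\<exists>w\<in>?W. \<bar>y - w\<bar> \<le> R / real_of_int N ^ Suc m" if y: "y \<in> T" for y
    proof -
      from T[OF y] obtain y' l where y': "y' \<in> T" "l \<in> L" "y = contraction N l y'" by blast
      obtain w where w: "w \<in> W" "\<bar>y' - w\<bar> \<le> R / real_of_int N ^ m" using W y' by blast
      have "y - contraction N l w = (y' - w) / real_of_int N"
        using y' by (simp add: contraction_def diff_divide_distrib add_divide_distrib)
      then have "\<bar>y - contraction N l w\<bar> = \<bar>y' - w\<bar> / real_of_int N"
        using N0 by (simp add: abs_divide)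
      also have "\<dots> \<le> R / real_of_int N ^ m / real_of_int N"
        using w N0 by (intro divide_right_mono) auto
      finally show ?thesis using w y' by (intro bexI[of _ "contraction N l w"]) (auto simp: mult.commute)
    qed
    ultimately show ?case using W finL by (intro exI[of _ ?W]) auto
  qed
  then obtain W where W: "finite W" "card W \<le> card L ^ m"
    "\<forall>y\<in>T. \<exists>w\<in>W. \<bar>y - w\<bar> \<le> R / real_of_int N ^ m" by blast
  then obtain f where f: "\<And>y. y \<in> T \<Longrightarrow> f y \<in> W \<and> \<bar>y - f y\<bar> \<le> R / real_of_int N ^ m" by metis
  have inj: "inj_on f S"
  proof (rule inj_onI, rule ccontr)
    fix y z assume yz: "y \<in> S" "z \<in> S" "f y = f z" "y \<noteq> z"
    then have "\<bar>y - f y\<bar> \<le> R / real_of_int N ^ m" "\<bar>z - f y\<bar> \<le> R / real_of_int N ^ m"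
      using f[of y] f[of z] S by auto
    then have "\<bar>y - z\<bar> \<le> 2 * R / real_of_int N ^ m" by linarith
    then show False using sep[of y z] yz by simp
  qed
  have sub: "f ` S \<subseteq> W" using f S by auto
  show "finite S" using inj sub W(1) by (metis finite_imageD finite_subset)
  show "card S \<le> card L ^ m" using card_inj_on_le[OF inj sub W(1)] W(2) by linarith
qed

section \<open>Prime eigenvalues\<close>

text \<open>Unitarity becomes the vanishing of sums of N-th roots of unity with explicit integer
  exponents, the form in which multiplication of L by p acts by raising each root to its p-th
  power.\<close>

lemma unitary_on_hadamard_iff:
  fixes N :: int and B L :: "int set"
  assumes fin: "finite B" "finite L" and card: "card B = card L" "card B > 0"
  shows "unitary_on B L (\<lambda>b l. of_real (1 / sqrt (real (card B))) *
      cis (2 * pi * real_of_int b * real_of_int l / real_of_int N)) \<longleftrightarrow>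
    (\<forall>b\<in>B. \<forall>b'\<in>B. b \<noteq> b' \<longrightarrow> (\<Sum>l\<in>L. cis (2 * pi * real_of_int ((b - b') * l) / real_of_int N)) = 0) \<and>
    (\<forall>l\<in>L. \<forall>l'\<in>L. l \<noteq> l' \<longrightarrow> (\<Sum>b\<in>B. cis (2 * pi * real_of_int (b * (l' - l)) / real_of_int N)) = 0)"
proof -
  let ?r = "complex_of_real (1 / sqrt (real (card B)))"
  let ?H = "\<lambda>b l. ?r * cis (2 * pi * real_of_int b * real_of_int l / real_of_int N)"
  have r: "?r * ?r = of_real (1 / real (card B))" by (simp flip: of_real_mult)
  have row: "?H b l * cnj (?H b' l) = (?r * ?r) * cis (2 * pi * real_of_int ((b - b') * l) / real_of_int N)" for b b' l
  proof -
    have "?H b l * cnj (?H b' l) = (?r * ?r) * (cis (2 * pi * real_of_int b * real_of_int l / real_of_int N) *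
        cis (- (2 * pi * real_of_int b' * real_of_int l / real_of_int N)))"
      by (simp only: complex_cnj_mult complex_cnj_complex_of_real cis_cnj mult_ac)
    then show ?thesis unfolding cis_mult by (simp add: algebra_simps diff_divide_distrib)
  qed
  have col: "cnj (?H b l) * ?H b l' = (?r * ?r) * cis (2 * pi * real_of_int (b * (l' - l)) / real_of_int N)" for b l l'
  proof -
    have "cnj (?H b l) * ?H b l' = (?r * ?r) * (cis (2 * pi * real_of_int b * real_of_int l' / real_of_int N) *
        cis (- (2 * pi * real_of_int b * real_of_int l / real_of_int N)))"
      by (simp only: complex_cnj_mult complex_cnj_complex_of_real cis_cnj mult_ac)
    then show ?thesis unfolding cis_mult by (simp add: algebra_simps diff_divide_distrib)
  qed
  have rows: "(\<Sum>l\<in>L. ?H b l * cnj (?H b' l)) = (if b = b' then 1 else 0) \<longleftrightarrow>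
      (b \<noteq> b' \<longrightarrow> (\<Sum>l\<in>L. cis (2 * pi * real_of_int ((b - b') * l) / real_of_int N)) = 0)" for b b'
    unfolding row r sum_distrib_left[symmetric] using card by auto
  have cols: "(\<Sum>b\<in>B. cnj (?H b l) * ?H b l') = (if l = l' then 1 else 0) \<longleftrightarrow>
      (l \<noteq> l' \<longrightarrow> (\<Sum>b\<in>B. cis (2 * pi * real_of_int (b * (l' - l)) / real_of_int N)) = 0)" for l l'
    unfolding col r sum_distrib_left[symmetric] using card by auto
  show ?thesis unfolding unitary_on_def rows cols by blast
qed

section \<open>Cycles of the contractions\<close>

lemma is_cycle_predecessor:
  assumes "is_cycle N L C" "y \<in> C"
  obtains y' l where "y' \<in> C" "l \<in> L" "y = contraction N l y'"
proof -
  obtain k X l where k: "k \<ge> (1::nat)" "C = X ` {1..k}" "l ` {1..k} \<subseteq> L"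
    "\<forall>j\<in>{1..<k}. contraction N (l j) (X j) = X (j + 1)" "contraction N (l k) (X k) = X 1"
    using assms(1) unfolding is_cycle_def by blast
  obtain j where j: "j \<in> {1..k}" "y = X j" using assms(2) k(2) by blast
  show ?thesis
  proof (cases "j = 1")
    case True
    then show ?thesis using k j by (intro that[of "X k" "l k"]) auto
  next
    case False
    then have "j - 1 \<in> {1..<k}" "j - 1 + 1 = j" using j by auto
    then have "contraction N (l (j - 1)) (X (j - 1)) = X j" using k(4) by metis
    moreover have "j - 1 \<in> {1..k}" using j False by auto
    then have "X (j - 1) \<in> C" "l (j - 1) \<in> L" using k(2,3) by blast+
    ultimately show ?thesis using j(2) by (intro that[of "X (j - 1)" "l (j - 1)"]) simp_all
  qed
qed

text \<open>Scaling by \<open>a\<close> commutes with the dynamics. A real factor covers both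
  directions: p from L to pL, and 1 / p back.\<close>

lemma is_cycle_scale:
  assumes "is_cycle N L C" "\<And>l. l \<in> L \<Longrightarrow> \<exists>l'\<in>L'. real_of_int l' = a * real_of_int l"
  shows "is_cycle N L' ((*) a ` C)"
proof -
  obtain k X l where k: "k \<ge> (1::nat)" "C = X ` {1..k}" "l ` {1..k} \<subseteq> L"
    "\<forall>j\<in>{1..<k}. contraction N (l j) (X j) = X (j + 1)" "contraction N (l k) (X k) = X 1"
    using assms(1) unfolding is_cycle_def by blast
  obtain f where f: "\<And>l. l \<in> L \<Longrightarrow> f l \<in> L' \<and> real_of_int (f l) = a * real_of_int l"
    using assms(2) by metis
  have scale: "contraction N (f l) (a * x) = a * contraction N l x" if "l \<in> L" for l x
    using f[OF that] by (simp add: contraction_def distrib_left)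
  show ?thesis
    unfolding is_cycle_def
  proof (intro exI conjI)
    show "k \<ge> 1" by fact
    show "(*) a ` C = (\<lambda>j. a * X j) ` {1..k}" using k(2) by auto
    show "(f \<circ> l) ` {1..k} \<subseteq> L'" using f k(3) by auto
    show "\<forall>j\<in>{1..<k}. contraction N ((f \<circ> l) j) (a * X j) = a * X (j + 1)"
      using k(3,4) scale by (auto simp: image_subset_iff)
    show "contraction N ((f \<circ> l) k) (a * X k) = a * X 1"
      using k(1,3,5) scale by (auto simp: image_subset_iff)
  qed
qed

lemma is_cycle_finite: "is_cycle N L C \<Longrightarrow> finite C"
  by (auto simp: is_cycle_def)

text \<open>At a cycle point z of largest modulus N |z| \<le> |z| + R, and N \<ge> 2.\<close>

lemma is_cycle_bounded:
  assumes "is_cycle N L C" "N \<ge> 2" "\<And>l. l \<in> L \<Longrightarrow> \<bar>real_of_int l\<bar> \<le> R" "y \<in> C"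
  shows "\<bar>y\<bar> \<le> R"
proof -
  have fin: "finite (abs ` C)" using is_cycle_finite[OF assms(1)] by simp
  then have "Max (abs ` C) \<in> abs ` C" using assms(4) by (intro Max_in) auto
  then obtain z where z: "z \<in> C" "\<bar>z\<bar> = Max (abs ` C)" by auto
  obtain z' l where z': "z' \<in> C" "l \<in> L" "z = contraction N l z'"
    using is_cycle_predecessor[OF assms(1) z(1)] .
  have "\<bar>z'\<bar> \<le> \<bar>z\<bar>" unfolding z(2) using fin z'(1) by (intro Max_ge) auto
  have "real_of_int N * z = z' + real_of_int l" using z'(3) assms(2) by (simp add: contraction_def)
  then have "real_of_int N * \<bar>z\<bar> = \<bar>z' + real_of_int l\<bar>"
    using assms(2) by (metis abs_mult abs_of_nonneg of_int_0_le_iff order.trans zero_le_numeral)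
  also have "\<dots> \<le> \<bar>z\<bar> + R" using \<open>\<bar>z'\<bar> \<le> \<bar>z\<bar>\<close> assms(3)[OF z'(2)] by linarith
  finally have "real_of_int N * \<bar>z\<bar> \<le> \<bar>z\<bar> + R" .
  moreover have "2 * \<bar>z\<bar> \<le> real_of_int N * \<bar>z\<bar>" using assms(2) by (intro mult_right_mono) auto
  ultimately have "\<bar>z\<bar> \<le> R" by linarith
  moreover have "\<bar>y\<bar> \<le> \<bar>z\<bar>" unfolding z(2) using fin assms(4) by (intro Max_ge) auto
  ultimately show ?thesis by linarith
qed

text \<open>Bezout's identity. It serves with p and N to go backwards in a cycle, and with two
  primes to show that their new points are disjoint.\<close>

lemma Ints_of_coprime_multiples:
  assumes "coprime a b" "real_of_int a * u \<in> \<int>" "real_of_int b * u \<in> \<int>"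
  shows "u \<in> \<int>"
proof -
  obtain s t where "s * a + t * b = 1" using bezout_int[of a b] assms(1) by auto
  then have "real_of_int s * real_of_int a + real_of_int t * real_of_int b = 1"
    by (metis of_int_1 of_int_add of_int_mult)
  then have "u = real_of_int s * (real_of_int a * u) + real_of_int t * (real_of_int b * u)"
    by (metis distrib_right mult.assoc mult_1)
  also have "\<dots> \<in> \<int>"
    by (intro Ints_add Ints_mult[OF Ints_of_int assms(2)] Ints_mult[OF Ints_of_int assms(3)])
  finally show ?thesis .
qed

context based_hadamard_triple
begin

text \<open>Unitarity consists of finitely many vanishing sums, and each of them survives the
  multiplication of its exponents by a large prime, so a common threshold exists.\<close>

lemma eventually_hadamard_prime:
  "\<forall>\<^sub>F p in sequentially. prime p \<longrightarrow> hadamard_triple N B ((*) (int p) ` L)"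
proof -
  note unit = unitary_on_hadamard_iff[OF finB finL cardL[symmetric]]
  have card_pos: "card B > 0" using cardB by simp
  have orth: "unitary_on B L hmat" using hadamard unfolding hadamard_triple_def by blast
  have ev: "\<forall>\<^sub>F p in sequentially. prime p \<longrightarrow> (\<Sum>i\<in>A. cis (2 * pi * real_of_int (e i * int p) / real_of_int N)) = 0"
    if zero: "(\<Sum>i\<in>A. cis (2 * pi * real_of_int (e i) / real_of_int N)) = 0" for A :: "int set" and e
  proof -
    obtain K where "\<And>p. prime p \<Longrightarrow> p > K \<Longrightarrow>
        (\<Sum>i\<in>A. cis (2 * pi * real_of_int (e i * int p) / real_of_int N)) = 0"
      using root_of_unity_sum_prime_power[OF _ zero] N2 by auto
    then show ?thesis unfolding eventually_sequentially by (intro exI[of _ "Suc K"]) auto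
  qed
  have "\<forall>\<^sub>F p in sequentially. \<forall>b\<in>B. \<forall>b'\<in>B. b \<noteq> b' \<longrightarrow> prime p \<longrightarrow>
      (\<Sum>l\<in>L. cis (2 * pi * real_of_int ((b - b') * l * int p) / real_of_int N)) = 0"
  proof (intro eventually_ball_finite finB ballI)
    fix b b' assume "b \<in> B" "b' \<in> B"
    then show "\<forall>\<^sub>F p in sequentially. b \<noteq> b' \<longrightarrow> prime p \<longrightarrow>
        (\<Sum>l\<in>L. cis (2 * pi * real_of_int ((b - b') * l * int p) / real_of_int N)) = 0"
      using orth ev[of "\<lambda>l. (b - b') * l" L] unfolding unit[OF card_pos]
      by (cases "b = b'") auto
  qed
  moreover have "\<forall>\<^sub>F p in sequentially. \<forall>l\<in>L. \<forall>l'\<in>L. l \<noteq> l' \<longrightarrow> prime p \<longrightarrow>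
      (\<Sum>b\<in>B. cis (2 * pi * real_of_int (b * (l' - l) * int p) / real_of_int N)) = 0"
  proof (intro eventually_ball_finite finL ballI)
    fix l l' assume "l \<in> L" "l' \<in> L"
    then show "\<forall>\<^sub>F p in sequentially. l \<noteq> l' \<longrightarrow> prime p \<longrightarrow>
        (\<Sum>b\<in>B. cis (2 * pi * real_of_int (b * (l' - l) * int p) / real_of_int N)) = 0"
      using orth ev[of "\<lambda>b. b * (l' - l)" B] unfolding unit[OF card_pos]
      by (cases "l = l'") auto
  qed
  ultimately show ?thesis
  proof eventually_elim
    case (elim p)
    show ?case
    proof
      assume p: "prime p"
      then have p0: "int p \<noteq> 0" using prime_gt_0_nat[of p] by simp
      have inj: "inj_on ((*) (int p)) A" for A using p0 by (simp add: inj_on_def)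
      have card: "card B = card ((*) (int p) ` L)" using cardL by (simp add: card_image[OF inj])
      have "unitary_on B ((*) (int p) ` L) hmat"
        unfolding unitary_on_hadamard_iff[OF finB finite_imageI[OF finL] card card_pos]
      proof (intro conjI ballI impI)
        fix b b' assume "b \<in> B" "b' \<in> B" "b \<noteq> b'"
        then have "(\<Sum>l\<in>L. cis (2 * pi * real_of_int ((b - b') * l * int p) / real_of_int N)) = 0"
          using elim(1) p by blast
        then show "(\<Sum>l\<in>(*) (int p) ` L. cis (2 * pi * real_of_int ((b - b') * l) / real_of_int N)) = 0"
          by (subst sum.reindex[OF inj]) (simp add: mult_ac)
      next
        fix l l' assume "l \<in> (*) (int p) ` L" "l' \<in> (*) (int p) ` L" "l \<noteq> l'"
        then obtain k k' where k: "k \<in> L" "k' \<in> L" "k \<noteq> k'" "l = int p * k" "l' = int p * k'" by blast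
        then have "(\<Sum>b\<in>B. cis (2 * pi * real_of_int (b * (k' - k) * int p) / real_of_int N)) = 0"
          using elim(2) p by blast
        moreover have "b * (l' - l) = b * (k' - k) * int p" for b
          using k by (simp add: algebra_simps)
        ultimately show "(\<Sum>b\<in>B. cis (2 * pi * real_of_int (b * (l' - l)) / real_of_int N)) = 0"
          by (simp only:)
      qed
      then show "hadamard_triple N B ((*) (int p) ` L)"
        using N2 finB finL cardB card by (simp add: hadamard_triple_def)
    qed
  qed
qed

section \<open>New cycle points and their number\<close>

definition cycle_points :: "real set" where
  "cycle_points = \<Union> {C. is_cycle N L C}"

text \<open>The cycle points at which scaling by the prime p would create a new mask cycle, as seen by
  the digit b.\<close>

definition new_points :: "int \<Rightarrow> nat \<Rightarrow> real set" where
  "new_points b p = {y \<in> cycle_points. real p * (real_of_int b * y) \<in> \<int> \<and> real_of_int b * y \<notin> \<int>}"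

text \<open>Closure under predecessors makes the cycle points an admissible set T in
  \<open>card_separated_le\<close>.\<close>

lemma cycle_points_predecessor:
  assumes "y \<in> cycle_points"
  obtains y' l where "y' \<in> cycle_points" "l \<in> L" "y = contraction N l y'"
proof -
  obtain C where C: "is_cycle N L C" "y \<in> C" using assms by (auto simp: cycle_points_def)
  obtain y' l where "y' \<in> C" "l \<in> L" "y = contraction N l y'"
    using is_cycle_predecessor[OF C] .
  then show ?thesis using C(1) by (intro that[of y' l]) (auto simp: cycle_points_def)
qed

lemma is_mask_cycle_iff:
  "is_mask_cycle N B L' C \<longleftrightarrow> is_cycle N L' C \<and> (\<forall>x\<in>C. \<forall>b\<in>B. real_of_int b * x \<in> \<int>)"
  using norm_mask_eq_1_iff[OF finB zero_mem(1)] by (simp add: is_mask_cycle_def)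

text \<open>Multiplying by p keeps b x integral, so mask cycles of L become mask cycles of pL.
  Dividing by p returns a cycle of L on which only p b y is known to be integral; the absence of new
  points closes this gap.\<close>

lemma canonical_spectrum_scaled:
  assumes p: "p > 0" and good: "\<And>b. b \<in> B \<Longrightarrow> new_points b p = {}"
  shows "canonical_spectrum N B ((*) (int p) ` L) = (*) (real p) ` \<Lambda>"
proof
  show "(*) (real p) ` \<Lambda> \<subseteq> canonical_spectrum N B ((*) (int p) ` L)"
  proof clarify
    fix y assume "y \<in> \<Lambda>"
    then show "real p * y \<in> canonical_spectrum N B ((*) (int p) ` L)"
    proof induction
      case (cycle C x)
      have "is_mask_cycle N B ((*) (int p) ` L) ((*) (real p) ` C)"
        unfolding is_mask_cycle_iff
      proof
        show "is_cycle N ((*) (int p) ` L) ((*) (real p) ` C)"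
          using cycle(1) by (intro is_cycle_scale[of N L]) (auto simp: is_mask_cycle_iff)
        have "real_of_int b * (real p * x) \<in> \<int>" if "b \<in> B" "x \<in> C" for b x
          using cycle(1) that Ints_mult[OF Ints_of_nat[of p], of "real_of_int b * x"]
          by (auto simp: is_mask_cycle_iff mult.left_commute)
        then show "\<forall>x\<in>(*) (real p) ` C. \<forall>b\<in>B. real_of_int b * x \<in> \<int>" by blast
      qed
      from canonical_spectrum.cycle[OF this imageI[OF cycle(2)]] show ?case by simp
    next
      case (step y l)
      have "real p * (real_of_int N * y + real_of_int l) = real_of_int N * (real p * y) + real_of_int (int p * l)"
        by (simp add: algebra_simps)
      then show ?case
        using canonical_spectrum.step[OF step.IH imageI[OF step.hyps(2), of "(*) (int p)"]] by (simp only:)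
    qed
  qed
  show "canonical_spectrum N B ((*) (int p) ` L) \<subseteq> (*) (real p) ` \<Lambda>"
  proof
    fix y assume "y \<in> canonical_spectrum N B ((*) (int p) ` L)"
    then show "y \<in> (*) (real p) ` \<Lambda>"
    proof induction
      case (cycle C x)
      let ?C = "(*) (1 / real p) ` C"
      have cyc: "is_cycle N L ?C"
        using cycle(1) p by (intro is_cycle_scale[of N "(*) (int p) ` L"]) (auto simp: is_mask_cycle_iff)
      have "real_of_int b * y \<in> \<int>" if "y \<in> ?C" "b \<in> B" for y b
      proof -
        have "real p * y \<in> C" using that p by auto
        then have "real p * (real_of_int b * y) \<in> \<int>"
          using cycle(1) that by (auto simp: is_mask_cycle_iff mult.left_commute)
        then show ?thesis
          using good[OF that(2)] that(1) cyc by (auto simp: new_points_def cycle_points_def)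
      qed
      then have "is_mask_cycle N B L ?C" using cyc by (simp add: is_mask_cycle_iff)
      then have "- (1 / real p * x) \<in> \<Lambda>" using cycle(2) by (intro canonical_spectrum.cycle) auto
      then show ?case using p by (intro image_eqI[of _ _ "- (1 / real p * x)"]) auto
    next
      case (step y l)
      then obtain z k where "z \<in> \<Lambda>" "y = real p * z" "k \<in> L" "l = int p * k" by blast
      then show ?case
        using canonical_spectrum.step[of z N B L k]
        by (intro image_eqI[of _ _ "real_of_int N * z + real_of_int k"]) (auto simp: algebra_simps)
    qed
  qed
qed

lemma prime_eigenvalue_if_no_new_points:
  assumes "prime p" "hadamard_triple N B ((*) (int p) ` L)" "\<And>b. b \<in> B \<Longrightarrow> new_points b p = {}"
  shows "p \<in> prime_eigenvalues N B L"
proof -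
  interpret scaled: based_hadamard_triple N B "(*) (int p) ` L"
    using assms(2) zero_mem by unfold_locales auto
  have "spectral_pair \<mu> ((*) (real p) ` \<Lambda>)"
    using scaled.spectral_pair_canonical canonical_spectrum_scaled[OF prime_gt_0_nat[OF assms(1)] assms(3)]
    by simp
  then show ?thesis
    using assms(1) spectral_pair_canonical by (simp add: prime_eigenvalues_def spectral_eigenvalue_def)
qed

text \<open>A backward orbit y -> N y - l stays among the new points since N is invertible modulo p.
  The integers p b y along it are prime to p and get multiplied by N modulo p at each step, so its
  first ord_p(N) points differ.\<close>

lemma ord_le_card_new_points:
  assumes p: "prime p" "int p > N" and ne: "new_points b p \<noteq> {}" and fin: "finite (new_points b p)"
  shows "ord p (nat N) \<le> card (new_points b p)"
proof -
  let ?S = "new_points b p"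
  have cop: "coprime (int p) N"
    using p N2 by (intro prime_imp_coprime) (auto dest: zdvd_imp_le)
  have step: "\<exists>y'\<in>?S. \<exists>l. y' = real_of_int N * y - real_of_int l" if y: "y \<in> ?S" for y
  proof -
    have "y \<in> cycle_points" using y by (simp add: new_points_def)
    then obtain y' l where y': "y' \<in> cycle_points" "l \<in> L" "y = contraction N l y'"
      by (rule cycle_points_predecessor)
    then have eq: "y' = real_of_int N * y - real_of_int l"
      using N2 by (simp add: contraction_def)
    have "real p * (real_of_int b * y') = real_of_int N * (real p * (real_of_int b * y)) - real_of_int (int p * b * l)"
      unfolding eq by (simp add: algebra_simps)
    also have "\<dots> \<in> \<int>" using y by (intro Ints_diff Ints_mult[OF Ints_of_int] Ints_of_int) (simp add: new_points_def)
    finally have 1: "real p * (real_of_int b * y') \<in> \<int>" .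
    have 2: "real_of_int b * y' \<notin> \<int>"
    proof
      assume "real_of_int b * y' \<in> \<int>"
      then have "real_of_int b * y' + real_of_int (b * l) \<in> \<int>" by (intro Ints_add Ints_of_int)
      moreover have "real_of_int b * y' + real_of_int (b * l) = real_of_int N * (real_of_int b * y)"
        unfolding eq by (simp add: algebra_simps)
      ultimately have "real_of_int N * (real_of_int b * y) \<in> \<int>" by (simp only:)
      then have "real_of_int b * y \<in> \<int>"
        using y Ints_of_coprime_multiples[OF cop, of "real_of_int b * y"] by (simp add: new_points_def)
      then show False using y by (simp add: new_points_def)
    qed
    show ?thesis
    proof (intro bexI exI)
      show "y' = real_of_int N * y - real_of_int l" by (rule eq)
      show "y' \<in> ?S" using 1 2 y'(1) by (simp add: new_points_def)
    qed
  qed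
  obtain y0 where "y0 \<in> ?S" using ne by blast
  then have "\<exists>f. (\<forall>i. f i \<in> ?S) \<and> (\<forall>i. \<exists>l. f (Suc i) = real_of_int N * f i - real_of_int l)"
    using step dependent_nat_choice[of "\<lambda>_ y. y \<in> ?S" "\<lambda>_ y y'. \<exists>l. y' = real_of_int N * y - real_of_int l"]
    by blast
  then obtain f where f: "\<And>i. f i \<in> ?S" "\<And>i. \<exists>l. f (Suc i) = real_of_int N * f i - real_of_int l" by blast
  have "\<exists>z::int. real p * (real_of_int b * f i) = z" for i
    using f(1)[of i] by (auto simp: new_points_def elim: Ints_cases)
  then obtain z :: "nat \<Rightarrow> int" where z: "\<And>i. real p * (real_of_int b * f i) = z i" by metis
  have zpow: "[z i = N ^ i * z 0] (mod int p)" for i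
  proof (induction i)
    case (Suc i)
    obtain l where l: "f (Suc i) = real_of_int N * f i - real_of_int l" using f(2) by blast
    have "real_of_int (z (Suc i)) = real_of_int (N * z i - int p * b * l)"
      using z[of "Suc i"] z[of i] unfolding l by (simp add: algebra_simps)
    then have "z (Suc i) = N * z i - int p * b * l" by (simp only: of_int_eq_iff)
    then have "[z (Suc i) = N * z i] (mod int p)" by (simp add: cong_iff_dvd_diff)
    also have "[N * z i = N * (N ^ i * z 0)] (mod int p)" by (intro cong_scalar_left Suc)
    finally show ?case by (simp add: mult.assoc)
  qed simp
  have z0: "coprime (z 0) (int p)"
  proof (rule ccontr)
    assume "\<not> ?thesis"
    then have "int p dvd z 0" using p(1) by (metis coprime_commute prime_imp_coprime prime_nat_int_transfer)
    then obtain q where q: "z 0 = int p * q" by (elim dvdE)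
    then have "real p * (real_of_int b * f 0) = real p * real_of_int q" using z[of 0] by simp
    then have "real_of_int b * f 0 = real_of_int q" using prime_gt_0_nat[OF p(1)] by simp
    then show False using f(1)[of 0] by (simp add: new_points_def)
  qed
  have "inj_on f {..<ord p (nat N)}"
  proof (rule inj_onI)
    fix i j assume ij: "i \<in> {..<ord p (nat N)}" "j \<in> {..<ord p (nat N)}" "f i = f j"
    then have "z i = z j" using z[of i] z[of j] by simp
    then have "[N ^ i * z 0 = N ^ j * z 0] (mod int p)" using zpow[of i] zpow[of j] by (metis cong_sym cong_trans)
    then have "[N ^ i = N ^ j] (mod int p)" using cong_mult_rcancel[OF z0] by blast
    then have "[int (nat N ^ i) = int (nat N ^ j)] (mod int p)" using N2 by simp
    then have "[nat N ^ i = nat N ^ j] (mod p)" by (simp only: cong_int_iff)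
    moreover have "coprime p (nat N)" using cop N2 by (metis coprime_int_iff int_nat_eq order.trans zero_le_numeral)
    ultimately have "[i = j] (mod ord p (nat N))" by (simp add: order_divides_expdiff)
    then show "i = j" using ij by (simp add: cong_def)
  qed
  then have "card {..<ord p (nat N)} \<le> card ?S" using f(1) fin by (intro card_inj_on_le) auto
  then show ?thesis by simp
qed

definition radius :: real where "radius = real_of_int (Max (abs ` L))"

lemma digit_le_radius: "l \<in> L \<Longrightarrow> \<bar>real_of_int l\<bar> \<le> radius"
proof -
  assume "l \<in> L"
  then have "\<bar>l\<bar> \<le> Max (abs ` L)" using finL by simp
  then show ?thesis unfolding radius_def by (simp only: of_int_abs[symmetric] of_int_le_iff)
qed

lemma cycle_points_bounded: "y \<in> cycle_points \<Longrightarrow> \<bar>y\<bar> \<le> radius"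
  using is_cycle_bounded[OF _ N2 digit_le_radius] by (auto simp: cycle_points_def)

text \<open>New points for different primes are distinct fractions with small denominators, hence well
  separated; so their total number over all primes up to x is controlled by the box dimension of
  the attractor of the digit set L.\<close>

lemma card_large_order_new_points:
  assumes x: "x > 0" and b: "b \<noteq> 0" and m: "2 * radius * (\<bar>real_of_int b\<bar> * x\<^sup>2) < real_of_int N ^ m"
    and Y: "Y > 0"
  defines "P \<equiv> {p. prime p \<and> real p \<le> x \<and> int p > N \<and> ord p (nat N) \<ge> Y \<and> new_points b p \<noteq> {}}"
  shows "Y * card P \<le> card L ^ m"
proof -
  let ?U = "\<Union>p\<in>P. new_points b p"
  have b0: "\<bar>real_of_int b\<bar> \<ge> 1" using b by linarith
  have sep: "2 * radius / real_of_int N ^ m < \<bar>y - z\<bar>" if yz: "y \<in> ?U" "z \<in> ?U" "y \<noteq> z" for y z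
  proof -
    obtain p q where pq: "p \<in> P" "y \<in> new_points b p" "q \<in> P" "z \<in> new_points b q" using yz by blast
    then have pq0: "real p > 0" "real q > 0" "real p \<le> x" "real q \<le> x"
      by (auto simp: P_def prime_gt_0_nat)
    \<comment> \<open>This is p q b (y - z), a nonzero integer, so |y - z| is at least 1 / (|b|
      x^2).\<close>
    define d where "d = real q * (real p * (real_of_int b * y)) - real p * (real q * (real_of_int b * z))"
    have "d \<in> \<int>" 
    proof -
      have "real p * (real_of_int b * y) \<in> \<int>" "real q * (real_of_int b * z) \<in> \<int>"
        using pq by (simp_all add: new_points_def)
      then show ?thesis unfolding d_def
        by (rule Ints_diff[OF Ints_mult[OF Ints_of_nat] Ints_mult[OF Ints_of_nat]])
    qed
    moreover have d: "d = (real p * real q * real_of_int b) * (y - z)" by (simp add: d_def algebra_simps)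
    then have "d \<noteq> 0" using pq0 b yz(3) by simp
    ultimately have "\<bar>d\<bar> \<ge> 1" by (elim Ints_cases) auto
    have "2 * radius < real_of_int N ^ m / (\<bar>real_of_int b\<bar> * x\<^sup>2)"
      using m b0 x by (simp add: field_simps)
    also have "\<dots> \<le> real_of_int N ^ m / (\<bar>real_of_int b\<bar> * x\<^sup>2) * \<bar>d\<bar>"
      using mult_left_mono[OF \<open>\<bar>d\<bar> \<ge> 1\<close>, of "real_of_int N ^ m / (\<bar>real_of_int b\<bar> * x\<^sup>2)"] N2
      by simp
    also have "\<bar>d\<bar> \<le> (x * x * \<bar>real_of_int b\<bar>) * \<bar>y - z\<bar>"
      unfolding d abs_mult using pq0 x by (intro mult_right_mono mult_mono) auto
    then have "real_of_int N ^ m / (\<bar>real_of_int b\<bar> * x\<^sup>2) * \<bar>d\<bar> \<le>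
        real_of_int N ^ m / (\<bar>real_of_int b\<bar> * x\<^sup>2) * ((x * x * \<bar>real_of_int b\<bar>) * \<bar>y - z\<bar>)"
      using N2 by (intro mult_left_mono) auto
    also have "\<dots> = real_of_int N ^ m * \<bar>y - z\<bar>"
      using b0 x by (simp add: field_simps power2_eq_square)
    finally show ?thesis using N2 by (simp add: divide_less_eq mult.commute)
  qed
  have T: "\<bar>y\<bar> \<le> radius \<and> (\<exists>y'\<in>cycle_points. \<exists>l\<in>L. y = contraction N l y')" if "y \<in> cycle_points" for y
    using cycle_points_bounded[OF that] cycle_points_predecessor[OF that] by metis
  have U: "?U \<subseteq> cycle_points" by (auto simp: new_points_def)
  have finU: "finite ?U" and cardU: "card ?U \<le> card L ^ m"
    using card_separated_le[OF N2 finL T U sep] by blast+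
  have finP: "finite P" by (rule finite_subset[OF _ finite_primes_upto[of x]]) (auto simp: P_def)
  have fin: "finite (new_points b p)" if "p \<in> P" for p
    by (rule finite_subset[OF _ finU]) (use that in blast)
  \<comment> \<open>If p b y and q b y are integers for distinct primes p and q, then so is b y, and
    y is not new.\<close>
  have disj: "new_points b p \<inter> new_points b q = {}" if "p \<in> P" "q \<in> P" "p \<noteq> q" for p q
  proof (rule ccontr)
    assume "new_points b p \<inter> new_points b q \<noteq> {}"
    then obtain y where y: "y \<in> new_points b p" "y \<in> new_points b q" by blast
    have "coprime (int p) (int q)" using that primes_coprime[of p q] by (simp add: P_def)
    then have "real_of_int b * y \<in> \<int>"
      using Ints_of_coprime_multiples[of "int p" "int q" "real_of_int b * y"] y
      by (simp add: new_points_def)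
    then show False using y(1) unfolding new_points_def by blast
  qed
  have "Y * card P = (\<Sum>p\<in>P. Y)" by simp
  also have "\<dots> \<le> (\<Sum>p\<in>P. card (new_points b p))"
  proof (rule sum_mono)
    fix p assume p: "p \<in> P"
    then have "ord p (nat N) \<le> card (new_points b p)"
      using fin[OF p] by (intro ord_le_card_new_points) (auto simp: P_def)
    then show "Y \<le> card (new_points b p)" using p by (simp add: P_def)
  qed
  also have "\<dots> = card ?U" using finP fin disj by (intro card_UN_disjoint[symmetric]) auto
  finally show ?thesis using cardU by linarith
qed

section \<open>Counting the primes that are not eigenvalues\<close>

definition non_eigenvalues :: "real \<Rightarrow> nat set" where
  "non_eigenvalues x = {p. prime p \<and> real p \<le> x \<and> p \<notin> prime_eigenvalues N B L}"

text \<open>The exceptions are primes below K, where the Hadamard property may fail or p may be at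
  most N; primes of small order; and primes of large order with new points for some digit. Y and m
  stay free, to be chosen in terms of x.\<close>

lemma card_non_eigenvalues_le:
  obtains K :: nat where "\<forall>x Y m. x > 0 \<longrightarrow> Y > 0 \<longrightarrow>
      (\<forall>b\<in>B. 2 * radius * (\<bar>real_of_int b\<bar> * x\<^sup>2) < real_of_int N ^ m) \<longrightarrow>
      real (card (non_eigenvalues x)) \<le>
        real K + (real Y)\<^sup>2 * log 2 (real_of_int N) + real (card B) * (real (card B) ^ m / real Y)"
proof -
  obtain K0 where K0: "\<And>p. p \<ge> K0 \<Longrightarrow> prime p \<Longrightarrow> hadamard_triple N B ((*) (int p) ` L)"
    using eventually_hadamard_prime unfolding eventually_sequentially by blast
  define K where "K = max K0 (Suc (nat N))"
  show ?thesis
  proof (rule that[of K], intro allI impI)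
    fix x :: real and Y m :: nat
    assume x: "x > 0" and Y: "Y > 0"
      and m: "\<forall>b\<in>B. 2 * radius * (\<bar>real_of_int b\<bar> * x\<^sup>2) < real_of_int N ^ m"
    define S where "S = {p. prime p \<and> coprime p (nat N) \<and> ord p (nat N) \<le> Y}"
    define P where "P b = {p. prime p \<and> real p \<le> x \<and> int p > N \<and> ord p (nat N) \<ge> Y \<and> new_points b p \<noteq> {}}" for b
    have cover: "non_eigenvalues x \<subseteq> {..<K} \<union> S \<union> (\<Union>b\<in>B - {0}. P b)"
    proof
      fix p assume p: "p \<in> non_eigenvalues x"
      then have pp: "prime p" "real p \<le> x" by (auto simp: non_eigenvalues_def)
      show "p \<in> {..<K} \<union> S \<union> (\<Union>b\<in>B - {0}. P b)"
      proof (cases "p < K \<or> p \<in> S")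
        case False
        then have pK: "p \<ge> K0" "p > nat N" by (auto simp: K_def)
        then have pN: "int p > N" using N2 by simp
        have "\<not> p dvd nat N" using pK(2) N2 by (auto dest: dvd_imp_le)
        then have "coprime p (nat N)" using pp(1) by (rule prime_imp_coprime[rotated])
        then have ord: "ord p (nat N) \<ge> Y" using False pp(1) by (simp add: S_def)
        obtain b where b: "b \<in> B" "new_points b p \<noteq> {}"
          using prime_eigenvalue_if_no_new_points[OF pp(1) K0[OF pK(1) pp(1)]] p
          by (auto simp: non_eigenvalues_def)
        \<comment> \<open>For b = 0 the number b y is an integer, so no point is new.\<close>
        moreover have "b \<noteq> 0" using b(2) by (auto simp: new_points_def)
        ultimately have "b \<in> B - {0}" "p \<in> P b" using pp pN ord by (auto simp: P_def)
        then show ?thesis by blast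
      qed auto
    qed
    have S: "finite S" "real (card S) \<le> (real Y)\<^sup>2 * log 2 (real_of_int N)"
      using card_small_order_primes[of "nat N" Y] N2 by (auto simp: S_def)
    have finP: "finite (P b)" for b
      by (rule finite_subset[OF _ finite_primes_upto[of x]]) (auto simp: P_def)
    have P: "real (card (P b)) \<le> real (card B) ^ m / real Y" if b: "b \<in> B - {0}" for b
    proof -
      have "Y * card (P b) \<le> card L ^ m"
        unfolding P_def using b m Y by (intro card_large_order_new_points[OF x]) auto
      then have "real (Y * card (P b)) \<le> real (card B ^ m)" unfolding cardL by (simp only: of_nat_le_iff)
      then show ?thesis using Y by (simp add: field_simps)
    qed
    have finU: "finite (\<Union>b\<in>B - {0}. P b)" using finP finB by auto
    have "card (non_eigenvalues x) \<le> card ({..<K} \<union> S \<union> (\<Union>b\<in>B - {0}. P b))"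
      using S(1) finU by (intro card_mono cover) auto
    also have "\<dots> \<le> card {..<K} + card S + card (\<Union>b\<in>B - {0}. P b)"
      using card_Un_le[of "{..<K} \<union> S" "\<Union>b\<in>B - {0}. P b"] card_Un_le[of "{..<K}" S] by linarith
    also have "\<dots> \<le> K + card S + (\<Sum>b\<in>B - {0}. card (P b))"
      using card_UN_le[of "B - {0}" P] finB by simp
    finally have "real (card (non_eigenvalues x)) \<le> real (K + card S + (\<Sum>b\<in>B - {0}. card (P b)))"
      by (simp only: of_nat_le_iff)
    also have "\<dots> = real K + real (card S) + (\<Sum>b\<in>B - {0}. real (card (P b)))" by simp
    also have "(\<Sum>b\<in>B - {0}. real (card (P b))) \<le> (\<Sum>b\<in>B - {0}. real (card B) ^ m / real Y)"
      by (rule sum_mono) (rule P)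
    also have "\<dots> \<le> (\<Sum>b\<in>B. real (card B) ^ m / real Y)"
      using finB by (intro sum_mono2) auto
    also have "\<dots> = real (card B) * (real (card B) ^ m / real Y)" by simp
    finally show "real (card (non_eigenvalues x)) \<le>
        real K + (real Y)\<^sup>2 * log 2 (real_of_int N) + real (card B) * (real (card B) ^ m / real Y)"
      using S(2) by linarith
  qed
qed

text \<open>With Y about x^0.4 and N^m between c x^2 and N c x^2, the number (#B)^m is at most a
  constant times x^1.354, and division by Y leaves x^0.954.\<close>

lemma card_non_eigenvalues_powr_bound:
  assumes small: "real (card B) < real_of_int N powr 0.677"
  obtains K D :: real where "\<And>x. x \<ge> 1 \<Longrightarrow> real (card (non_eigenvalues x)) \<le>
      K + (x powr 0.4 + 1)\<^sup>2 * log 2 (real_of_int N) + D * x powr 0.954"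
proof -
  obtain K :: nat where K: "\<forall>x Y m. x > 0 \<longrightarrow> Y > 0 \<longrightarrow>
      (\<forall>b\<in>B. 2 * radius * (\<bar>real_of_int b\<bar> * x\<^sup>2) < real_of_int N ^ m) \<longrightarrow>
      real (card (non_eigenvalues x)) \<le>
        real K + (real Y)\<^sup>2 * log 2 (real_of_int N) + real (card B) * (real (card B) ^ m / real Y)"
    by (rule card_non_eigenvalues_le)
  define \<beta> where "\<beta> = real_of_int (Max (abs ` B))"
  have \<beta>: "\<bar>real_of_int b\<bar> \<le> \<beta>" if "b \<in> B" for b
  proof -
    have "\<bar>b\<bar> \<le> Max (abs ` B)" using that finB by simp
    then show ?thesis unfolding \<beta>_def by (simp only: of_int_abs[symmetric] of_int_le_iff)
  qed
  have radius0: "radius \<ge> 0" using digit_le_radius[OF zero_mem(2)] by simp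
  have \<beta>0: "\<beta> \<ge> 0" using \<beta>[OF zero_mem(1)] by simp
  \<comment> \<open>The summand 1 makes the separation bound strict and keeps c x^2 \<ge> 1.\<close>
  define c where "c = 2 * radius * \<beta> + 1"
  have c1: "c \<ge> 1" using radius0 \<beta>0 by (simp add: c_def)
  have N1: "real_of_int N > 1" using N2 by simp
  show ?thesis
  proof (rule that[of "real K" "real (card B) * (real_of_int N * c) powr 0.677"])
    fix x :: real assume x: "x \<ge> 1"
    define Y where "Y = nat \<lceil>x powr 0.4\<rceil>"
    have pos: "x powr 0.4 > 0" using x by simp
    have Y: "real Y \<ge> x powr 0.4" "real Y \<le> x powr 0.4 + 1"
      using pos by (simp_all add: Y_def)
    have Y0: "Y > 0" using Y(1) pos by (cases Y) auto
    define t where "t = log (real_of_int N) (c * x\<^sup>2)"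
    have x2: "x\<^sup>2 \<ge> 1" using x by (simp add: one_le_power)
    have cx: "c * x\<^sup>2 \<ge> 1" using c1 x2 mult_mono[of 1 c 1 "x\<^sup>2"] by simp
    have t0: "t \<ge> 0" unfolding t_def using N1 cx by simp
    define m where "m = nat \<lceil>t\<rceil>"
    have m: "real m \<ge> t" "real m \<le> t + 1" using t0 by (simp_all add: m_def)
    have Nm: "real_of_int N ^ m = real_of_int N powr real m" using N1 by (simp add: powr_realpow)
    have Nt: "real_of_int N powr t = c * x\<^sup>2" unfolding t_def using N1 cx by simp
    have lower: "c * x\<^sup>2 \<le> real_of_int N ^ m"
      unfolding Nm Nt[symmetric] using m N1 by (intro powr_mono) auto
    have "real_of_int N powr real m \<le> real_of_int N powr (t + 1)" using m N1 by (intro powr_mono) auto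
    then have upper: "real_of_int N ^ m \<le> real_of_int N * c * x\<^sup>2"
      unfolding Nm powr_add Nt using N1 by (simp add: mult_ac)
    have sep: "2 * radius * (\<bar>real_of_int b\<bar> * x\<^sup>2) < real_of_int N ^ m" if "b \<in> B" for b
    proof -
      have "2 * radius * (\<bar>real_of_int b\<bar> * x\<^sup>2) \<le> 2 * radius * (\<beta> * x\<^sup>2)"
        using \<beta>[OF that] radius0 by (intro mult_left_mono mult_right_mono) auto
      also have "\<dots> < c * x\<^sup>2" using x by (simp add: c_def algebra_simps)
      finally show ?thesis using lower by linarith
    qed
    have "real (card B) ^ m \<le> (real_of_int N powr 0.677) ^ m"
      using small by (intro power_mono) auto
    also have "\<dots> = (real_of_int N ^ m) powr 0.677"
      using N1 by (simp add: powr_powr mult.commute flip: powr_realpow)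
    also have "\<dots> \<le> (real_of_int N * c * x\<^sup>2) powr 0.677"
      using upper N1 by (intro powr_mono2) auto
    also have "\<dots> = (real_of_int N * c) powr 0.677 * x powr 1.354"
    proof -
      have "x\<^sup>2 = x powr 2" using x by simp
      then have "(x\<^sup>2) powr 0.677 = x powr 1.354" by (simp add: powr_powr)
      then show ?thesis using N1 c1 by (simp add: powr_mult)
    qed
    finally have Bm: "real (card B) ^ m \<le> (real_of_int N * c) powr 0.677 * x powr 1.354" .
    have "real (card B) ^ m / real Y \<le> (real_of_int N * c) powr 0.677 * x powr 1.354 / x powr 0.4"
      using Bm Y(1) pos by (intro frac_le) auto
    also have "\<dots> = (real_of_int N * c) powr 0.677 * (x powr 1.354 / x powr 0.4)" by simp
    also have "x powr 1.354 / x powr 0.4 = x powr 0.954"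
      by (simp flip: powr_diff)
    finally have quot: "real (card B) ^ m / real Y \<le> (real_of_int N * c) powr 0.677 * x powr 0.954" .
    have "real (card (non_eigenvalues x)) \<le>
        real K + (real Y)\<^sup>2 * log 2 (real_of_int N) + real (card B) * (real (card B) ^ m / real Y)"
      using x Y0 sep by (intro K[rule_format]) auto
    also have "\<dots> \<le> real K + (x powr 0.4 + 1)\<^sup>2 * log 2 (real_of_int N) +
        real (card B) * ((real_of_int N * c) powr 0.677 * x powr 0.954)"
      using Y(2) N1 quot
      by (intro add_mono mult_right_mono mult_left_mono power_mono order_refl) auto
    finally show "real (card (non_eigenvalues x)) \<le> real K + (x powr 0.4 + 1)\<^sup>2 * log 2 (real_of_int N) +
        real (card B) * (real_of_int N * c) powr 0.677 * x powr 0.954" by (simp add: mult.assoc)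
  qed
qed

lemma prime_counting_split:
  "prime_counting x = count_upto (prime_eigenvalues N B L) x + card (non_eigenvalues x)"
proof -
  have "{p::nat. prime p \<and> real p \<le> x} = {p \<in> prime_eigenvalues N B L. real p \<le> x} \<union> non_eigenvalues x"
    by (auto simp: prime_eigenvalues_def non_eigenvalues_def)
  moreover have "{p \<in> prime_eigenvalues N B L. real p \<le> x} \<inter> non_eigenvalues x = {}"
    by (auto simp: non_eigenvalues_def)
  moreover have "finite {p \<in> prime_eigenvalues N B L. real p \<le> x}" "finite (non_eigenvalues x)"
    by (rule finite_subset[OF _ finite_primes_upto[of x]];
        auto simp: prime_eigenvalues_def non_eigenvalues_def)+
  ultimately show ?thesis
    unfolding prime_counting_def count_upto_def by (simp add: card_Un_disjoint)
qed

text \<open>The exceptions are O(x^0.954), while the number of primes is at least a constant times x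
  / ln x, so they have density 0 among the primes.\<close>

lemma eigenvalue_density_1:
  assumes "real (card B) < real_of_int N powr 0.677"
  shows "((\<lambda>x. real (count_upto (prime_eigenvalues N B L) x) / real (prime_counting x)) \<longlongrightarrow> 1) at_top"
proof -
  obtain K D where KD: "\<And>x. x \<ge> 1 \<Longrightarrow> real (card (non_eigenvalues x)) \<le>
      K + (x powr 0.4 + 1)\<^sup>2 * log 2 (real_of_int N) + D * x powr 0.954"
    using card_non_eigenvalues_powr_bound[OF assms] by blast
  define W where "W = log 2 (real_of_int N)"
  let ?f = "\<lambda>x::real. (K + (x powr 0.4 + 1)\<^sup>2 * W + D * x powr 0.954) / ((x - 3) / 2 * ln 4 / ln x)"
  have "(?f \<longlongrightarrow> 0) at_top" by real_asymp
  have "((\<lambda>x. real (card (non_eigenvalues x)) / real (prime_counting x)) \<longlongrightarrow> 0) at_top"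
  proof (rule tendsto_sandwich[OF _ _ tendsto_const \<open>(?f \<longlongrightarrow> 0) at_top\<close>])
    show "\<forall>\<^sub>F x in at_top. 0 \<le> real (card (non_eigenvalues x)) / real (prime_counting x)"
      by (intro always_eventually allI) simp
    show "\<forall>\<^sub>F x in at_top. real (card (non_eigenvalues x)) / real (prime_counting x) \<le> ?f x"
      using eventually_gt_at_top[of 3]
    proof eventually_elim
      case (elim x)
      have "(x - 3) / 2 * ln 4 / ln x > 0" using elim by (intro divide_pos_pos mult_pos_pos) auto
      then show ?case
        using elim KD[of x] prime_counting_lower_bound[of x]
        by (intro frac_le) (auto simp: W_def intro: order_trans[of 0])
    qed
  qed
  then have "((\<lambda>x. 1 - real (card (non_eigenvalues x)) / real (prime_counting x)) \<longlongrightarrow> 1 - 0) at_top"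
    by (intro tendsto_intros)
  moreover have "\<forall>\<^sub>F x in at_top. 1 - real (card (non_eigenvalues x)) / real (prime_counting x) =
      real (count_upto (prime_eigenvalues N B L) x) / real (prime_counting x)"
    using eventually_gt_at_top[of 3]
  proof eventually_elim
    case (elim x)
    have "(x - 3) / 2 * ln 4 / ln x > 0" using elim by (intro divide_pos_pos mult_pos_pos) auto
    then have "real (prime_counting x) > 0" using prime_counting_lower_bound[of x] elim by linarith
    moreover have "real (count_upto (prime_eigenvalues N B L) x) =
        real (prime_counting x) - real (card (non_eigenvalues x))"
      using prime_counting_split[of x] by simp
    ultimately show ?case by (simp add: diff_divide_distrib)
  qed
  ultimately show ?thesis using tendsto_cong by force
qed

end

section \<open>Infinitude from positive density\<close>

lemma filterlim_prime_counting: "filterlim (\<lambda>x. real (prime_counting x)) at_top at_top"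
proof (rule filterlim_at_top_mono)
  show "filterlim (\<lambda>x::real. (x - 3) / 2 * ln 4 / ln x) at_top at_top" by real_asymp
  show "\<forall>\<^sub>F x in at_top. (x - 3) / 2 * ln 4 / ln x \<le> real (prime_counting x)"
    using eventually_ge_at_top[of 3] by eventually_elim (rule prime_counting_lower_bound)
qed

text \<open>A finite set has a bounded count while the number of primes tends to infinity, so the
  quotient would tend to 0.\<close>

lemma infinite_if_positive_density:
  assumes lim: "((\<lambda>x. real (count_upto P x) / real (prime_counting x)) \<longlongrightarrow> d) at_top" and "d \<noteq> 0"
  shows "infinite P"
proof
  assume fin: "finite P"
  have upper: "((\<lambda>x. real (card P) / real (prime_counting x)) \<longlongrightarrow> 0) at_top"
    by (intro real_tendsto_divide_at_top[OF tendsto_const] filterlim_prime_counting)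
  have "((\<lambda>x. real (count_upto P x) / real (prime_counting x)) \<longlongrightarrow> 0) at_top"
  proof (rule tendsto_sandwich[OF _ _ tendsto_const upper])
    show "\<forall>\<^sub>F x in at_top. real (count_upto P x) / real (prime_counting x) \<le>
        real (card P) / real (prime_counting x)"
      using fin by (intro always_eventually allI divide_right_mono of_nat_mono)
        (auto simp: count_upto_def intro!: card_mono)
  qed (intro always_eventually allI, simp)
  then show False using tendsto_unique[OF _ lim] assms(2) by simp
qed

theorem theorem1p1:
  fixes N :: int and B L :: "int set"
  assumes "hadamard_triple N B L" and "0 \<in> B \<inter> L"
  shows
    "(real (card B) < real_of_int N powr 0.677 \<longrightarrow>
        infinite (prime_eigenvalues N B L) \<and>
        Liminf at_top (\<lambda>x :: real. ereal (real (count_upto (prime_eigenvalues N B L) x) /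
                                          real (prime_counting x))) > 0) \<and>
     (real (card B) < real_of_int N powr (1 / 2) \<longrightarrow>
        ((\<lambda>x :: real. real (count_upto (prime_eigenvalues N B L) x) /
                      real (prime_counting x)) \<longlongrightarrow> 1) at_top)"
proof -
  interpret based_hadamard_triple N B L
    using assms by unfold_locales auto
  let ?r = "\<lambda>x. real (count_upto (prime_eigenvalues N B L) x) / real (prime_counting x)"
  have "Liminf at_top (\<lambda>x. ereal (?r x)) = ereal 1"
    if "real (card B) < real_of_int N powr 0.677"
    using eigenvalue_density_1[OF that]
    by (intro lim_imp_Liminf) (simp_all add: trivial_limit_at_top_linorder)
  \<comment> \<open>Since N > 1, the assumption of the second part implies that of the first, and
    both follow from density 1.\<close>
  moreover have "real_of_int N powr (1 / 2) \<le> real_of_int N powr 0.677"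
    using N2 by (intro powr_mono) auto
  ultimately show ?thesis
    using eigenvalue_density_1 infinite_if_positive_density[OF eigenvalue_density_1] by force
qed

end
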